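(* Consider the flow $S^t$ of a dynamical system in $\mathbb R^n$ with a globally stable Milnor attractor $\mathcal A$ of Sell type, and let $\mu$ be the invariant physical measure on $\mathcal A$. Let $\mathbf s=(s_1,\dots,s_n)$ be principal eigenfunctions of $U^t$ that vanish on $\mathcal A$ and correspond to eigenvalues $\boldsymbol\lambda=(\lambda_1,\dots,\lambda_n)$ with negative real parts. Let the Modulated Fock Space (MFS) be the space of functions $f\circ\mathbf s$, $f$ entire on $\mathbb C^n$, such that $$\int_{\mathbb C^n}|f\circ\mathbf s|^2e^{-|\mathbf s|^2}\,d\mathbf s<\infty,$$ which is the RKHS with respect to the kernel $K(\mathbf z,\mathbf w)=e^{\mathbf s(\mathbf z)\cdot\mathbf s(\mathbf w)}$, $\mathbf z,\mathbf w\in\mathbb C^n$. Let $\mathcal H_{\mathcal A}=L^2(\mu)$ and $\tilde{\mathcal H}_{\mathcal B}$ be the MFS. Then the spectrum of the Koopman operator $U^t$ (on $\mathcal H=\mathcal H_{\mathcal A}\otimes\mathcal H_{\mathcal B}$) is given by $$\sigma(U^t)=\mathrm{cl}\big(P(\sigma(U^t|_{\mathcal H_{\mathcal A}}),\sigma(U^t|_{\mathcal H_{\mathcal B}}))\big)=\mathrm{cl}\big(P(\sigma(U^t|_{\mathcal H_{\mathcal A}}),\{e^{(\mathbf k\cdot\boldsymbol\lambda)t}:\mathbf k=(k_1,\dots,k_n)\in\mathbb N^n\})\big).$$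
   Context: $U^tf=f\circ S^t$. For $E_1,E_2\subset\mathbb C$, $P(E_1,E_2)=\{ab:a\in E_1,b\in E_2\}$; $\mathrm{cl}$ is closure; $\mathbb N$ includes $0$. The integral is taken over the values $\mathbf s\in\mathbb C^n$ (i.e. it is $\int_{\mathbb C^n}|f(\mathbf s)|^2e^{-|\mathbf s|^2}d\mathbf s$ with Lebesgue measure), and in the kernel the dot is the Hermitian product on $\mathbb C^n$. $\mathcal H_{\mathcal B}$ is $\tilde{\mathcal H}_{\mathcal B}$ together with the constant function $\mathbf 1$. $U^t$ acts on $\mathcal H=\mathcal H_{\mathcal A}\otimes\mathcal H_{\mathcal B}$ as $U^t|_{\mathcal H_{\mathcal A}}\otimes U^t|_{\mathcal H_{\mathcal B}}$, and the elements of $L^2(\mu)$ are regarded as functions on the state space. An eigenfunction at $\lambda$ satisfies $U^ts=e^{\lambda t}s$; the principal eigenfunctions are the generating ones (those given by the linearizing coordinates), so that the monomials $s_1^{k_1}\cdots s_n^{k_n}$ are eigenfunctions at $\mathbf k\cdot\boldsymbol\lambda$. Attractor of Sell type: a smooth compact normally hyperbolic attracting invariant manifold $\mathcal A$, near which coordinates $(\mathbf u,\mathbf y)$ ($\mathbf u$ along $\mathcal A$, $\mathcal A=\{\mathbf y=0\}$) exist in which the system has the form $\dot{\mathbf y}=A(\mathbf u)\mathbf y+\mathbf v(\mathbf y,\mathbf u)$, $\dot{\mathbf u}=\boldsymbol\omega(\mathbf u)+\boldsymbol\Omega(\mathbf y,\mathbf u)$ with $\mathbf v(0,\mathbf u)=D_{\mathbf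 y}\mathbf v(0,\mathbf u)=\boldsymbol\Omega(0,\mathbf u)=0$, and such that this system is smoothly conjugate near $\mathcal A$ to the skew-linear system $\dot{\mathbf y}=A(\mathbf u)\mathbf y$, $\dot{\mathbf u}=\boldsymbol\omega(\mathbf u)$. *)

theory Defs
  imports "HOL-Probability.Probability"
begin

section \<open>Smooth maps and submanifolds\<close>

primrec Ck_on :: "nat \<Rightarrow> 'a::euclidean_space set \<Rightarrow> ('a \<Rightarrow> 'b::real_normed_vector) \<Rightarrow> bool" where
  "Ck_on 0 U f \<longleftrightarrow> continuous_on U f"
| "Ck_on (Suc k) U f \<longleftrightarrow>
     (\<forall>x\<in>U. f differentiable (at x)) \<and>
     (\<forall>v. Ck_on k U (\<lambda>x. frechet_derivative f (at x) v))"

definition smooth_on :: "'a::euclidean_space set \<Rightarrow> ('a \<Rightarrow> 'b::real_normed_vector) \<Rightarrow> bool" where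
  "smooth_on U f \<longleftrightarrow> open U \<and> (\<forall>k. Ck_on k U f)"

text \<open>On a set that need not be open, smooth means: locally the restriction of a smooth function.\<close>

definition smooth_on_subset :: "'a::euclidean_space set \<Rightarrow> ('a \<Rightarrow> 'b::real_normed_vector) \<Rightarrow> bool" where
  "smooth_on_subset S f \<longleftrightarrow>
     (\<forall>x\<in>S. \<exists>U g. x \<in> U \<and> smooth_on U g \<and> (\<forall>z\<in>U \<inter> S. g z = f z))"

definition smooth_submanifold :: "nat \<Rightarrow> 'a::euclidean_space set \<Rightarrow> bool" where
  "smooth_submanifold d M \<longleftrightarrow>
     (\<forall>p\<in>M. \<exists>U V \<phi> \<psi> T.
        p \<in> U \<and> smooth_on U \<phi> \<and> smooth_on V \<psi> \<and> \<phi> ` U = V \<and>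
        (\<forall>x\<in>U. \<psi> (\<phi> x) = x) \<and> (\<forall>z\<in>V. \<phi> (\<psi> z) = z) \<and>
        subspace (T :: 'a set) \<and> dim T = d \<and> \<phi> ` (U \<inter> M) = V \<inter> T)"

definition tangent_space :: "'a::euclidean_space set \<Rightarrow> 'a \<Rightarrow> 'a set" where
  "tangent_space M p =
     {v. \<exists>\<gamma>. \<gamma> 0 = p \<and> (\<forall>r::real. \<gamma> r \<in> M) \<and> (\<gamma> has_vector_derivative v) (at 0)}"

section \<open>Flows, attractors and physical measures\<close>

text \<open>Only nonnegative times are constrained, so that systems whose solutions blow up in backward
  time are included; every complete flow restricts to such an \<open>S\<close>.\<close>

definition flow_of :: "('a::euclidean_space \<Rightarrow> 'a) \<Rightarrow> (real \<Rightarrow> 'a \<Rightarrow> 'a) \<Rightarrow> bool" where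
  "flow_of F S \<longleftrightarrow>
     Ck_on 1 UNIV F \<and>
     (\<forall>x. S 0 x = x) \<and>
     (\<forall>r\<ge>0. \<forall>t\<ge>0. \<forall>x. S (r + t) x = S r (S t x)) \<and>
     (\<forall>x. \<forall>t\<ge>0. ((\<lambda>r. S r x) has_vector_derivative F (S t x)) (at t within {0..})) \<and>
     continuous_on ({0..} \<times> UNIV) (\<lambda>(t, x). S t x)"

definition invariant_set :: "(real \<Rightarrow> 'a \<Rightarrow> 'a) \<Rightarrow> 'a set \<Rightarrow> bool" where
  "invariant_set S A \<longleftrightarrow> (\<forall>t\<ge>0. S t ` A = A)"

text \<open>Points whose orbit converges to \<open>A\<close>.  Formulating convergence with open neighbourhoods
  makes the realm of the empty set empty; for compact \<open>A\<close> it says that the distance of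
  \<open>S t x\<close> to \<open>A\<close> tends to 0.\<close>

definition realm_of_attraction ::
    "(real \<Rightarrow> 'a \<Rightarrow> 'a) \<Rightarrow> 'a::topological_space set \<Rightarrow> 'a set" where
  "realm_of_attraction S A =
     {x. \<forall>U. open U \<longrightarrow> A \<subseteq> U \<longrightarrow> (\<forall>\<^sub>F t in at_top. S t x \<in> U)}"

definition milnor_attractor ::
    "(real \<Rightarrow> 'a \<Rightarrow> 'a) \<Rightarrow> 'a::euclidean_space set \<Rightarrow> bool" where
  "milnor_attractor S A \<longleftrightarrow>
     compact A \<and> invariant_set S A \<and>
     \<not> negligible (realm_of_attraction S A) \<and>
     (\<forall>A'. closed A' \<longrightarrow> A' \<subset> A \<longrightarrow>
        \<not> negligible (realm_of_attraction S A - realm_of_attraction S A'))"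

definition globally_stable ::
    "(real \<Rightarrow> 'a \<Rightarrow> 'a) \<Rightarrow> 'a::topological_space set \<Rightarrow> bool" where
  "globally_stable S A \<longleftrightarrow>
     (\<forall>U. open U \<longrightarrow> A \<subseteq> U \<longrightarrow>
        (\<exists>V. open V \<and> A \<subseteq> V \<and> (\<forall>t\<ge>0. S t ` V \<subseteq> U))) \<and>
     realm_of_attraction S A = UNIV"

definition invariant_physical_measure ::
    "(real \<Rightarrow> 'a \<Rightarrow> 'a) \<Rightarrow> 'a set \<Rightarrow> 'a::euclidean_space measure \<Rightarrow> bool" where
  "invariant_physical_measure S A \<mu> \<longleftrightarrow>
     prob_space \<mu> \<and> sets \<mu> = sets borel \<and> emeasure \<mu> A = 1 \<and>
     (\<forall>t\<ge>0. distr \<mu> borel (S t) = \<mu>) \<and>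
     \<not> negligible {x. \<forall>f :: 'a \<Rightarrow> real. continuous_on UNIV f \<and> bounded (range f) \<longrightarrow>
         ((\<lambda>T. integral {0..T} (\<lambda>r. f (S r x)) / T) \<longlongrightarrow> (LINT x|\<mu>. f x)) at_top}"

section \<open>Attractors of Sell type\<close>

text \<open>There is an invariant normal bundle on which the linearized flow contracts, and contracts
  more strongly than along \<open>A\<close>.\<close>

definition normally_hyperbolic_attracting ::
    "(real \<Rightarrow> 'a \<Rightarrow> 'a) \<Rightarrow> 'a::euclidean_space set \<Rightarrow> bool" where
  "normally_hyperbolic_attracting S A \<longleftrightarrow>
     (\<exists>(N :: 'a \<Rightarrow> 'a set) C \<nu>. C > 0 \<and> \<nu> > 0 \<and>
        closed {(p, v). p \<in> A \<and> v \<in> N p} \<and>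
        (\<forall>p\<in>A. subspace (N p) \<and> tangent_space A p \<inter> N p = {0} \<and>
           {w + v | w v. w \<in> tangent_space A p \<and> v \<in> N p} = UNIV \<and>
           (\<forall>t\<ge>0. \<forall>v\<in>N p.
              let DS = frechet_derivative (S t) (at p) in
              DS v \<in> N (S t p) \<and>
              norm (DS v) \<le> C * exp (- \<nu> * t) * norm v \<and>
              (\<forall>w\<in>tangent_space A p.
                 norm (DS v) * norm w \<le> C * exp (- \<nu> * t) * norm v * norm (DS w)))))"

text \<open>Coordinates \<open>(u, y)\<close> near \<open>A\<close>: a diffeomorphism from the neighbourhood \<open>V\<close> of \<open>A\<close> onto
  a neighbourhood of \<open>A \<times> {0}\<close> in \<open>A\<close> times the Euclidean space of \<open>y\<close>.  The coordinate along
  \<open>A\<close> is a point of \<open>A\<close> itself, viewed in the ambient space.\<close>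

definition coordinates_near ::
    "'a::euclidean_space set \<Rightarrow> 'a set \<Rightarrow> ('a \<Rightarrow> 'a) \<Rightarrow> ('a \<Rightarrow> 'b::euclidean_space) \<Rightarrow> bool" where
  "coordinates_near A V u y \<longleftrightarrow>
     A \<subseteq> V \<and> smooth_on V u \<and> smooth_on V y \<and> u ` V \<subseteq> A \<and>
     {x\<in>V. y x = 0} = A \<and>
     inj_on (\<lambda>x. (u x, y x)) V \<and>
     A \<times> {0} \<subseteq> (\<lambda>x. (u x, y x)) ` V \<and>
     openin (top_of_set (A \<times> UNIV)) ((\<lambda>x. (u x, y x)) ` V) \<and>
     smooth_on_subset ((\<lambda>x. (u x, y x)) ` V) (the_inv_into V (\<lambda>x. (u x, y x)))"

text \<open>The derivative of a coordinate in direction \<open>F x\<close> is its time derivative along the flow.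
  The coordinates \<open>(u, y)\<close> in the arguments are the linearizing ones, i.e. the original
  coordinates \<open>(u\<^sub>0, y\<^sub>0)\<close> composed with the conjugacy to the skew-linear system.\<close>

definition sell_type_attractor ::
    "(real^'n \<Rightarrow> real^'n) \<Rightarrow> (real \<Rightarrow> real^'n \<Rightarrow> real^'n) \<Rightarrow> (real^'n) set \<Rightarrow>
     (real^'n \<Rightarrow> real^'n) \<Rightarrow> (real^'n \<Rightarrow> real^'m) \<Rightarrow> bool" where
  "sell_type_attractor F S A u y \<longleftrightarrow>
     compact A \<and> (\<exists>d. smooth_submanifold d A) \<and> invariant_set S A \<and>
     normally_hyperbolic_attracting S A \<and>
     (\<exists>V\<^sub>0 (u\<^sub>0 :: real^'n \<Rightarrow> real^'n) (y\<^sub>0 :: real^'n \<Rightarrow> real^'m)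
        (B :: real^'n \<Rightarrow> real^'m^'m) (v :: real^'m \<Rightarrow> real^'n \<Rightarrow> real^'m)
        (\<omega> :: real^'n \<Rightarrow> real^'n) (\<Omega> :: real^'m \<Rightarrow> real^'n \<Rightarrow> real^'n).
        coordinates_near A V\<^sub>0 u\<^sub>0 y\<^sub>0 \<and>
        (\<forall>x\<in>V\<^sub>0.
           frechet_derivative y\<^sub>0 (at x) (F x) = B (u\<^sub>0 x) *v y\<^sub>0 x + v (y\<^sub>0 x) (u\<^sub>0 x) \<and>
           frechet_derivative u\<^sub>0 (at x) (F x) = \<omega> (u\<^sub>0 x) + \<Omega> (y\<^sub>0 x) (u\<^sub>0 x)) \<and>
        (\<forall>p\<in>A. v 0 p = 0 \<and> ((\<lambda>\<eta>. v \<eta> p) has_derivative (\<lambda>_. 0)) (at 0) \<and> \<Omega> 0 p = 0) \<and>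
        (\<exists>V. coordinates_near A V u y \<and>
           (\<forall>x\<in>V.
              frechet_derivative y (at x) (F x) = B (u x) *v y x \<and>
              frechet_derivative u (at x) (F x) = \<omega> (u x))))"

section \<open>Koopman operator and principal eigenfunctions\<close>

definition koopman :: "(real \<Rightarrow> 'a \<Rightarrow> 'a) \<Rightarrow> real \<Rightarrow> ('a \<Rightarrow> complex) \<Rightarrow> 'a \<Rightarrow> complex" where
  "koopman S t f = f \<circ> S t"

definition koopman_eigenfunction ::
    "(real \<Rightarrow> 'a \<Rightarrow> 'a) \<Rightarrow> complex \<Rightarrow> ('a \<Rightarrow> complex) \<Rightarrow> bool" where
  "koopman_eigenfunction S l f \<longleftrightarrow>
     (\<exists>x. f x \<noteq> 0) \<and>
     (\<forall>t\<ge>0. koopman S t f = (\<lambda>x. exp (l * complex_of_real t) * f x))"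

text \<open>Principal eigenfunctions vanishing on \<open>A\<close> are the eigenfunctions which, near \<open>A\<close>, are
  linear coordinates on the fibres of the linearizing coordinates \<open>(u, y)\<close>:
  \<open>s = W(u) y\<close> with \<open>W(u)\<close> an invertible complex matrix depending continuously on \<open>u\<close>
  (complex since the eigenvalues may be).\<close>

definition principal_eigenfunctions ::
    "(real \<Rightarrow> real^'n \<Rightarrow> real^'n) \<Rightarrow> (real^'n) set \<Rightarrow>
     (real^'n \<Rightarrow> real^'n) \<Rightarrow> (real^'n \<Rightarrow> real^'m) \<Rightarrow>
     (real^'n \<Rightarrow> complex^'m) \<Rightarrow> complex^'m \<Rightarrow> bool" where
  "principal_eigenfunctions S A u y s lam \<longleftrightarrow>
     (\<forall>j. koopman_eigenfunction S (lam $ j) (\<lambda>x. s x $ j)) \<and>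
     (\<forall>x\<in>A. s x = 0) \<and>
     (\<exists>V (W :: real^'n \<Rightarrow> complex^'m^'m). open V \<and> A \<subseteq> V \<and>
        continuous_on A W \<and> (\<forall>p\<in>A. invertible (W p)) \<and>
        (\<forall>x\<in>V. s x = W (u x) *v (\<chi> j. complex_of_real (y x $ j))))"

section \<open>Hilbert spaces of functions\<close>

text \<open>A space of complex functions with a (semi-)inner product, linear in the first argument.
  Vectors at seminorm distance 0 are identified; the identification is built into the
  notions below instead of passing to equivalence classes.\<close>

record 'x ipspace =
  vecs :: "('x \<Rightarrow> complex) set"
  ip :: "('x \<Rightarrow> complex) \<Rightarrow> ('x \<Rightarrow> complex) \<Rightarrow> complex"

definition nrm :: "'x ipspace \<Rightarrow> ('x \<Rightarrow> complex) \<Rightarrow> real" where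
  "nrm H f = sqrt (Re (ip H f f))"

definition cauchy_in :: "'x ipspace \<Rightarrow> (nat \<Rightarrow> 'x \<Rightarrow> complex) \<Rightarrow> bool" where
  "cauchy_in H X \<longleftrightarrow>
     (\<forall>n. X n \<in> vecs H) \<and>
     (\<forall>e>0. \<exists>N. \<forall>m\<ge>N. \<forall>n\<ge>N. nrm H (\<lambda>i. X m i - X n i) < e)"

definition hilbert :: "'x ipspace \<Rightarrow> bool" where
  "hilbert H \<longleftrightarrow>
     (\<lambda>_. 0) \<in> vecs H \<and>
     (\<forall>f\<in>vecs H. \<forall>g\<in>vecs H. (\<lambda>i. f i + g i) \<in> vecs H) \<and>
     (\<forall>c. \<forall>f\<in>vecs H. (\<lambda>i. c * f i) \<in> vecs H) \<and>
     (\<forall>f\<in>vecs H. \<forall>g\<in>vecs H. \<forall>h\<in>vecs H. ip H (\<lambda>i. f i + g i) h = ip H f h + ip H g h) \<and>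
     (\<forall>c. \<forall>f\<in>vecs H. \<forall>g\<in>vecs H. ip H (\<lambda>i. c * f i) g = c * ip H f g) \<and>
     (\<forall>f\<in>vecs H. \<forall>g\<in>vecs H. ip H g f = cnj (ip H f g)) \<and>
     (\<forall>f\<in>vecs H. Re (ip H f f) \<ge> 0) \<and>
     (\<forall>X. cauchy_in H X \<longrightarrow> (\<exists>f\<in>vecs H. (\<lambda>n. nrm H (\<lambda>i. X n i - f i)) \<longlonglongrightarrow> 0))"

definition rkhs :: "'x ipspace \<Rightarrow> ('x \<Rightarrow> 'x \<Rightarrow> complex) \<Rightarrow> bool" where
  "rkhs H K \<longleftrightarrow>
     hilbert H \<and> (\<forall>f\<in>vecs H. nrm H f = 0 \<longrightarrow> f = (\<lambda>_. 0)) \<and>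
     (\<forall>w. (\<lambda>z. K z w) \<in> vecs H) \<and>
     (\<forall>w. \<forall>f\<in>vecs H. f w = ip H f (\<lambda>z. K z w))"

definition bounded_operator ::
    "'x ipspace \<Rightarrow> (('x \<Rightarrow> complex) \<Rightarrow> 'x \<Rightarrow> complex) \<Rightarrow> bool" where
  "bounded_operator H T \<longleftrightarrow>
     (\<forall>f\<in>vecs H. T f \<in> vecs H) \<and>
     (\<forall>f\<in>vecs H. \<forall>g\<in>vecs H. nrm H (\<lambda>i. T (\<lambda>j. f j + g j) i - (T f i + T g i)) = 0) \<and>
     (\<forall>c. \<forall>f\<in>vecs H. nrm H (\<lambda>i. T (\<lambda>j. c * f j) i - c * T f i) = 0) \<and>
     (\<exists>C. \<forall>f\<in>vecs H. nrm H (T f) \<le> C * nrm H f)"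

definition spectrum ::
    "'x ipspace \<Rightarrow> (('x \<Rightarrow> complex) \<Rightarrow> 'x \<Rightarrow> complex) \<Rightarrow> complex set" where
  "spectrum H T = {z. \<not> (\<exists>R. bounded_operator H R \<and>
     (\<forall>f\<in>vecs H.
        nrm H (\<lambda>i. R (\<lambda>j. T f j - z * f j) i - f i) = 0 \<and>
        nrm H (\<lambda>i. (T (R f) i - z * R f i) - f i) = 0))}"

subsection \<open>Tensor product\<close>

text \<open>A finite sum of elementary tensors is represented by the finitely supported function
  that maps the pair \<open>(f, g)\<close> to the coefficient of \<open>f \<otimes> g\<close>.  With the product inner product,
  identifying vectors at distance 0 is exactly the passage from formal sums to the algebraic
  tensor product.\<close>

definition alg_tensor ::
    "'x ipspace \<Rightarrow> 'y ipspace \<Rightarrow> (('x \<Rightarrow> complex) \<times> ('y \<Rightarrow> complex)) ipspace" where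
  "alg_tensor H K =
     \<lparr> vecs = {c. finite {p. c p \<noteq> 0} \<and> {p. c p \<noteq> 0} \<subseteq> vecs H \<times> vecs K},
       ip = (\<lambda>c d. \<Sum>p | c p \<noteq> 0. \<Sum>q | d q \<noteq> 0.
               c p * cnj (d q) * (ip H (fst p) (fst q) * ip K (snd p) (snd q))) \<rparr>"

definition alg_tensor_map ::
    "(('x \<Rightarrow> complex) \<Rightarrow> 'x \<Rightarrow> complex) \<Rightarrow> (('y \<Rightarrow> complex) \<Rightarrow> 'y \<Rightarrow> complex) \<Rightarrow>
     (('x \<Rightarrow> complex) \<times> ('y \<Rightarrow> complex) \<Rightarrow> complex) \<Rightarrow>
     ('x \<Rightarrow> complex) \<times> ('y \<Rightarrow> complex) \<Rightarrow> complex" where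
  "alg_tensor_map T1 T2 c =
     (\<lambda>q. \<Sum>p | c p \<noteq> 0 \<and> (T1 (fst p), T2 (snd p)) = q. c p)"

text \<open>The vectors of the completion are the Cauchy sequences \<open>n \<mapsto> (\<lambda>i. X (n, i))\<close>, again
  identified when at distance 0.\<close>

definition completion :: "'x ipspace \<Rightarrow> (nat \<times> 'x) ipspace" where
  "completion H =
     \<lparr> vecs = {X. cauchy_in H (\<lambda>n i. X (n, i))},
       ip = (\<lambda>X Y. lim (\<lambda>n. ip H (\<lambda>i. X (n, i)) (\<lambda>i. Y (n, i)))) \<rparr>"

definition completion_map ::
    "(('x \<Rightarrow> complex) \<Rightarrow> 'x \<Rightarrow> complex) \<Rightarrow> (nat \<times> 'x \<Rightarrow> complex) \<Rightarrow> nat \<times> 'x \<Rightarrow> complex" where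
  "completion_map T X = (\<lambda>(n, i). T (\<lambda>j. X (n, j)) i)"

definition hilbert_tensor (infixr \<open>\<otimes>\<^sub>H\<close> 70) where
  "H \<otimes>\<^sub>H K = completion (alg_tensor H K)"

definition tensor_map (infixr \<open>\<otimes>\<^sub>o\<close> 70) where
  "T1 \<otimes>\<^sub>o T2 = completion_map (alg_tensor_map T1 T2)"

definition elementary_tensor ::
    "('x \<Rightarrow> complex) \<Rightarrow> ('y \<Rightarrow> complex) \<Rightarrow> nat \<times> ('x \<Rightarrow> complex) \<times> ('y \<Rightarrow> complex) \<Rightarrow> complex" where
  "elementary_tensor f g = (\<lambda>(n, p). if p = (f, g) then 1 else 0)"

lemma ip_elementary_tensor:
  "ip (H \<otimes>\<^sub>H K) (elementary_tensor f g) (elementary_tensor f' g') = ip H f f' * ip K g g'"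
  by (simp add: hilbert_tensor_def completion_def alg_tensor_def elementary_tensor_def)

lemma elementary_tensor_in_hilbert_tensor:
  assumes "f \<in> vecs H" "g \<in> vecs K"
  shows "elementary_tensor f g \<in> vecs (H \<otimes>\<^sub>H K)"
  using assms
  by (auto simp: hilbert_tensor_def completion_def alg_tensor_def elementary_tensor_def
      cauchy_in_def nrm_def split: if_splits)

lemma tensor_map_elementary_tensor:
  "(T1 \<otimes>\<^sub>o T2) (elementary_tensor f g) = elementary_tensor (T1 f) (T2 g)"
proof -
  have *: "{p. p = (f, g) \<and> (T1 (fst p), T2 (snd p)) = q} =
      (if q = (T1 f, T2 g) then {(f, g)} else {})" for q
    by auto
  show ?thesis
    by (auto simp: tensor_map_def completion_map_def alg_tensor_map_def elementary_tensor_def *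
        fun_eq_iff)
qed

subsection \<open>The on-attractor and off-attractor spaces\<close>

definition L2_space :: "'a measure \<Rightarrow> 'a ipspace" where
  "L2_space \<mu> =
     \<lparr> vecs = {f. f \<in> borel_measurable \<mu> \<and> integrable \<mu> (\<lambda>x. (cmod (f x))\<^sup>2)},
       ip = (\<lambda>f g. LINT x|\<mu>. f x * cnj (g x)) \<rparr>"

definition entire :: "(complex^'m \<Rightarrow> complex) \<Rightarrow> bool" where
  "entire f \<longleftrightarrow> (\<forall>z. \<exists>D. (f has_derivative D) (at z) \<and> (\<forall>c v. D (c *s v) = c * D v))"

definition fock :: "(complex^'m \<Rightarrow> complex) set" where
  "fock = {f. entire f \<and> integrable lborel (\<lambda>z. (cmod (f z))\<^sup>2 * exp (- (norm z)\<^sup>2))}"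

text \<open>The entire function \<open>f\<close> with \<open>\<phi> = f \<circ> s\<close>; it is unique for principal eigenfunctions,
  because near the attractor their values fill a neighbourhood of 0 in a totally real
  subspace of maximal dimension.\<close>

definition fock_rep :: "('a \<Rightarrow> complex^'m) \<Rightarrow> ('a \<Rightarrow> complex) \<Rightarrow> complex^'m \<Rightarrow> complex" where
  "fock_rep s \<phi> = (THE f. f \<in> fock \<and> \<phi> = f \<circ> s)"

text \<open>The factor \<open>1 / \<pi>^m\<close> is the normalization under which the kernel is exactly
  \<open>exp (s(z) \<cdot> s(w))\<close>.\<close>

definition modulated_fock_space :: "('a \<Rightarrow> complex^'m) \<Rightarrow> 'a ipspace" where
  "modulated_fock_space s =
     \<lparr> vecs = {f \<circ> s | f. f \<in> fock},
       ip = (\<lambda>\<phi> \<psi>. complex_of_real (1 / pi ^ CARD('m)) *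
               (LINT z|lborel. fock_rep s \<phi> z * cnj (fock_rep s \<psi> z) *
                  complex_of_real (exp (- (norm z)\<^sup>2)))) \<rparr>"

text \<open>The constant \<open>1 = 1 \<circ> s\<close> already belongs to the modulated Fock space, so adjoining
  the constants leaves the inner product unchanged.\<close>

definition off_attractor_space :: "('a \<Rightarrow> complex^'m) \<Rightarrow> 'a ipspace" where
  "off_attractor_space s =
     \<lparr> vecs = {(\<lambda>x. \<phi> x + c) | \<phi> c. \<phi> \<in> vecs (modulated_fock_space s)},
       ip = ip (modulated_fock_space s) \<rparr>"

definition hermitian_dot :: "complex^'m \<Rightarrow> complex^'m \<Rightarrow> complex" where
  "hermitian_dot z w = (\<Sum>j\<in>UNIV. z $ j * cnj (w $ j))"

definition setprod :: "complex set \<Rightarrow> complex set \<Rightarrow> complex set" where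
  "setprod E1 E2 = {a * b | a b. a \<in> E1 \<and> b \<in> E2}"

end

theory Submission
  imports Defs "HOL-Complex_Analysis.Complex_Analysis"
begin

text \<open>On the off-attractor space the Koopman operator is diagonal: \<open>U f(s) = f(D s)\<close> with
  \<open>D = diag(exp (\<lambda>\<^sub>j t))\<close>, so the normalized monomials in \<open>s\<close> form an orthonormal basis of
  eigenfunctions with eigenvalues \<open>c\<^sub>k = exp ((k \<cdot> \<lambda>) t)\<close>.  Expanding the second tensor factor in this
  basis identifies the tensor product with a Hilbert sum of copies of \<open>L\<^sup>2(\<mu>)\<close> on which the
  operator acts as \<open>c\<^sub>k U\<close> on the \<open>k\<close>-th copy, and \<open>U\<close> is an isometry since \<open>\<mu>\<close> is invariant.
  A point \<open>z\<close> is outside the spectrum of the sum iff the inverses of \<open>c\<^sub>k U - z\<close> exist and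
  are uniformly bounded.  Only finitely many \<open>c\<^sub>k\<close> exceed a given modulus, and for small \<open>c\<^sub>k\<close> the
  Neumann series gives a uniform bound if \<open>z \<noteq> 0\<close>; hence the spectrum is the closure of the union of the
  sets \<open>c\<^sub>k \<sigma>(U)\<close>.  For \<open>z = 0\<close> one uses that \<open>1 \<in> \<sigma>(U)\<close>.

  The kernel of the Fock space reproduces because Gaussian means of entire functions are their
  values at 0; the monomials are orthogonal by invariance under coordinate rotations and
  total because the kernel is a limit of polynomials.  The entire function representing an
  element of the modulated Fock space is unique since the values of \<open>s\<close> contain a ball of a
  totally real subspace of full dimension.\<close>

section \<open>Seminormed function spaces\<close>

text \<open>The spaces consist of representatives with a possibly degenerate form: a vector of the
  tensor product is a Cauchy sequence of formal sums, and equality means seminorm distance 0.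
  Linearity, expansions and inverses therefore make sense only up to this relation, and an inverse
  is available only as a choice of representatives. This is why invertibility is recast as a lower
  bound plus solvability. Both conditions pass through slices and limits without an inverse operator
  being named, and the constant in the lower bound is the quantity that must be uniform in k.
  Completeness is used in the two factors. The tensor product enters as a seminormed space whose
  norm is the square sum of its components and whose vectors realize every square-summable family of
  components. Equations in it are solved component by component, and a uniform bound is exactly what
  allows the solutions to be reassembled. The spectrum on the off-attractor space follows from the
  same theorem, with the first factor replaced by the complex numbers.\<close>

locale seminormed_space =
  fixes H :: "'x ipspace"
  assumes zero_vec: "(\<lambda>_. 0) \<in> vecs H"
    and add_vec: "\<lbrakk>f \<in> vecs H; g \<in> vecs H\<rbrakk> \<Longrightarrow> (\<lambda>i. f i + g i) \<in> vecs H"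
    and scale_vec: "f \<in> vecs H \<Longrightarrow> (\<lambda>i. c * f i) \<in> vecs H"
    and nrm_scale: "f \<in> vecs H \<Longrightarrow> nrm H (\<lambda>i. c * f i) = cmod c * nrm H f"
    and nrm_triangle: "\<lbrakk>f \<in> vecs H; g \<in> vecs H\<rbrakk> \<Longrightarrow>
      nrm H (\<lambda>i. f i + g i) \<le> nrm H f + nrm H g"
begin

lemma diff_vec: "\<lbrakk>f \<in> vecs H; g \<in> vecs H\<rbrakk> \<Longrightarrow> (\<lambda>i. f i - g i) \<in> vecs H"
  using add_vec[of f "\<lambda>i. - 1 * g i"] scale_vec[of g "-1"] by simp

lemma nrm_zero: "nrm H (\<lambda>_. 0) = 0"
  using nrm_scale[OF zero_vec, of 0] by simp

lemma nrm_minus: "f \<in> vecs H \<Longrightarrow> nrm H (\<lambda>i. - f i) = nrm H f"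
  using nrm_scale[of f "-1"] by simp

text \<open>\<open>sqrt\<close> is odd on the negative reals, so \<open>nrm\<close>, being a square
  root of \<open>Re (ip H f f)\<close>, has no sign by definition. The triangle inequality for f +
  (-f) = 0 supplies it.\<close>

lemma nrm_nonneg: "f \<in> vecs H \<Longrightarrow> 0 \<le> nrm H f"
  using nrm_triangle[of f "\<lambda>i. -1 * f i"] scale_vec[of f "-1"] nrm_minus[of f] nrm_zero by simp

lemma nrm_commute: "\<lbrakk>f \<in> vecs H; g \<in> vecs H\<rbrakk> \<Longrightarrow> nrm H (\<lambda>i. f i - g i) = nrm H (\<lambda>i. g i - f i)"
  using nrm_minus[OF diff_vec, of f g] by simp

lemma nrm_diff_triangle:
  "\<lbrakk>f \<in> vecs H; g \<in> vecs H; h \<in> vecs H\<rbrakk> \<Longrightarrow>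
    nrm H (\<lambda>i. f i - h i) \<le> nrm H (\<lambda>i. f i - g i) + nrm H (\<lambda>i. g i - h i)"
  using nrm_triangle[OF diff_vec diff_vec, of f g g h] by simp

lemma nrm_triangle_sub:
  "\<lbrakk>f \<in> vecs H; g \<in> vecs H\<rbrakk> \<Longrightarrow> nrm H f \<le> nrm H g + nrm H (\<lambda>i. f i - g i)"
  using nrm_triangle[OF _ diff_vec, of g f g] by simp

lemma abs_nrm_diff:
  "\<lbrakk>f \<in> vecs H; g \<in> vecs H\<rbrakk> \<Longrightarrow> \<bar>nrm H f - nrm H g\<bar> \<le> nrm H (\<lambda>i. f i - g i)"
  using nrm_triangle_sub[of f g] nrm_triangle_sub[of g f] nrm_commute[of f g] by linarith

lemma nrm_triangle_diff:
  "\<lbrakk>f \<in> vecs H; g \<in> vecs H\<rbrakk> \<Longrightarrow> nrm H (\<lambda>i. f i - g i) \<le> nrm H f + nrm H g"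
  using nrm_triangle_sub[OF diff_vec, of f g "\<lambda>i. - g i"] nrm_minus[of g] scale_vec[of g "-1"]
  by simp

end

text \<open>Equality in the quotient by the null vectors. Symmetry and transitivity require
  membership in the space, because the seminorm axioms hold only there.\<close>

definition veq :: "'x ipspace \<Rightarrow> ('x \<Rightarrow> complex) \<Rightarrow> ('x \<Rightarrow> complex) \<Rightarrow> bool" where
  "veq H f g \<longleftrightarrow> nrm H (\<lambda>i. f i - g i) = 0"

context seminormed_space
begin

lemma veq_refl: "veq H f f"
  by (simp add: veq_def nrm_zero)

lemma veq_sym: "\<lbrakk>f \<in> vecs H; g \<in> vecs H\<rbrakk> \<Longrightarrow> veq H f g \<Longrightarrow> veq H g f"
  using nrm_commute[of f g] by (simp add: veq_def)

lemma veq_trans: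
  "\<lbrakk>f \<in> vecs H; g \<in> vecs H; h \<in> vecs H\<rbrakk> \<Longrightarrow> veq H f g \<Longrightarrow> veq H g h \<Longrightarrow> veq H f h"
  using nrm_diff_triangle[of f g h] nrm_nonneg[OF diff_vec, of f h] by (simp add: veq_def)

lemma veq_nrm: "\<lbrakk>f \<in> vecs H; g \<in> vecs H\<rbrakk> \<Longrightarrow> veq H f g \<Longrightarrow> nrm H f = nrm H g"
  using abs_nrm_diff[of f g] by (simp add: veq_def)

lemma veq_diff:
  assumes "f \<in> vecs H" "g \<in> vecs H" "f' \<in> vecs H" "g' \<in> vecs H" "veq H f f'" "veq H g g'"
  shows "veq H (\<lambda>i. f i - g i) (\<lambda>i. f' i - g' i)"
  using nrm_triangle_diff[OF diff_vec diff_vec, of f f' g g'] assms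
    nrm_nonneg[OF diff_vec[OF diff_vec diff_vec], of f g f' g']
  by (simp add: veq_def algebra_simps)

lemma veq_add:
  assumes "f \<in> vecs H" "g \<in> vecs H" "f' \<in> vecs H" "g' \<in> vecs H" "veq H f f'" "veq H g g'"
  shows "veq H (\<lambda>i. f i + g i) (\<lambda>i. f' i + g' i)"
  using nrm_triangle[OF diff_vec diff_vec, of f f' g g'] assms
    nrm_nonneg[OF diff_vec[OF add_vec add_vec], of f g f' g']
  by (simp add: veq_def algebra_simps)

lemma veq_scale:
  assumes "f \<in> vecs H" "g \<in> vecs H" "veq H f g"
  shows "veq H (\<lambda>i. c * f i) (\<lambda>i. c * g i)"
  using nrm_scale[OF diff_vec, of f g c] assms by (simp add: veq_def algebra_simps)

end

section \<open>Bounded operators with a bounded inverse\<close>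

text \<open>For linear L this says that L induces a bijection on classes whose inverse is bounded by
  C, without naming that inverse. The constant stays visible because inverses on infinitely many
  slices have to be bounded uniformly.\<close>

definition bounded_inverse ::
    "'x ipspace \<Rightarrow> (('x \<Rightarrow> complex) \<Rightarrow> 'x \<Rightarrow> complex) \<Rightarrow> real \<Rightarrow> bool" where
  "bounded_inverse H L C \<longleftrightarrow>
     (\<forall>g\<in>vecs H. nrm H g \<le> C * nrm H (L g)) \<and> (\<forall>f\<in>vecs H. \<exists>g\<in>vecs H. veq H (L g) f)"

context seminormed_space
begin

lemma bounded_operatorD:
  assumes "bounded_operator H T"
  shows "f \<in> vecs H \<Longrightarrow> T f \<in> vecs H"
    and "f \<in> vecs H \<Longrightarrow> g \<in> vecs H \<Longrightarrow> veq H (T (\<lambda>j. f j + g j)) (\<lambda>i. T f i + T g i)"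
    and "f \<in> vecs H \<Longrightarrow> veq H (T (\<lambda>j. c * f j)) (\<lambda>i. c * T f i)"
    and "\<exists>C>0. \<forall>f\<in>vecs H. nrm H (T f) \<le> C * nrm H f"
proof -
  obtain C where C: "\<forall>f\<in>vecs H. nrm H (T f) \<le> C * nrm H f"
    using assms by (auto simp: bounded_operator_def)
  have "nrm H (T f) \<le> max C 1 * nrm H f" if "f \<in> vecs H" for f
    using C that nrm_nonneg[OF that] by (meson max.cobounded1 mult_right_mono order_trans)
  then show "\<exists>C>0. \<forall>f\<in>vecs H. nrm H (T f) \<le> C * nrm H f"
    by (intro exI[of _ "max C 1"]) auto
qed (use assms in \<open>auto simp: bounded_operator_def veq_def\<close>)

lemma bounded_operator_veq_diff:
  assumes "bounded_operator H T" "f \<in> vecs H" "g \<in> vecs H"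
  shows "veq H (T (\<lambda>j. f j - g j)) (\<lambda>i. T f i - T g i)"
proof -
  note T = bounded_operatorD[OF assms(1)]
  have g: "(\<lambda>j. -1 * g j) \<in> vecs H" by (rule scale_vec[OF assms(3)])
  have 1: "veq H (T (\<lambda>j. f j + -1 * g j)) (\<lambda>i. T f i + T (\<lambda>j. -1 * g j) i)"
    by (rule T(2)[OF assms(2) g])
  have 2: "veq H (\<lambda>i. T f i + T (\<lambda>j. -1 * g j) i) (\<lambda>i. T f i + -1 * T g i)"
    by (intro veq_add veq_refl T(1) T(3) scale_vec assms)
  have "veq H (T (\<lambda>j. f j + -1 * g j)) (\<lambda>i. T f i + -1 * T g i)"
    by (rule veq_trans[OF _ _ _ 1 2]; intro T(1) add_vec g assms scale_vec)
  then show ?thesis by simp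
qed

text \<open>Boundedness makes T well defined on classes: up to \<open>veq\<close>, T f - T g is T (f
  - g), whose norm is at most C times 0.\<close>

lemma bounded_operator_veq:
  assumes "bounded_operator H T" "f \<in> vecs H" "g \<in> vecs H" "veq H f g"
  shows "veq H (T f) (T g)"
proof -
  note T = bounded_operatorD[OF assms(1)]
  obtain C where C: "\<forall>f\<in>vecs H. nrm H (T f) \<le> C * nrm H f" using T(4) by auto
  have d: "(\<lambda>j. f j - g j) \<in> vecs H" by (rule diff_vec[OF assms(2,3)])
  have "nrm H (T (\<lambda>j. f j - g j)) \<le> 0"
    using C[rule_format, OF d] assms(4) by (simp add: veq_def)
  moreover have "nrm H (T (\<lambda>j. f j - g j)) = nrm H (\<lambda>i. T f i - T g i)"
    by (rule veq_nrm[OF _ _ bounded_operator_veq_diff[OF assms(1-3)]]) (intro T(1) diff_vec assms)+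
  ultimately show ?thesis
    using nrm_nonneg[OF diff_vec[OF T(1) T(1)], of f g] assms by (simp add: veq_def)
qed

lemma bounded_operator_lincomb:
  assumes "bounded_operator H T"
  shows "bounded_operator H (\<lambda>g i. a * T g i - b * g i)"
proof -
  note T = bounded_operatorD[OF assms]
  obtain C where C: "\<forall>f\<in>vecs H. nrm H (T f) \<le> C * nrm H f" using T(4) by auto
  have vec: "(\<lambda>i. a * T f i - b * f i) \<in> vecs H" if "f \<in> vecs H" for f
    by (intro diff_vec scale_vec T(1) that)
  have add: "veq H (\<lambda>i. a * T (\<lambda>j. f j + g j) i - b * (f i + g i))
      (\<lambda>i. (a * T f i - b * f i) + (a * T g i - b * g i))"
    if "f \<in> vecs H" "g \<in> vecs H" for f g
  proof -
    have "veq H (\<lambda>i. a * T (\<lambda>j. f j + g j) i - b * (f i + g i))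
      (\<lambda>i. a * (T f i + T g i) - b * (f i + g i))"
      by (intro veq_diff veq_scale veq_refl T(2) scale_vec T(1) add_vec that)
    then show ?thesis by (simp add: algebra_simps)
  qed
  have scl: "veq H (\<lambda>i. a * T (\<lambda>j. c * f j) i - b * (c * f i)) (\<lambda>i. c * (a * T f i - b * f i))"
    if "f \<in> vecs H" for f c
  proof -
    have "veq H (\<lambda>i. a * T (\<lambda>j. c * f j) i - b * (c * f i)) (\<lambda>i. a * (c * T f i) - b * (c * f i))"
      by (intro veq_diff veq_scale veq_refl T(3) scale_vec T(1) add_vec that)
    then show ?thesis by (simp add: algebra_simps)
  qed
  have bd: "nrm H (\<lambda>i. a * T f i - b * f i) \<le> (cmod a * C + cmod b) * nrm H f"
    if "f \<in> vecs H" for f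
  proof -
    have "nrm H (\<lambda>i. a * T f i - b * f i) \<le> cmod a * nrm H (T f) + cmod b * nrm H f"
      using nrm_triangle_diff[OF scale_vec scale_vec, OF T(1) that, OF that, of a b]
        nrm_scale[OF T(1), OF that] nrm_scale[OF that] by simp
    also have "\<dots> \<le> cmod a * (C * nrm H f) + cmod b * nrm H f"
      using C that by (intro add_right_mono mult_left_mono) auto
    finally show ?thesis by (simp add: algebra_simps)
  qed
  have "\<exists>K. \<forall>f\<in>vecs H. nrm H (\<lambda>i. a * T f i - b * f i) \<le> K * nrm H f"
    using bd by blast
  then show ?thesis
    unfolding bounded_operator_def using vec add scl by (simp add: veq_def)
qed

lemma bounded_inverse_inj:
  assumes "bounded_operator H L" "bounded_inverse H L C" "f \<in> vecs H" "g \<in> vecs H" "veq H (L f) (L g)"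
  shows "veq H f g"
proof -
  have d: "(\<lambda>i. f i - g i) \<in> vecs H" by (rule diff_vec[OF assms(3,4)])
  have "nrm H (\<lambda>i. f i - g i) \<le> C * nrm H (L (\<lambda>i. f i - g i))"
    using assms(2) d by (auto simp: bounded_inverse_def)
  also have "nrm H (L (\<lambda>i. f i - g i)) = nrm H (\<lambda>i. L f i - L g i)"
    by (rule veq_nrm[OF _ _ bounded_operator_veq_diff[OF assms(1,3,4)]])
       (intro bounded_operatorD(1)[OF assms(1)] diff_vec assms)+
  finally show ?thesis
    using assms(5) nrm_nonneg[OF d] by (simp add: veq_def)
qed

lemma bounded_inverse_mono:
  assumes "bounded_inverse H L C" "C \<le> C'" "\<And>g. g \<in> vecs H \<Longrightarrow> L g \<in> vecs H"
  shows "bounded_inverse H L C'"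
  using assms nrm_nonneg unfolding bounded_inverse_def
  by (meson mult_right_mono order_trans)

text \<open>The definition of \<open>spectrum\<close> quantifies over resolvent operators; this
  replaces them by an estimate and solvability, the form in which slices and perturbations can be
  handled.\<close>

lemma not_in_spectrum_iff:
  assumes T: "bounded_operator H T"
  shows "z \<notin> spectrum H T \<longleftrightarrow> (\<exists>C>0. bounded_inverse H (\<lambda>g i. T g i - z * g i) C)"
proof
  define L where "L = (\<lambda>g i. T g i - z * g i)"
  have L: "bounded_operator H L"
    using bounded_operator_lincomb[OF T, of 1 z] by (simp add: L_def)
  note Lv = bounded_operatorD(1)[OF L]
  show "\<exists>C>0. bounded_inverse H (\<lambda>g i. T g i - z * g i) C" if z: "z \<notin> spectrum H T"
  proof -
    obtain R where R: "bounded_operator H R"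
      and l: "\<And>f. f \<in> vecs H \<Longrightarrow> veq H (R (L f)) f"
      and r: "\<And>f. f \<in> vecs H \<Longrightarrow> veq H (L (R f)) f"
      using z unfolding spectrum_def veq_def L_def by auto
    obtain C where C: "C > 0" "\<forall>f\<in>vecs H. nrm H (R f) \<le> C * nrm H f"
      using bounded_operatorD(4)[OF R] by blast
    have "nrm H g \<le> C * nrm H (L g)" if "g \<in> vecs H" for g
      using veq_nrm[OF _ that l[OF that]] C(2) Lv[OF that] bounded_operatorD(1)[OF R] by metis
    then have "bounded_inverse H L C"
      unfolding bounded_inverse_def using r bounded_operatorD(1)[OF R] by blast
    then show ?thesis using C(1) L_def by auto
  qed
  show "z \<notin> spectrum H T" if z: "\<exists>C>0. bounded_inverse H (\<lambda>g i. T g i - z * g i) C"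
  proof -
    obtain C where C: "bounded_inverse H L C" using z L_def by auto
    \<comment> \<open>Preimages under L are unique only up to \<open>veq\<close>. Additivity and
      homogeneity of this choice are recovered by applying L to both sides and using injectivity of
      L up to \<open>veq\<close>.\<close>
    define R where "R f = (SOME g. g \<in> vecs H \<and> veq H (L g) f)" for f
    have R: "R f \<in> vecs H \<and> veq H (L (R f)) f" if "f \<in> vecs H" for f
    proof -
      have "\<exists>g. g \<in> vecs H \<and> veq H (L g) f" using C that by (auto simp: bounded_inverse_def)
      from someI_ex[OF this] show ?thesis by (simp add: R_def)
    qed
    have R1: "R f \<in> vecs H" if "f \<in> vecs H" for f using R that by blast
    have R2: "veq H (L (R f)) f" if "f \<in> vecs H" for f using R that by blast
    have l: "veq H (R (L f)) f" if "f \<in> vecs H" for f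
      by (rule bounded_inverse_inj[OF L C R1 that]) (use R2 Lv that in auto)
    have bd: "nrm H (R f) \<le> C * nrm H f" if "f \<in> vecs H" for f
    proof -
      have "nrm H (R f) \<le> C * nrm H (L (R f))"
        using C R1[OF that] by (auto simp: bounded_inverse_def)
      then show ?thesis using veq_nrm[OF _ that R2[OF that]] Lv[OF R1[OF that]] by simp
    qed
    have add: "veq H (R (\<lambda>j. f j + g j)) (\<lambda>i. R f i + R g i)" if "f \<in> vecs H" "g \<in> vecs H" for f g
    proof (rule bounded_inverse_inj[OF L C])
      have 1: "veq H (\<lambda>i. L (R f) i + L (R g) i) (\<lambda>j. f j + g j)"
        by (intro veq_add R2 Lv R1 that)
      have 2: "veq H (L (\<lambda>i. R f i + R g i)) (\<lambda>i. L (R f) i + L (R g) i)"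
        by (intro bounded_operatorD(2)[OF L] R1 that)
      have "veq H (L (\<lambda>i. R f i + R g i)) (\<lambda>j. f j + g j)"
        by (rule veq_trans[OF _ _ _ 2 1]; intro Lv add_vec R1 that)
      then have 3: "veq H (\<lambda>j. f j + g j) (L (\<lambda>i. R f i + R g i))"
        by (rule veq_sym[rotated -1]; intro Lv add_vec R1 that)
      show "veq H (L (R (\<lambda>j. f j + g j))) (L (\<lambda>i. R f i + R g i))"
        by (rule veq_trans[OF _ _ _ R2 3]; intro Lv R1 add_vec that)
    qed (intro R1 add_vec that)+
    have scl: "veq H (R (\<lambda>j. c * f j)) (\<lambda>i. c * R f i)" if "f \<in> vecs H" for f c
    proof (rule bounded_inverse_inj[OF L C])
      have 1: "veq H (\<lambda>i. c * L (R f) i) (\<lambda>j. c * f j)"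
        by (intro veq_scale R2 Lv R1 that)
      have 2: "veq H (L (\<lambda>i. c * R f i)) (\<lambda>i. c * L (R f) i)"
        by (intro bounded_operatorD(3)[OF L] R1 that)
      have "veq H (L (\<lambda>i. c * R f i)) (\<lambda>j. c * f j)"
        by (rule veq_trans[OF _ _ _ 2 1]; intro Lv scale_vec R1 that)
      then have 3: "veq H (\<lambda>j. c * f j) (L (\<lambda>i. c * R f i))"
        by (rule veq_sym[rotated -1]; intro Lv scale_vec R1 that)
      show "veq H (L (R (\<lambda>j. c * f j))) (L (\<lambda>i. c * R f i))"
        by (rule veq_trans[OF _ _ _ R2 3]; intro Lv R1 scale_vec that)
    qed (intro R1 scale_vec that)+
    have "\<exists>C. \<forall>f\<in>vecs H. nrm H (R f) \<le> C * nrm H f"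
      using bd by blast
    then have "bounded_operator H R"
      unfolding bounded_operator_def using R1 add scl by (simp add: veq_def)
    then show ?thesis
      using l R2 unfolding spectrum_def veq_def L_def by auto
  qed
qed

end

section \<open>Completeness and the Neumann series\<close>

locale complete_seminormed_space = seminormed_space +
  assumes complete: "cauchy_in H X \<Longrightarrow> \<exists>f\<in>vecs H. (\<lambda>n. nrm H (\<lambda>i. X n i - f i)) \<longlonglongrightarrow> 0"
begin

lemma geometric_cauchy_in:
  assumes X: "\<And>n. X n \<in> vecs H" and le: "\<And>n. nrm H (\<lambda>i. X (Suc n) i - X n i) \<le> a * r ^ n"
    and r: "0 \<le> r" "r < 1"
  shows "cauchy_in H X"
proof -
  have a: "0 \<le> a" using le[of 0] nrm_nonneg[OF diff_vec[OF X X], of "Suc 0" 0] by simp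
  have *: "nrm H (\<lambda>i. X (n + k) i - X n i) \<le> a * r ^ n * (\<Sum>j<k. r ^ j)" for n k
  proof (induction k)
    case (Suc k)
    have "nrm H (\<lambda>i. X (n + Suc k) i - X n i)
      \<le> nrm H (\<lambda>i. X (Suc (n + k)) i - X (n + k) i) + nrm H (\<lambda>i. X (n + k) i - X n i)"
      using nrm_diff_triangle[OF X X X] by simp
    also have "\<dots> \<le> a * r ^ (n + k) + a * r ^ n * (\<Sum>j<k. r ^ j)"
      using le Suc by (intro add_mono) auto
    finally show ?case by (simp add: algebra_simps power_add)
  qed (simp add: nrm_zero)
  have **: "nrm H (\<lambda>i. X m i - X n i) \<le> a * r ^ n / (1 - r)" if "n \<le> m" for n m
  proof -
    have "(\<Sum>j<m - n. r ^ j) \<le> 1 / (1 - r)"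
      using r by (simp add: sum_gp_strict divide_right_mono)
    then have "a * r ^ n * (\<Sum>j<m - n. r ^ j) \<le> a * r ^ n * (1 / (1 - r))"
      using a r by (intro mult_left_mono) auto
    then show ?thesis using *[of n "m - n"] that by simp
  qed
  show ?thesis
    unfolding cauchy_in_def
  proof (intro conjI allI impI X)
    fix e :: real assume e: "e > 0"
    have "(\<lambda>n. a * r ^ n / (1 - r)) \<longlonglongrightarrow> a * 0 / (1 - r)"
      using r by (intro tendsto_intros) auto
    then have "\<forall>\<^sub>F n in sequentially. a * r ^ n / (1 - r) < e"
      using e by (intro order_tendstoD(2)) auto
    then obtain N where N: "\<And>n. n \<ge> N \<Longrightarrow> a * r ^ n / (1 - r) < e"
      by (auto simp: eventually_sequentially)
    show "\<exists>N. \<forall>m\<ge>N. \<forall>n\<ge>N. nrm H (\<lambda>i. X m i - X n i) < e"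
    proof (intro exI[of _ N] allI impI)
      fix m n assume mn: "m \<ge> N" "n \<ge> N"
      show "nrm H (\<lambda>i. X m i - X n i) < e"
      proof (cases "n \<le> m")
        case True
        then show ?thesis using **[of n m] N[of n] mn by linarith
      next
        case False
        then show ?thesis using **[of m n] N[of m] mn nrm_commute[OF X X, of m n] by linarith
      qed
    qed
  qed
qed

text \<open>The Neumann series as a fixed point iteration: with E = L' - L, a solution of L' g = f
  is a fixed point of the map sending h to a preimage of f - E h under L, which shrinks distances by
  the factor d * C. The new constant comes from solving nrm g \<le> C * (nrm (L' g) + d * nrm g) for
  nrm g.\<close>

lemma bounded_inverse_perturb:
  assumes L: "bounded_operator H L" and L': "bounded_operator H L'"
    and C: "bounded_inverse H L C" "C > 0"
    and d: "\<And>g. g \<in> vecs H \<Longrightarrow> nrm H (\<lambda>i. L' g i - L g i) \<le> d * nrm H g" "0 \<le> d" "d * C < 1"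
  shows "bounded_inverse H L' (C / (1 - d * C))"
proof -
  note Lv = bounded_operatorD(1)[OF L] and L'v = bounded_operatorD(1)[OF L']
  have lower: "nrm H g \<le> C / (1 - d * C) * nrm H (L' g)" if g: "g \<in> vecs H" for g
  proof -
    have "nrm H g \<le> C * nrm H (L g)" using C g by (auto simp: bounded_inverse_def)
    also have "\<dots> \<le> C * (nrm H (L' g) + d * nrm H g)"
      using nrm_triangle_sub[OF Lv[OF g] L'v[OF g]] nrm_commute[OF Lv[OF g] L'v[OF g]] d(1)[OF g] C(2)
      by (intro mult_left_mono) auto
    finally show ?thesis using d C(2) by (simp add: field_simps)
  qed
  have "\<exists>g\<in>vecs H. veq H (L' g) f" if f: "f \<in> vecs H" for f
  proof -
    define E where "E g i = L' g i - L g i" for g i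
    have Ev: "E g \<in> vecs H" if "g \<in> vecs H" for g
      using diff_vec[OF L'v Lv] that unfolding E_def[abs_def] by auto
    have "\<forall>h\<in>vecs H. \<exists>g\<in>vecs H. veq H (L g) (\<lambda>i. f i - E h i)"
      using C(1) diff_vec[OF f Ev] by (auto simp: bounded_inverse_def)
    then obtain N where Nv: "\<And>h. h \<in> vecs H \<Longrightarrow> N h \<in> vecs H"
      and N: "\<And>h. h \<in> vecs H \<Longrightarrow> veq H (L (N h)) (\<lambda>i. f i - E h i)"
      by metis
    \<comment> \<open>N merely picks preimages, yet it is a contraction: the lower bound for L
      controls the distance between any two preimages by the distance of their images.\<close>
    have Nc: "nrm H (\<lambda>i. N h i - N h' i) \<le> (d * C) * nrm H (\<lambda>i. h i - h' i)"
      if h: "h \<in> vecs H" "h' \<in> vecs H" for h h'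
    proof -
      have "nrm H (\<lambda>i. N h i - N h' i) \<le> C * nrm H (L (\<lambda>i. N h i - N h' i))"
        using C diff_vec[OF Nv Nv] h by (auto simp: bounded_inverse_def)
      also have "nrm H (L (\<lambda>i. N h i - N h' i)) = nrm H (\<lambda>i. L (N h) i - L (N h') i)"
        by (intro veq_nrm bounded_operator_veq_diff[OF L] Lv diff_vec Nv h)
      also have "\<dots> = nrm H (\<lambda>i. (f i - E h i) - (f i - E h' i))"
        by (intro veq_nrm veq_diff N diff_vec Lv Nv Ev f h)
      also have "\<dots> = nrm H (\<lambda>i. E h' i - E h i)" by simp
      also have "\<dots> = nrm H (\<lambda>i. (L' h' i - L' h i) - (L h' i - L h i))"
        by (simp add: E_def algebra_simps)
      also have "\<dots> = nrm H (\<lambda>i. L' (\<lambda>j. h' j - h j) i - L (\<lambda>j. h' j - h j) i)"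
        by (rule veq_nrm[symmetric]; intro veq_diff bounded_operator_veq_diff L L' diff_vec Lv L'v h)
      also have "\<dots> \<le> d * nrm H (\<lambda>j. h' j - h j)"
        by (intro d diff_vec h)
      also have "nrm H (\<lambda>j. h' j - h j) = nrm H (\<lambda>j. h j - h' j)"
        by (intro nrm_commute h)
      finally show ?thesis using C(2) by (simp add: mult.assoc mult.left_commute)
    qed
    define X where "X n = (N ^^ n) (\<lambda>_. 0)" for n
    have X: "X n \<in> vecs H" for n
      by (induction n) (auto simp: X_def zero_vec Nv)
    have XS: "X (Suc n) = N (X n)" for n by (simp add: X_def)
    have step: "nrm H (\<lambda>i. X (Suc n) i - X n i) \<le> nrm H (\<lambda>i. X (Suc 0) i - X 0 i) * (d * C) ^ n" for n
    proof (induction n)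
      case (Suc n)
      have "nrm H (\<lambda>i. X (Suc (Suc n)) i - X (Suc n) i) \<le> (d * C) * nrm H (\<lambda>i. X (Suc n) i - X n i)"
        using Nc[OF X X, of "Suc n" n] XS by simp
      also have "\<dots> \<le> (d * C) * (nrm H (\<lambda>i. X (Suc 0) i - X 0 i) * (d * C) ^ n)"
        using Suc d C(2) by (intro mult_left_mono) auto
      finally show ?case by (simp add: algebra_simps)
    qed simp
    have "cauchy_in H X"
      by (rule geometric_cauchy_in[OF X step]) (use d C in auto)
    then obtain g where g: "g \<in> vecs H" "(\<lambda>n. nrm H (\<lambda>i. X n i - g i)) \<longlonglongrightarrow> 0"
      using complete by blast
    obtain K where K: "K > 0" "\<forall>f\<in>vecs H. nrm H (L f) \<le> K * nrm H f" using bounded_operatorD(4)[OF L] by auto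
    have XSg: "(\<lambda>n. nrm H (\<lambda>i. X (Suc n) i - g i)) \<longlonglongrightarrow> 0"
      using g(2) by (rule LIMSEQ_Suc)
    \<comment> \<open>Write L' g = L g + E g and insert \<open>L (X (Suc n)) + E (X n)\<close>,
      which is f up to \<open>veq\<close> by the choice of N. The two remaining differences are
      bounded by the errors of consecutive iterates.\<close>
    have bnd: "nrm H (\<lambda>i. L' g i - f i) \<le> d * nrm H (\<lambda>i. X n i - g i) + K * nrm H (\<lambda>i. X (Suc n) i - g i)" for n
    proof -
      have 1: "nrm H (\<lambda>i. L' g i - f i) \<le> nrm H (\<lambda>i. L' g i - (L (X (Suc n)) i + E (X n) i)) +
         nrm H (\<lambda>i. (L (X (Suc n)) i + E (X n) i) - f i)"
        by (intro nrm_diff_triangle f add_vec Ev Lv L'v X g)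
      have "nrm H (\<lambda>i. (L (X (Suc n)) i + E (X n) i) - f i) = 0"
        using N[OF X, of n] by (simp add: veq_def XS algebra_simps)
      moreover have "nrm H (\<lambda>i. L' g i - (L (X (Suc n)) i + E (X n) i)) =
          nrm H (\<lambda>i. (E g i - E (X n) i) - (L (X (Suc n)) i - L g i))"
        by (simp add: E_def algebra_simps)
      moreover have "\<dots> \<le> nrm H (\<lambda>i. E g i - E (X n) i) + nrm H (\<lambda>i. L (X (Suc n)) i - L g i)"
        by (intro nrm_triangle_diff diff_vec Ev Lv X g)
      moreover have "nrm H (\<lambda>i. L (X (Suc n)) i - L g i) = nrm H (L (\<lambda>i. X (Suc n) i - g i))"
        by (rule veq_nrm[symmetric]; intro bounded_operator_veq_diff L diff_vec Lv X g)
      moreover have "\<dots> \<le> K * nrm H (\<lambda>i. X (Suc n) i - g i)"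
        using K diff_vec[OF X g(1)] by auto
      moreover have "nrm H (\<lambda>i. E g i - E (X n) i) = nrm H (\<lambda>i. (L' g i - L' (X n) i) - (L g i - L (X n) i))"
        by (simp add: E_def algebra_simps)
      moreover have "\<dots> = nrm H (\<lambda>i. L' (\<lambda>j. g j - X n j) i - L (\<lambda>j. g j - X n j) i)"
        by (rule veq_nrm[symmetric]; intro veq_diff bounded_operator_veq_diff L L' diff_vec Lv L'v X g)
      moreover have "\<dots> \<le> d * nrm H (\<lambda>j. g j - X n j)"
        by (intro d diff_vec X g)
      moreover have "d * nrm H (\<lambda>j. g j - X n j) = d * nrm H (\<lambda>j. X n j - g j)"
        using nrm_commute[OF g(1) X, of n] by simp
      ultimately show ?thesis using 1 by linarith
    qed
    have "(\<lambda>n. d * nrm H (\<lambda>i. X n i - g i) + K * nrm H (\<lambda>i. X (Suc n) i - g i)) \<longlonglongrightarrow> d * 0 + K * 0"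
      by (intro tendsto_intros g XSg)
    then have "nrm H (\<lambda>i. L' g i - f i) \<le> d * 0 + K * 0"
      by (rule Lim_bounded2) (use bnd in blast)
    then have "veq H (L' g) f"
      using nrm_nonneg[OF diff_vec[OF L'v[OF g(1)] f]] by (simp add: veq_def)
    then show ?thesis using g(1) by blast
  qed
  then show ?thesis using lower by (auto simp: bounded_inverse_def)
qed

end

context complete_seminormed_space begin

lemma bounded_inverse_scale:
  assumes "bounded_inverse H L C" "a \<noteq> 0" "\<And>g. g \<in> vecs H \<Longrightarrow> L g \<in> vecs H"
  shows "bounded_inverse H (\<lambda>g i. a * L g i) (C / cmod a)"
proof -
  have "\<exists>g\<in>vecs H. veq H (\<lambda>i. a * L g i) f" if f: "f \<in> vecs H" for f
  proof -
    obtain g where g: "g \<in> vecs H" "veq H (L g) (\<lambda>i. inverse a * f i)"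
      using assms(1) scale_vec[OF f, of "inverse a"] unfolding bounded_inverse_def by blast
    have "veq H (\<lambda>i. a * L g i) (\<lambda>i. a * (inverse a * f i))"
      by (intro veq_scale g assms scale_vec f)
    then show ?thesis using g(1) assms(2) by (auto simp: mult.assoc[symmetric])
  qed
  then show ?thesis
    using assms by (auto simp: bounded_inverse_def nrm_scale)
qed

end

section \<open>Diagonal operators on direct sums\<close>

text \<open>The space \<open>G\<close> is isometric to the Hilbert sum of copies of \<open>H\<close> indexed by \<open>k\<close>; \<open>\<Phi> k\<close> is the
  \<open>k\<close>-th component, and \<open>T\<close> acts on it as \<open>c k\<close> times \<open>U\<close>.\<close>

locale diagonal_operator = H: complete_seminormed_space H + G: seminormed_space G
  for H :: "'x ipspace" and G :: "'y ipspace" +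
  fixes U :: "('x \<Rightarrow> complex) \<Rightarrow> 'x \<Rightarrow> complex"
    and T :: "('y \<Rightarrow> complex) \<Rightarrow> 'y \<Rightarrow> complex"
    and c :: "'k \<Rightarrow> complex"
    and \<Phi> :: "'k \<Rightarrow> ('y \<Rightarrow> complex) \<Rightarrow> 'x \<Rightarrow> complex"
  assumes U_vec: "f \<in> vecs H \<Longrightarrow> U f \<in> vecs H"
    and U_add: "U (\<lambda>i. f i + g i) = (\<lambda>i. U f i + U g i)"
    and U_scale: "U (\<lambda>i. a * f i) = (\<lambda>i. a * U f i)"
    and U_contr: "f \<in> vecs H \<Longrightarrow> nrm H (U f) \<le> nrm H f"
    and c_le: "cmod (c k) \<le> 1"
    and c_nz: "c k \<noteq> 0"
    and T_vec: "X \<in> vecs G \<Longrightarrow> T X \<in> vecs G"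
    and \<Phi>_vec: "X \<in> vecs G \<Longrightarrow> \<Phi> k X \<in> vecs H"
    and \<Phi>_add: "\<lbrakk>X \<in> vecs G; Y \<in> vecs G\<rbrakk> \<Longrightarrow>
      veq H (\<Phi> k (\<lambda>i. X i + Y i)) (\<lambda>i. \<Phi> k X i + \<Phi> k Y i)"
    and \<Phi>_scale: "X \<in> vecs G \<Longrightarrow> veq H (\<Phi> k (\<lambda>i. a * X i)) (\<lambda>i. a * \<Phi> k X i)"
    and \<Phi>_T: "X \<in> vecs G \<Longrightarrow> veq H (\<Phi> k (T X)) (\<lambda>i. c k * U (\<Phi> k X) i)"
    and \<Phi>_nrm: "X \<in> vecs G \<Longrightarrow> ((\<lambda>k. (nrm H (\<Phi> k X))\<^sup>2) has_sum (nrm G X)\<^sup>2) UNIV"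
    and \<Phi>_onto: "\<lbrakk>\<And>k. F k \<in> vecs H; (\<lambda>k. (nrm H (F k))\<^sup>2) summable_on UNIV\<rbrakk> \<Longrightarrow>
      \<exists>X\<in>vecs G. \<forall>k. veq H (\<Phi> k X) (F k)"
begin

lemma U_bounded: "bounded_operator H U"
proof -
  have "\<exists>C. \<forall>f\<in>vecs H. nrm H (U f) \<le> C * nrm H f"
    using U_contr by (intro exI[of _ 1]) auto
  then show ?thesis
    unfolding bounded_operator_def U_add U_scale by (simp add: U_vec H.nrm_zero)
qed

text \<open>The squared norm is the sum of the squared component norms, so an estimate holding on
  all components with one constant holds for the whole vector with that constant.\<close>

lemma slice_nrm_le:
  assumes "X \<in> vecs G" "Y \<in> vecs G" "\<And>k. nrm H (\<Phi> k X) \<le> C * nrm H (\<Phi> k Y)" "0 \<le> C"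
  shows "nrm G X \<le> C * nrm G Y"
proof -
  have "((\<lambda>k. C\<^sup>2 * (nrm H (\<Phi> k Y))\<^sup>2) has_sum C\<^sup>2 * (nrm G Y)\<^sup>2) UNIV"
    by (intro has_sum_cmult_right \<Phi>_nrm assms)
  moreover have "(nrm H (\<Phi> k X))\<^sup>2 \<le> C\<^sup>2 * (nrm H (\<Phi> k Y))\<^sup>2" for k
    using power_mono[OF assms(3)[of k], of 2] H.nrm_nonneg[OF \<Phi>_vec[OF assms(1)]]
    by (simp add: power_mult_distrib)
  ultimately have "(nrm G X)\<^sup>2 \<le> C\<^sup>2 * (nrm G Y)\<^sup>2"
    by (intro has_sum_mono[OF \<Phi>_nrm[OF assms(1)]]) auto
  then show ?thesis
    by (intro power2_le_imp_le[of "nrm G X"])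
       (use assms(4) G.nrm_nonneg[OF assms(2)] in \<open>auto simp: power_mult_distrib\<close>)
qed

lemma nrm_slice_le: "X \<in> vecs G \<Longrightarrow> nrm H (\<Phi> k X) \<le> nrm G X"
  by (rule power2_le_imp_le)
     (use finite_sum_le_has_sum[OF \<Phi>_nrm, of X "{k}"] G.nrm_nonneg[of X] in auto)

lemma \<Phi>_diff:
  assumes "X \<in> vecs G" "Y \<in> vecs G"
  shows "veq H (\<Phi> k (\<lambda>i. X i - Y i)) (\<lambda>i. \<Phi> k X i - \<Phi> k Y i)"
proof -
  have "veq H (\<Phi> k (\<lambda>i. X i + -1 * Y i)) (\<lambda>i. \<Phi> k X i + -1 * \<Phi> k Y i)"
  proof (rule H.veq_trans)
    show "veq H (\<Phi> k (\<lambda>i. X i + -1 * Y i)) (\<lambda>i. \<Phi> k X i + \<Phi> k (\<lambda>i. -1 * Y i) i)"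
      by (intro \<Phi>_add G.scale_vec assms)
    show "veq H (\<lambda>i. \<Phi> k X i + \<Phi> k (\<lambda>i. -1 * Y i) i) (\<lambda>i. \<Phi> k X i + -1 * \<Phi> k Y i)"
      by (intro H.veq_add \<Phi>_scale H.veq_refl \<Phi>_vec G.scale_vec H.scale_vec assms)
  qed (intro \<Phi>_vec G.add_vec G.scale_vec H.add_vec H.scale_vec assms)+
  then show ?thesis by simp
qed

lemma veq_slices:
  assumes "X \<in> vecs G" "Y \<in> vecs G"
  shows "veq G X Y \<longleftrightarrow> (\<forall>k. veq H (\<Phi> k X) (\<Phi> k Y))"
proof -
  have d: "nrm H (\<Phi> k (\<lambda>i. X i - Y i)) = nrm H (\<lambda>i. \<Phi> k X i - \<Phi> k Y i)" for k
    by (intro H.veq_nrm \<Phi>_diff \<Phi>_vec G.diff_vec H.diff_vec assms)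
  show ?thesis
  proof
    assume XY: "veq G X Y"
    show "\<forall>k. veq H (\<Phi> k X) (\<Phi> k Y)"
    proof
      fix k
      have "nrm H (\<lambda>i. \<Phi> k X i - \<Phi> k Y i) \<le> 0"
        using nrm_slice_le[OF G.diff_vec[OF assms], of k] d[of k] XY by (simp add: veq_def)
      then show "veq H (\<Phi> k X) (\<Phi> k Y)"
        using H.nrm_nonneg[OF H.diff_vec[OF \<Phi>_vec[OF assms(1)] \<Phi>_vec[OF assms(2)]], of k k]
        by (simp add: veq_def)
    qed
  next
    assume "\<forall>k. veq H (\<Phi> k X) (\<Phi> k Y)"
    then have "nrm G (\<lambda>i. X i - Y i) \<le> 0 * nrm G X"
      using d assms G.diff_vec by (intro slice_nrm_le) (auto simp: veq_def)
    then show "veq G X Y"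
      using G.nrm_nonneg[OF G.diff_vec[OF assms]] by (simp add: veq_def)
  qed
qed

text \<open>Linearity and boundedness of T are read off on components, where T acts as
  \<open>c k\<close> times the linear contraction U and \<open>cmod (c k)\<close> is at most
  1.\<close>

lemma T_bounded: "bounded_operator G T"
  unfolding bounded_operator_def veq_def[symmetric]
proof (intro conjI ballI allI)
  fix X assume X: "X \<in> vecs G"
  then show "T X \<in> vecs G" by (rule T_vec)
  fix a
  have "veq H (\<Phi> k (T (\<lambda>j. a * X j))) (\<Phi> k (\<lambda>i. a * T X i))" for k
  proof (rule H.veq_trans)
    show "veq H (\<Phi> k (T (\<lambda>j. a * X j))) (\<lambda>i. c k * U (\<Phi> k (\<lambda>j. a * X j)) i)"
      by (intro \<Phi>_T G.scale_vec X)
    show "veq H (\<lambda>i. c k * U (\<Phi> k (\<lambda>j. a * X j)) i) (\<Phi> k (\<lambda>i. a * T X i))"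
    proof (rule H.veq_trans)
      have "veq H (\<lambda>i. c k * U (\<Phi> k (\<lambda>j. a * X j)) i) (\<lambda>i. c k * U (\<lambda>j. a * \<Phi> k X j) i)"
        by (intro H.veq_scale H.bounded_operator_veq[OF U_bounded] U_vec \<Phi>_vec \<Phi>_scale G.scale_vec H.scale_vec X)
      then show "veq H (\<lambda>i. c k * U (\<Phi> k (\<lambda>j. a * X j)) i) (\<lambda>i. a * (c k * U (\<Phi> k X) i))"
        by (simp add: U_scale algebra_simps)
      show "veq H (\<lambda>i. a * (c k * U (\<Phi> k X) i)) (\<Phi> k (\<lambda>i. a * T X i))"
      proof (rule H.veq_sym, goal_cases)
        case 3
        show ?case
        proof (rule H.veq_trans)
          show "veq H (\<Phi> k (\<lambda>i. a * T X i)) (\<lambda>i. a * \<Phi> k (T X) i)" by (intro \<Phi>_scale T_vec X)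
          show "veq H (\<lambda>i. a * \<Phi> k (T X) i) (\<lambda>i. a * (c k * U (\<Phi> k X) i))"
            by (intro H.veq_scale \<Phi>_T \<Phi>_vec T_vec H.scale_vec U_vec X)
        qed (intro \<Phi>_vec G.scale_vec H.scale_vec T_vec U_vec X)+
      qed (intro \<Phi>_vec G.scale_vec H.scale_vec T_vec U_vec X)+
    qed (intro \<Phi>_vec G.scale_vec H.scale_vec T_vec U_vec X)+
  qed (intro \<Phi>_vec G.scale_vec H.scale_vec T_vec U_vec X)+
  then show "veq G (T (\<lambda>j. a * X j)) (\<lambda>i. a * T X i)"
    by (subst veq_slices) (intro allI T_vec G.scale_vec X | assumption)+
next
  fix X Y assume XY: "X \<in> vecs G" "Y \<in> vecs G"
  have "veq H (\<Phi> k (T (\<lambda>j. X j + Y j))) (\<Phi> k (\<lambda>i. T X i + T Y i))" for k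
  proof (rule H.veq_trans)
    show "veq H (\<Phi> k (T (\<lambda>j. X j + Y j))) (\<lambda>i. c k * U (\<Phi> k (\<lambda>j. X j + Y j)) i)"
      by (intro \<Phi>_T G.add_vec XY)
    show "veq H (\<lambda>i. c k * U (\<Phi> k (\<lambda>j. X j + Y j)) i) (\<Phi> k (\<lambda>i. T X i + T Y i))"
    proof (rule H.veq_trans)
      have "veq H (\<lambda>i. c k * U (\<Phi> k (\<lambda>j. X j + Y j)) i) (\<lambda>i. c k * U (\<lambda>j. \<Phi> k X j + \<Phi> k Y j) i)"
        by (intro H.veq_scale H.bounded_operator_veq[OF U_bounded] U_vec \<Phi>_vec \<Phi>_add G.add_vec H.add_vec XY)
      then show "veq H (\<lambda>i. c k * U (\<Phi> k (\<lambda>j. X j + Y j)) i) (\<lambda>i. c k * U (\<Phi> k X) i + c k * U (\<Phi> k Y) i)"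
        by (simp add: U_add algebra_simps)
      show "veq H (\<lambda>i. c k * U (\<Phi> k X) i + c k * U (\<Phi> k Y) i) (\<Phi> k (\<lambda>i. T X i + T Y i))"
      proof (rule H.veq_sym, goal_cases)
        case 3
        show ?case
        proof (rule H.veq_trans)
          show "veq H (\<Phi> k (\<lambda>i. T X i + T Y i)) (\<lambda>i. \<Phi> k (T X) i + \<Phi> k (T Y) i)"
            by (intro \<Phi>_add T_vec XY)
          show "veq H (\<lambda>i. \<Phi> k (T X) i + \<Phi> k (T Y) i) (\<lambda>i. c k * U (\<Phi> k X) i + c k * U (\<Phi> k Y) i)"
            by (intro H.veq_add \<Phi>_T \<Phi>_vec T_vec H.scale_vec U_vec XY)
        qed (intro \<Phi>_vec G.add_vec H.add_vec H.scale_vec T_vec U_vec XY)+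
      qed (intro \<Phi>_vec G.add_vec H.add_vec H.scale_vec T_vec U_vec XY)+
    qed (intro \<Phi>_vec G.add_vec H.add_vec H.scale_vec T_vec U_vec XY)+
  qed (intro \<Phi>_vec G.add_vec H.add_vec H.scale_vec T_vec U_vec XY)+
  then show "veq G (T (\<lambda>j. X j + Y j)) (\<lambda>i. T X i + T Y i)"
    by (subst veq_slices) (intro allI T_vec G.add_vec XY | assumption)+
next
  have "nrm G (T X) \<le> 1 * nrm G X" if X: "X \<in> vecs G" for X
  proof (rule slice_nrm_le)
    fix k
    have "nrm H (\<Phi> k (T X)) = nrm H (\<lambda>i. c k * U (\<Phi> k X) i)"
      by (intro H.veq_nrm \<Phi>_T \<Phi>_vec T_vec H.scale_vec U_vec X)
    also have "\<dots> = cmod (c k) * nrm H (U (\<Phi> k X))"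
      by (intro H.nrm_scale U_vec \<Phi>_vec X)
    also have "\<dots> \<le> 1 * nrm H (\<Phi> k X)"
      by (intro mult_mono c_le U_contr \<Phi>_vec X H.nrm_nonneg U_vec) auto
    finally show "nrm H (\<Phi> k (T X)) \<le> 1 * nrm H (\<Phi> k X)" .
  qed (use X T_vec in auto)
  then show "\<exists>C. \<forall>X\<in>vecs G. nrm G (T X) \<le> C * nrm G X" by blast
qed

lemma \<Phi>_resolvent:
  assumes X: "X \<in> vecs G"
  shows "veq H (\<Phi> k (\<lambda>i. T X i - z * X i)) (\<lambda>i. c k * U (\<Phi> k X) i - z * \<Phi> k X i)"
proof (rule H.veq_trans)
  show "veq H (\<Phi> k (\<lambda>i. T X i - z * X i)) (\<lambda>i. \<Phi> k (T X) i - \<Phi> k (\<lambda>i. z * X i) i)"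
    by (intro \<Phi>_diff T_vec G.scale_vec X)
  show "veq H (\<lambda>i. \<Phi> k (T X) i - \<Phi> k (\<lambda>i. z * X i) i) (\<lambda>i. c k * U (\<Phi> k X) i - z * \<Phi> k X i)"
    by (intro H.veq_diff \<Phi>_T \<Phi>_scale \<Phi>_vec T_vec G.scale_vec H.scale_vec U_vec X)
qed (intro \<Phi>_vec G.diff_vec G.scale_vec H.diff_vec H.scale_vec T_vec U_vec X)+

lemma slice_operator_vec: "g \<in> vecs H \<Longrightarrow> (\<lambda>i. a * U g i - z * g i) \<in> vecs H"
  by (intro H.diff_vec H.scale_vec U_vec)

lemma slice_operator_bounded: "bounded_operator H (\<lambda>g i. a * U g i - z * g i)"
  by (rule H.bounded_operator_lincomb[OF U_bounded])

text \<open>A vector concentrated in component k is an isometric copy of its entry, and T - z leaves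
  it concentrated there; this transfers the lower bound. For solvability, solve in G and take
  component k of the solution.\<close>

lemma bounded_inverse_sliceI:
  assumes C: "0 \<le> C" and inv: "bounded_inverse G (\<lambda>X i. T X i - z * X i) C"
  shows "bounded_inverse H (\<lambda>g i. c k * U g i - z * g i) C"
proof -
  have single: "\<exists>X\<in>vecs G. \<forall>l. veq H (\<Phi> l X) (if l = k then g else (\<lambda>_. 0))" if g: "g \<in> vecs H" for g
  proof (rule \<Phi>_onto)
    show "(if l = k then g else (\<lambda>_. 0)) \<in> vecs H" for l
      using g H.zero_vec by auto
    have "(\<lambda>l. (nrm H (if l = k then g else (\<lambda>_. 0)))\<^sup>2) summable_on {k}" by simp
    then show "(\<lambda>l. (nrm H (if l = k then g else (\<lambda>_. 0)))\<^sup>2) summable_on UNIV"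
      by (subst summable_on_cong_neutral[of "{k}" UNIV]) (auto simp: H.nrm_zero)
  qed
  have single_nrm: "nrm G X = nrm H h" if X: "X \<in> vecs G" and h: "h \<in> vecs H"
    and sl: "\<And>l. veq H (\<Phi> l X) (if l = k then h else (\<lambda>_. 0))" for X h
  proof -
    have *: "nrm H (\<Phi> l X) = (if l = k then nrm H h else 0)" for l
      using H.veq_nrm[OF \<Phi>_vec[OF X] _ sl[of l]] h H.zero_vec H.nrm_zero by (auto split: if_splits)
    have "((\<lambda>l. (nrm H (\<Phi> l X))\<^sup>2) has_sum (nrm H h)\<^sup>2) {k}"
      by (simp add: * has_sum_finite_iff)
    then have "((\<lambda>l. (nrm H (\<Phi> l X))\<^sup>2) has_sum (nrm H h)\<^sup>2) UNIV"
      by (subst has_sum_cong_neutral[of "{k}" UNIV]) (auto simp: *)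
    then have "(nrm G X)\<^sup>2 = (nrm H h)\<^sup>2"
      using \<Phi>_nrm[OF X] has_sum_unique by blast
    then show ?thesis
      using G.nrm_nonneg[OF X] H.nrm_nonneg[OF h] by (simp add: power2_eq_iff_nonneg)
  qed
  have lower: "nrm H g \<le> C * nrm H (\<lambda>i. c k * U g i - z * g i)" if g: "g \<in> vecs H" for g
  proof -
    obtain X where X: "X \<in> vecs G" and sl: "\<And>l. veq H (\<Phi> l X) (if l = k then g else (\<lambda>_. 0))"
      using single[OF g] by auto
    define Y where "Y = (\<lambda>i. T X i - z * X i)"
    have Y: "Y \<in> vecs G" unfolding Y_def by (intro G.diff_vec G.scale_vec T_vec X)
    have "veq H (\<Phi> l Y) (if l = k then (\<lambda>i. c k * U g i - z * g i) else (\<lambda>_. 0))" for l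
    proof (rule H.veq_trans)
      show "veq H (\<Phi> l Y) (\<lambda>i. c l * U (\<Phi> l X) i - z * \<Phi> l X i)"
        unfolding Y_def by (rule \<Phi>_resolvent[OF X])
      define h where "h = (if l = k then g else (\<lambda>_. 0))"
      have h: "h \<in> vecs H" using g H.zero_vec by (auto simp: h_def)
      have "veq H (\<lambda>i. c l * U (\<Phi> l X) i - z * \<Phi> l X i) (\<lambda>i. c l * U h i - z * h i)"
        by (rule H.bounded_operator_veq[OF slice_operator_bounded \<Phi>_vec[OF X] h])
           (use sl[of l] in \<open>simp add: h_def\<close>)
      moreover have "(\<lambda>i. c l * U h i - z * h i) =
          (if l = k then (\<lambda>i. c k * U g i - z * g i) else (\<lambda>_. 0))"
        using U_scale[of 0 "\<lambda>_. 0"] by (auto simp: h_def)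
      ultimately show "veq H (\<lambda>i. c l * U (\<Phi> l X) i - z * \<Phi> l X i)
          (if l = k then (\<lambda>i. c k * U g i - z * g i) else (\<lambda>_. 0))"
        by simp
    qed (use Y X g slice_operator_vec H.zero_vec \<Phi>_vec in auto)
    then have "nrm G Y = nrm H (\<lambda>i. c k * U g i - z * g i)"
      by (intro single_nrm Y slice_operator_vec g)
    moreover have "nrm G X = nrm H g" by (intro single_nrm X g sl)
    ultimately show ?thesis using inv X unfolding bounded_inverse_def Y_def by auto
  qed
  have "\<exists>g\<in>vecs H. veq H (\<lambda>i. c k * U g i - z * g i) f" if f: "f \<in> vecs H" for f
  proof -
    obtain X where X: "X \<in> vecs G" and sl: "\<And>l. veq H (\<Phi> l X) (if l = k then f else (\<lambda>_. 0))"
      using single[OF f] by auto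
    obtain Y where Y: "Y \<in> vecs G" "veq G (\<lambda>i. T Y i - z * Y i) X"
      using inv X by (auto simp: bounded_inverse_def)
    have R: "(\<lambda>i. T Y i - z * Y i) \<in> vecs G" by (intro G.diff_vec G.scale_vec T_vec Y)
    have 1: "veq H (\<Phi> k (\<lambda>i. T Y i - z * Y i)) f"
      by (rule H.veq_trans[of _ "\<Phi> k X"])
         (use sl[of k] Y veq_slices[OF R X] R X f \<Phi>_vec in auto)
    have 2: "veq H (\<lambda>i. c k * U (\<Phi> k Y) i - z * \<Phi> k Y i) (\<Phi> k (\<lambda>i. T Y i - z * Y i))"
      by (rule H.veq_sym[OF \<Phi>_vec[OF R] slice_operator_vec[OF \<Phi>_vec] \<Phi>_resolvent]) (rule Y)+
    have "veq H (\<lambda>i. c k * U (\<Phi> k Y) i - z * \<Phi> k Y i) f"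
      by (rule H.veq_trans[OF _ _ _ 2 1]) (use \<Phi>_vec R Y slice_operator_vec f in auto)
    then show ?thesis using \<Phi>_vec[OF Y(1)] by blast
  qed
  then show ?thesis using lower by (auto simp: bounded_inverse_def)
qed

text \<open>One constant for all k is the point: the solution in slice k is bounded by C times
  component k of the right-hand side, so the solutions are square-summable and
  \<open>\<Phi>_onto\<close> joins them into a vector of G.\<close>

lemma bounded_inverse_slicesD:
  assumes C: "0 \<le> C" and inv: "\<And>k. bounded_inverse H (\<lambda>g i. c k * U g i - z * g i) C"
  shows "bounded_inverse G (\<lambda>X i. T X i - z * X i) C"
proof -
  have R: "(\<lambda>i. T X i - z * X i) \<in> vecs G" if "X \<in> vecs G" for X
    by (intro G.diff_vec G.scale_vec T_vec that)
  have lower: "nrm G X \<le> C * nrm G (\<lambda>i. T X i - z * X i)" if X: "X \<in> vecs G" for X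
  proof (rule slice_nrm_le[OF X R[OF X] _ C])
    fix k
    have "nrm H (\<Phi> k (\<lambda>i. T X i - z * X i)) = nrm H (\<lambda>i. c k * U (\<Phi> k X) i - z * \<Phi> k X i)"
      by (rule H.veq_nrm[OF \<Phi>_vec[OF R[OF X]] slice_operator_vec[OF \<Phi>_vec[OF X]] \<Phi>_resolvent[OF X]])
    then show "nrm H (\<Phi> k X) \<le> C * nrm H (\<Phi> k (\<lambda>i. T X i - z * X i))"
      using inv[of k] \<Phi>_vec[OF X] by (auto simp: bounded_inverse_def)
  qed
  have "\<exists>X\<in>vecs G. veq G (\<lambda>i. T X i - z * X i) Y" if Y: "Y \<in> vecs G" for Y
  proof -
    have "\<forall>k. \<exists>g. g \<in> vecs H \<and> veq H (\<lambda>i. c k * U g i - z * g i) (\<Phi> k Y)"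
      using inv[unfolded bounded_inverse_def] \<Phi>_vec[OF Y] by blast
    then obtain g where g: "\<And>k. g k \<in> vecs H"
      and eq: "\<And>k. veq H (\<lambda>i. c k * U (g k) i - z * g k i) (\<Phi> k Y)"
      by metis
    have le: "nrm H (g k) \<le> C * nrm H (\<Phi> k Y)" for k
      using inv[of k] g[of k] H.veq_nrm[OF slice_operator_vec[OF g] \<Phi>_vec[OF Y] eq, of k]
      by (auto simp: bounded_inverse_def)
    have "(nrm H (g k))\<^sup>2 \<le> C\<^sup>2 * (nrm H (\<Phi> k Y))\<^sup>2" for k
      using power_mono[OF le[of k], of 2] H.nrm_nonneg[OF g[of k]] by (simp add: power_mult_distrib)
    then have "(\<lambda>k. (nrm H (g k))\<^sup>2) summable_on UNIV"
      using has_sum_cmult_right[OF \<Phi>_nrm[OF Y], of "C\<^sup>2"]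
      by (rule_tac summable_on_comparison_test[where f = "\<lambda>k. C\<^sup>2 * (nrm H (\<Phi> k Y))\<^sup>2"])
         (auto simp: summable_on_def)
    then obtain X where X: "X \<in> vecs G" and sl: "\<And>k. veq H (\<Phi> k X) (g k)"
      using \<Phi>_onto[of g] g by blast
    have "veq H (\<Phi> k (\<lambda>i. T X i - z * X i)) (\<Phi> k Y)" for k
    proof (rule H.veq_trans[OF _ _ _ \<Phi>_resolvent[OF X] H.veq_trans[OF _ _ _ _ eq]])
      show "veq H (\<lambda>i. c k * U (\<Phi> k X) i - z * \<Phi> k X i) (\<lambda>i. c k * U (g k) i - z * g k i)"
        by (rule H.bounded_operator_veq[OF slice_operator_bounded \<Phi>_vec[OF X] g sl])
    qed (intro \<Phi>_vec R X Y slice_operator_vec g)+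
    then have "veq G (\<lambda>i. T X i - z * X i) Y" by (simp add: veq_slices R X Y)
    then show ?thesis using X by blast
  qed
  then show ?thesis using lower by (auto simp: bounded_inverse_def)
qed

lemma slice_invertible_iff:
  "(\<exists>C>0. bounded_inverse H (\<lambda>g i. c k * U g i - z * g i) C) \<longleftrightarrow> z / c k \<notin> spectrum H U"
proof -
  have "\<exists>C>0. bounded_inverse H (\<lambda>g i. U g i - z / c k * g i) C"
    if "bounded_inverse H (\<lambda>g i. c k * U g i - z * g i) C" "C > 0" for C
    using H.bounded_inverse_scale[OF that(1), of "1 / c k"] that(2) c_nz[of k] slice_operator_vec
    by (intro exI[of _ "C / cmod (1 / c k)"]) (auto simp: algebra_simps diff_divide_distrib)
  moreover have "\<exists>C>0. bounded_inverse H (\<lambda>g i. c k * U g i - z * g i) C"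
    if "bounded_inverse H (\<lambda>g i. U g i - z / c k * g i) C" "C > 0" for C
  proof -
    have "(\<lambda>i. U g i - z / c k * g i) \<in> vecs H" if "g \<in> vecs H" for g
      using slice_operator_vec[OF that, of 1 "z / c k"] by simp
    from H.bounded_inverse_scale[OF that(1) c_nz[of k] this] that(2) c_nz[of k] show ?thesis
      by (intro exI[of _ "C / cmod (c k)"]) (auto simp: algebra_simps)
  qed
  ultimately show ?thesis
    unfolding H.not_in_spectrum_iff[OF U_bounded] by blast
qed

theorem spectrum_diagonal:
  assumes one: "1 \<in> spectrum H U"
    and fin: "\<And>e. e > 0 \<Longrightarrow> finite {c k | k. cmod (c k) > e}"
  shows "spectrum G T = closure {c k * a | k a. a \<in> spectrum H U}" (is "_ = closure ?E")
proof (intro equalityI subsetI; rule ccontr)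
  fix z assume z: "z \<in> closure ?E" "z \<notin> spectrum G T"
  then obtain C where C: "C > 0" "bounded_inverse G (\<lambda>X i. T X i - z * X i) C"
    using G.not_in_spectrum_iff[OF T_bounded] by blast
  \<comment> \<open>1 / C is the radius within which the perturbation bound applies. For a product w
    that close to z, the slice operator at w would still be invertible, although w / c k = a lies in
    the spectrum of U.\<close>
  obtain w where w: "w \<in> ?E" "dist w z < 1 / C"
    using z(1)[unfolded closure_approachable, rule_format, of "1 / C"] C(1) by auto
  then obtain k a where a: "w = c k * a" "a \<in> spectrum H U" by blast
  have dC: "cmod (w - z) * C < 1" using w C by (simp add: dist_norm field_simps)
  have "bounded_inverse H (\<lambda>g i. c k * U g i - w * g i) (C / (1 - cmod (w - z) * C))"
  proof (rule H.bounded_inverse_perturb[OF slice_operator_bounded slice_operator_bounded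
        bounded_inverse_sliceI[OF _ C(2)]])
    fix g assume g: "g \<in> vecs H"
    have "(\<lambda>i. c k * U g i - w * g i - (c k * U g i - z * g i)) = (\<lambda>i. (z - w) * g i)"
      by (auto simp: algebra_simps)
    then show "nrm H (\<lambda>i. c k * U g i - w * g i - (c k * U g i - z * g i)) \<le> cmod (w - z) * nrm H g"
      by (simp add: H.nrm_scale[OF g] norm_minus_commute)
  qed (use C dC in auto)
  moreover have "C / (1 - cmod (w - z) * C) > 0" using dC C(1) by simp
  ultimately have "\<exists>C>0. bounded_inverse H (\<lambda>g i. c k * U g i - w * g i) C"
    by (intro exI[of _ "C / (1 - cmod (w - z) * C)"] conjI)
  then have "w / c k \<notin> spectrum H U"
    by (rule slice_invertible_iff[THEN iffD1])
  then show False using a c_nz[of k] by simp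
next
  fix z assume z: "z \<in> spectrum G T" "z \<notin> closure ?E"
  \<comment> \<open>e separates the components treated value by value from those small against z.
    For z = 0 there must be none of the second kind: as 1 is in the spectrum of U, every
    \<open>c k\<close> is itself one of the products, so 0 outside the closure keeps all
    \<open>c k\<close> away from 0.\<close>
  obtain e where e: "e > 0" "\<And>k. cmod (c k) \<le> e \<Longrightarrow> z \<noteq> 0 \<and> e \<le> cmod z / 2"
  proof (cases "z = 0")
    case True
    obtain e where e: "e > 0" "\<And>w. w \<in> ?E \<Longrightarrow> e \<le> dist w 0"
      using z(2) True unfolding closure_approachable by (meson not_less)
    have "c k \<in> ?E" for k using one by force
    then have "e \<le> cmod (c k)" for k using e(2)[of "c k"] by simp
    then have "\<not> cmod (c k) \<le> e / 2" for k using e(1) by (smt (verit) field_sum_of_halves)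
    then show ?thesis using that[of "e / 2"] e(1) by auto
  next
    case False
    then show ?thesis using that[of "cmod z / 2"] by auto
  qed
  \<comment> \<open>A set of values rather than of indices: it can be finite although infinitely
    many k share a value, as happens for the eigenvalues at time 0.\<close>
  define \<Lambda> where "\<Lambda> = {c k | k. cmod (c k) > e}"
  have finL: "finite \<Lambda>" unfolding \<Lambda>_def by (rule fin[OF e(1)])
  have "z / c k \<notin> spectrum H U" for k
  proof
    assume "z / c k \<in> spectrum H U"
    then have "c k * (z / c k) \<in> ?E" by blast
    then have "z \<in> ?E" using c_nz[of k] by simp
    with closure_subset have "z \<in> closure ?E" by (rule subsetD)
    with z(2) show False by contradiction
  qed
  then have inv: "\<exists>C>0. bounded_inverse H (\<lambda>g i. c k * U g i - z * g i) C" for k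
    unfolding slice_invertible_iff .
  have "\<forall>l\<in>\<Lambda>. \<exists>C>0. bounded_inverse H (\<lambda>g i. l * U g i - z * g i) C"
    using inv by (auto simp: \<Lambda>_def)
  from bchoice[OF this] obtain K where K: "\<forall>l\<in>\<Lambda>. K l > 0 \<and> bounded_inverse H (\<lambda>g i. l * U g i - z * g i) (K l)"
    by blast
  \<comment> \<open>For small \<open>c k\<close> the slice operator is compared with -z, whose
    inverse is bounded by 1 / |z|; an error of at most |z| / 2 doubles this bound. For z = 0 no
    small \<open>c k\<close> exist and 1 is a placeholder.\<close>
  define M where "M = (if z = 0 then 1 else 2 / cmod z)"
  define C where "C = Max (insert M (K ` \<Lambda>))"
  have C: "M \<le> C" "\<And>l. l \<in> \<Lambda> \<Longrightarrow> K l \<le> C"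
    unfolding C_def using finL by simp_all
  have "M > 0" by (simp add: M_def)
  then have C0: "C > 0" using C(1) by linarith
  have "bounded_inverse H (\<lambda>g i. c k * U g i - z * g i) C" for k
  proof (cases "cmod (c k) > e")
    case True
    then have "c k \<in> \<Lambda>" by (auto simp: \<Lambda>_def)
    then have "bounded_inverse H (\<lambda>g i. c k * U g i - z * g i) (K (c k))" using K by blast
    then show ?thesis by (rule H.bounded_inverse_mono[OF _ C(2)[OF \<open>c k \<in> \<Lambda>\<close>] slice_operator_vec])
  next
    case False
    then have z0: "z \<noteq> 0" and ez: "e \<le> cmod z / 2" using e(2)[of k] by auto
    have base: "bounded_inverse H (\<lambda>g i. 0 * U g i - z * g i) (1 / cmod z)"
    proof -
      have "bounded_inverse H (\<lambda>g. g) 1"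
        unfolding bounded_inverse_def using H.veq_refl by auto
      from H.bounded_inverse_scale[OF this, of "- z"] z0 show ?thesis by simp
    qed
    have "bounded_inverse H (\<lambda>g i. c k * U g i - z * g i) (1 / cmod z / (1 - cmod z / 2 * (1 / cmod z)))"
    proof (rule H.bounded_inverse_perturb[OF slice_operator_bounded slice_operator_bounded base])
      fix g assume g: "g \<in> vecs H"
      have "nrm H (\<lambda>i. c k * U g i) \<le> cmod z / 2 * nrm H g"
        using False ez mult_mono[OF _ U_contr[OF g], of "cmod (c k)" "cmod z / 2"]
          H.nrm_nonneg[OF U_vec[OF g]] by (simp add: H.nrm_scale[OF U_vec[OF g]])
      then show "nrm H (\<lambda>i. c k * U g i - z * g i - (0 * U g i - z * g i)) \<le> cmod z / 2 * nrm H g"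
        by simp
    qed (use z0 in auto)
    then show ?thesis
      by (rule H.bounded_inverse_mono) (use C(1) z0 slice_operator_vec in \<open>auto simp: M_def field_simps\<close>)
  qed
  then have "bounded_inverse G (\<lambda>X i. T X i - z * X i) C"
    using C0 by (intro bounded_inverse_slicesD) auto
  then show False
    using z(1) C0 G.not_in_spectrum_iff[OF T_bounded] by blast
qed

end

section \<open>Orthonormal bases\<close>

locale hilbert_space =
  fixes H :: "'x ipspace"
  assumes hilbert: "hilbert H"
begin

lemma
  shows hilbert_add_vec: "f \<in> vecs H \<Longrightarrow> g \<in> vecs H \<Longrightarrow> (\<lambda>i. f i + g i) \<in> vecs H"
    and hilbert_scale_vec: "f \<in> vecs H \<Longrightarrow> (\<lambda>i. a * f i) \<in> vecs H"
    and ip_add_left: "f \<in> vecs H \<Longrightarrow> g \<in> vecs H \<Longrightarrow> h \<in> vecs H \<Longrightarrow>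
      ip H (\<lambda>i. f i + g i) h = ip H f h + ip H g h"
    and ip_scale_left: "f \<in> vecs H \<Longrightarrow> g \<in> vecs H \<Longrightarrow> ip H (\<lambda>i. a * f i) g = a * ip H f g"
    and ip_commute: "f \<in> vecs H \<Longrightarrow> g \<in> vecs H \<Longrightarrow> ip H g f = cnj (ip H f g)"
    and ip_nonneg: "f \<in> vecs H \<Longrightarrow> 0 \<le> Re (ip H f f)"
  using hilbert unfolding hilbert_def by blast+

lemma ip_add_right: "f \<in> vecs H \<Longrightarrow> g \<in> vecs H \<Longrightarrow> h \<in> vecs H \<Longrightarrow>
      ip H h (\<lambda>i. f i + g i) = ip H h f + ip H h g"
  using ip_commute[of "\<lambda>i. f i + g i" h] ip_commute[of f h] ip_commute[of g h]
  by (simp add: hilbert_add_vec ip_add_left)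

lemma ip_scale_right: "f \<in> vecs H \<Longrightarrow> g \<in> vecs H \<Longrightarrow> ip H g (\<lambda>i. a * f i) = cnj a * ip H g f"
  using ip_commute[of "\<lambda>i. a * f i" g] ip_commute[of f g]
  by (simp add: hilbert_scale_vec ip_scale_left)

lemma ip_self: "f \<in> vecs H \<Longrightarrow> ip H f f = complex_of_real ((nrm H f)\<^sup>2)"
  using ip_commute[of f f] ip_nonneg[of f]
  by (auto simp: nrm_def complex_eq_iff)

text \<open>The squared norm of f - r <f, g> g is nonnegative for all real r; scaling g by <f, g>
  makes the cross terms real. The form is only semidefinite, so a g of norm 0 needs a separate
  argument.\<close>

lemma cauchy_schwarz:
  assumes f: "f \<in> vecs H" and g: "g \<in> vecs H"
  shows "cmod (ip H f g) \<le> nrm H f * nrm H g"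
proof -
  define b where "b = (cmod (ip H f g))\<^sup>2"
  have b0: "b \<ge> 0" by (simp add: b_def)
  have nn: "nrm H f \<ge> 0" "nrm H g \<ge> 0" using ip_nonneg f g by (auto simp: nrm_def)
  have quad: "0 \<le> (nrm H f)\<^sup>2 - 2 * r * b + r\<^sup>2 * b * (nrm H g)\<^sup>2" for r :: real
  proof -
    define a where "a = - (of_real r * ip H f g)"
    have ag: "(\<lambda>i. a * g i) \<in> vecs H" by (rule hilbert_scale_vec[OF g])
    have bb: "ip H f g * cnj (ip H f g) = of_real b"
      unfolding b_def using complex_norm_square[of "ip H f g"] by simp
    have "ip H (\<lambda>i. f i + a * g i) (\<lambda>i. f i + a * g i) =
        ip H f f + cnj a * ip H f g + a * (cnj (ip H f g) + cnj a * ip H g g)"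
      using f g ag ip_commute[OF f g]
      by (simp add: ip_add_left ip_add_right ip_scale_left ip_scale_right hilbert_add_vec algebra_simps)
    also have "cnj a * ip H f g = of_real (- r * b)"
      using bb by (simp add: a_def mult.commute mult.left_commute)
    also have "a * (cnj (ip H f g) + cnj a * ip H g g) = of_real (- r * b + r\<^sup>2 * b * (nrm H g)\<^sup>2)"
      unfolding a_def ip_self[OF g] using bb by (simp add: algebra_simps power2_eq_square)
    also have "ip H f f + of_real (- r * b) + of_real (- r * b + r\<^sup>2 * b * (nrm H g)\<^sup>2) =
       complex_of_real ((nrm H f)\<^sup>2 - 2 * r * b + r\<^sup>2 * b * (nrm H g)\<^sup>2)"
      by (simp add: ip_self[OF f])
    finally show ?thesis
      using ip_nonneg[OF hilbert_add_vec[OF f ag]] by simp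
  qed
  have "b \<le> (nrm H f)\<^sup>2 * (nrm H g)\<^sup>2"
  proof (cases "nrm H g = 0")
    case True
    have "b = 0"
    proof (rule ccontr)
      assume "b \<noteq> 0"
      \<comment> \<open>For g of norm 0 the quadratic degenerates to a linear function of r, and
        this r turns the inequality into 0 \<le> -1.\<close>
      then show False using quad[of "((nrm H f)\<^sup>2 + 1) / (2 * b)"] True by simp
    qed
    then show ?thesis by simp
  next
    case False
    then have G: "(nrm H g)\<^sup>2 > 0" by simp
    have "(1 / G)\<^sup>2 * b * G = 1 / G * b" if "G > 0" for G :: real
      using that by (simp add: power2_eq_square)
    from this[OF G] have "b / (nrm H g)\<^sup>2 \<le> (nrm H f)\<^sup>2"
      using quad[of "1 / (nrm H g)\<^sup>2"] by simp
    then show ?thesis using G by (simp add: pos_divide_le_eq)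
  qed
  then have "(cmod (ip H f g))\<^sup>2 \<le> (nrm H f * nrm H g)\<^sup>2"
    by (simp add: b_def power_mult_distrib)
  then show ?thesis by (rule power2_le_imp_le) (use nn in auto)
qed

sublocale complete_seminormed_space H
proof
  fix f g :: "'x \<Rightarrow> complex" and a :: complex
  assume f: "f \<in> vecs H"
  then have "ip H (\<lambda>i. a * f i) (\<lambda>i. a * f i) = (a * cnj a) * of_real ((nrm H f)\<^sup>2)"
    by (simp add: ip_scale_left ip_scale_right hilbert_scale_vec ip_self)
  also have "\<dots> = of_real ((cmod a * nrm H f)\<^sup>2)"
    unfolding complex_norm_square[symmetric] by (simp add: power_mult_distrib)
  finally show "nrm H (\<lambda>i. a * f i) = cmod a * nrm H f"
    using ip_nonneg[OF f] by (simp add: nrm_def)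
  assume g: "g \<in> vecs H"
  have "ip H (\<lambda>i. f i + g i) (\<lambda>i. f i + g i) =
      of_real ((nrm H f)\<^sup>2) + (ip H f g + cnj (ip H f g)) + of_real ((nrm H g)\<^sup>2)"
    unfolding ip_self[OF f, symmetric] ip_self[OF g, symmetric] ip_commute[OF f g, symmetric]
    using f g by (simp add: ip_add_left ip_add_right hilbert_add_vec)
  then have "Re (ip H (\<lambda>i. f i + g i) (\<lambda>i. f i + g i)) =
      (nrm H f)\<^sup>2 + 2 * Re (ip H f g) + (nrm H g)\<^sup>2" by simp
  also have "\<dots> \<le> (nrm H f + nrm H g)\<^sup>2"
    using cauchy_schwarz[OF f g] complex_Re_le_cmod[of "ip H f g"]
    by (simp add: power2_eq_square algebra_simps)
  finally show "nrm H (\<lambda>i. f i + g i) \<le> nrm H f + nrm H g"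
    using ip_nonneg f g unfolding nrm_def by (metis add_nonneg_nonneg real_le_lsqrt real_sqrt_ge_zero)
qed (use hilbert in \<open>auto simp: hilbert_def\<close>)

lemma sum_vec: "finite A \<Longrightarrow> (\<And>k. k \<in> A \<Longrightarrow> f k \<in> vecs H) \<Longrightarrow> (\<lambda>i. \<Sum>k\<in>A. a k * f k i) \<in> vecs H"
  by (induction A rule: finite_induct) (auto simp: zero_vec add_vec scale_vec)

lemma ip_zero_left: "g \<in> vecs H \<Longrightarrow> ip H (\<lambda>_. 0) g = 0"
  using ip_scale_left[OF zero_vec, of g 0] by simp

lemma ip_sum_left:
  "finite A \<Longrightarrow> (\<And>k. k \<in> A \<Longrightarrow> f k \<in> vecs H) \<Longrightarrow> g \<in> vecs H \<Longrightarrow>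
    ip H (\<lambda>i. \<Sum>k\<in>A. a k * f k i) g = (\<Sum>k\<in>A. a k * ip H (f k) g)"
  by (induction A rule: finite_induct)
     (auto simp: ip_zero_left ip_add_left ip_scale_left scale_vec sum_vec)

lemma ip_sum_right:
  assumes "finite A" "\<And>k. k \<in> A \<Longrightarrow> f k \<in> vecs H" "g \<in> vecs H"
  shows "ip H g (\<lambda>i. \<Sum>k\<in>A. a k * f k i) = (\<Sum>k\<in>A. cnj (a k) * ip H g (f k))"
proof -
  have "ip H g (\<lambda>i. \<Sum>k\<in>A. a k * f k i) = cnj (\<Sum>k\<in>A. a k * ip H (f k) g)"
    using ip_commute[OF sum_vec[of A f a] assms(3)] ip_sum_left[of A f g a] assms by simp
  also have "\<dots> = (\<Sum>k\<in>A. cnj (a k) * ip H g (f k))"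
    using assms ip_commute[OF assms(2) assms(3)] by (auto simp: cnj_sum intro!: sum.cong)
  finally show ?thesis .
qed

lemma ip_diff_left:
  assumes "f \<in> vecs H" "g \<in> vecs H" "h \<in> vecs H"
  shows "ip H (\<lambda>i. f i - g i) h = ip H f h - ip H g h"
  using ip_add_left[OF assms(1) scale_vec[OF assms(2), of "-1"] assms(3)]
    ip_scale_left[OF assms(2,3), of "-1"] by simp

lemma ip_tendsto_left:
  assumes "\<And>n. X n \<in> vecs H" "f \<in> vecs H" "g \<in> vecs H" "(\<lambda>n. nrm H (\<lambda>i. X n i - f i)) \<longlonglongrightarrow> 0"
  shows "(\<lambda>n. ip H (X n) g) \<longlonglongrightarrow> ip H f g"
proof (rule Lim_null[THEN iffD2], rule Lim_null_comparison)
  show "(\<lambda>n. nrm H (\<lambda>i. X n i - f i) * nrm H g) \<longlonglongrightarrow> 0"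
    using assms(4) by (auto intro: tendsto_mult_left_zero)
  show "\<forall>\<^sub>F n in sequentially. norm (ip H (X n) g - ip H f g) \<le> nrm H (\<lambda>i. X n i - f i) * nrm H g"
    using cauchy_schwarz[OF diff_vec[OF assms(1,2)] assms(3)] assms
    by (auto simp: ip_diff_left[symmetric])
qed

end

section \<open>Finite exhaustions of a countable index set: from unordered sums to limits of
  sequences\<close>

definition exhaustion :: "nat \<Rightarrow> 'k::countable set" where
  "exhaustion n = {k. to_nat k < n}"

lemma finite_exhaustion: "finite (exhaustion n)"
  unfolding exhaustion_def by (rule finite_imageD[of to_nat]) (auto intro: finite_subset[of _ "{..<n}"])

lemma exhaustion_mono: "m \<le> n \<Longrightarrow> exhaustion m \<subseteq> exhaustion n"
  by (auto simp: exhaustion_def)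

lemma eventually_exhaustion: "\<forall>\<^sub>F n in sequentially. k \<in> exhaustion n"
  using eventually_gt_at_top[of "to_nat k"] by (simp add: exhaustion_def)

lemma filterlim_exhaustion: "filterlim exhaustion (finite_subsets_at_top UNIV) sequentially"
  unfolding filterlim_finite_subsets_at_top
proof (intro allI impI)
  fix X :: "'a::countable set" assume X: "finite X \<and> X \<subseteq> UNIV"
  then have "\<forall>\<^sub>F n in sequentially. \<forall>k\<in>X. k \<in> exhaustion n"
    by (intro eventually_ball_finite) (auto intro: eventually_exhaustion)
  then show "\<forall>\<^sub>F n in sequentially. finite (exhaustion n) \<and> X \<subseteq> exhaustion n \<and> exhaustion n \<subseteq> UNIV"
    by eventually_elim (auto simp: finite_exhaustion)
qed

lemma has_sum_exhaustion:
  "(f has_sum s) UNIV \<Longrightarrow> (\<lambda>n. sum f (exhaustion n)) \<longlonglongrightarrow> s"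
  unfolding has_sum_def using filterlim_compose[OF _ filterlim_exhaustion] by blast

lemma summable_exhaustion_cauchy:
  fixes f :: "'k::countable \<Rightarrow> real"
  assumes "f summable_on UNIV" "e > 0"
  shows "\<exists>N. \<forall>m\<ge>N. \<forall>n\<ge>N. n \<le> m \<longrightarrow> sum f (exhaustion m - exhaustion n) < e"
proof -
  obtain s where "(f has_sum s) UNIV" using assms(1) by (auto simp: summable_on_def)
  then have "Cauchy (\<lambda>n. sum f (exhaustion n))"
    using has_sum_exhaustion LIMSEQ_imp_Cauchy by blast
  then obtain N where N: "\<And>m n. m \<ge> N \<Longrightarrow> n \<ge> N \<Longrightarrow> dist (sum f (exhaustion m)) (sum f (exhaustion n)) < e"
    using assms(2) unfolding Cauchy_def by blast
  show ?thesis
  proof (intro exI[of _ N] allI impI)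
    fix m n assume mn: "N \<le> m" "N \<le> n" "n \<le> m"
    show "sum f (exhaustion m - exhaustion n) < e"
      using N[OF mn(1,2)] mn(3)
      by (subst sum_diff) (auto simp: finite_exhaustion exhaustion_mono dist_real_def)
  qed
qed

text \<open>Totality is expressed by the orthogonal complement: only null vectors are orthogonal to
  every \<open>e k\<close>. This is the form proved for the monomials, and completeness turns it
  into convergent expansions.\<close>

locale orthonormal_basis = hilbert_space H for H :: "'x ipspace" +
  fixes e :: "'k::countable \<Rightarrow> 'x \<Rightarrow> complex"
  assumes e_vec: "e k \<in> vecs H"
    and e_orth: "ip H (e k) (e l) = (if k = l then 1 else 0)"
    and e_total: "f \<in> vecs H \<Longrightarrow> (\<And>k. ip H f (e k) = 0) \<Longrightarrow> nrm H f = 0"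
begin

lemma inj_e: "inj e"
proof (rule injI)
  fix k l assume "e k = e l"
  then show "k = l" using e_orth[of k l] e_orth[of l l] by (auto split: if_splits)
qed

definition psum :: "('k \<Rightarrow> complex) \<Rightarrow> 'k set \<Rightarrow> 'x \<Rightarrow> complex" where
  "psum a A = (\<lambda>i. \<Sum>k\<in>A. a k * e k i)"

lemma psum_vec: "finite A \<Longrightarrow> psum a A \<in> vecs H"
  unfolding psum_def by (intro sum_vec e_vec)

lemma ip_psum: "finite A \<Longrightarrow> g \<in> vecs H \<Longrightarrow> ip H (psum a A) g = (\<Sum>k\<in>A. a k * cnj (ip H g (e k)))"
  unfolding psum_def by (subst ip_sum_left) (auto simp: e_vec ip_commute[of g] intro!: sum.cong)

lemma ip_psum_e: "finite A \<Longrightarrow> ip H (psum a A) (e l) = (if l \<in> A then a l else 0)"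
proof -
  assume A: "finite A"
  have "ip H (psum a A) (e l) = (\<Sum>k\<in>A. if k = l then a k else 0)"
    unfolding ip_psum[OF A e_vec] by (intro sum.cong) (auto simp: e_orth)
  then show ?thesis using A by simp
qed

lemma nrm_psum: "finite A \<Longrightarrow> (nrm H (psum a A))\<^sup>2 = (\<Sum>k\<in>A. (cmod (a k))\<^sup>2)"
proof -
  assume A: "finite A"
  have "complex_of_real ((nrm H (psum a A))\<^sup>2) = (\<Sum>k\<in>A. a k * cnj (a k))"
    unfolding ip_self[OF psum_vec[OF A], symmetric] ip_psum[OF A psum_vec[OF A]]
    by (intro sum.cong) (simp_all add: ip_psum_e A)
  also have "\<dots> = complex_of_real (\<Sum>k\<in>A. (cmod (a k))\<^sup>2)"
    by (simp only: of_real_sum complex_norm_square)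
  finally show ?thesis using of_real_eq_iff by blast
qed

lemma psum_diff:
  "finite A \<Longrightarrow> B \<subseteq> A \<Longrightarrow> (\<lambda>i. psum a A i - psum a B i) = psum a (A - B)"
  by (auto simp: psum_def sum_diff)

text \<open>Differences of partial sums along the exhaustion are sums over differences of finite
  sets, so square summability makes them Cauchy. Each coefficient is eventually constant along the
  sequence and passes to the limit by continuity of \<open>ip\<close>.\<close>

lemma riesz_fischer_lim:
  assumes "(\<lambda>k. (cmod (a k))\<^sup>2) summable_on UNIV"
  obtains f where "f \<in> vecs H" "\<And>k. ip H f (e k) = a k"
    "(\<lambda>n. nrm H (\<lambda>i. psum a (exhaustion n) i - f i)) \<longlonglongrightarrow> 0"
proof -
  let ?X = "\<lambda>n. psum a (exhaustion n)"
  have X: "?X n \<in> vecs H" for n by (intro psum_vec finite_exhaustion)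
  have "cauchy_in H ?X"
    unfolding cauchy_in_def
  proof (intro conjI allI impI X)
    fix r :: real assume r: "r > 0"
    then obtain N where N: "\<And>m n. m \<ge> N \<Longrightarrow> n \<ge> N \<Longrightarrow> n \<le> m \<Longrightarrow>
        (\<Sum>k\<in>exhaustion m - exhaustion n. (cmod (a k))\<^sup>2) < r\<^sup>2"
      using summable_exhaustion_cauchy[OF assms, of "r\<^sup>2"] by (meson zero_less_power)
    have *: "nrm H (\<lambda>i. ?X m i - ?X n i) < r" if "m \<ge> N" "n \<ge> N" "n \<le> m" for m n
    proof -
      have "(nrm H (\<lambda>i. ?X m i - ?X n i))\<^sup>2 < r\<^sup>2"
        using N[OF that] that
        by (simp add: psum_diff finite_exhaustion exhaustion_mono nrm_psum)
      then show ?thesis using r by (rule_tac power2_less_imp_less) auto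
    qed
    show "\<exists>N. \<forall>m\<ge>N. \<forall>n\<ge>N. nrm H (\<lambda>i. ?X m i - ?X n i) < r"
    proof (intro exI[of _ N] allI impI)
      fix m n assume "m \<ge> N" "n \<ge> N"
      then show "nrm H (\<lambda>i. ?X m i - ?X n i) < r"
        using *[of m n] *[of n m] nrm_commute[OF X X, of m n] by (cases "n \<le> m") auto
    qed
  qed
  then obtain f where f: "f \<in> vecs H" "(\<lambda>n. nrm H (\<lambda>i. ?X n i - f i)) \<longlonglongrightarrow> 0"
    using complete by blast
  have "ip H f (e k) = a k" for k
  proof -
    have "(\<lambda>n. ip H (?X n) (e k)) \<longlonglongrightarrow> ip H f (e k)"
      by (intro ip_tendsto_left X f e_vec)
    moreover have "(\<lambda>n. ip H (?X n) (e k)) \<longlonglongrightarrow> a k"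
    proof (rule tendsto_eventually)
      show "\<forall>\<^sub>F n in sequentially. ip H (?X n) (e k) = a k"
        using eventually_exhaustion[of k] by eventually_elim (simp add: ip_psum_e finite_exhaustion)
    qed
    ultimately show ?thesis using LIMSEQ_unique by blast
  qed
  then show ?thesis using f that by blast
qed

lemma riesz_fischer:
  assumes "(\<lambda>k. (cmod (a k))\<^sup>2) summable_on UNIV"
  shows "\<exists>f\<in>vecs H. \<forall>k. ip H f (e k) = a k"
  by (rule riesz_fischer_lim[OF assms]) blast

text \<open>For the partial expansion p, the sum s of squares equals both <p, f> and the squared
  norm of p. Cauchy-Schwarz gives s \<le> sqrt s * nrm f, and sqrt s can be divided out unless it is
  0.\<close>

lemma bessel:
  assumes f: "f \<in> vecs H" and A: "finite A"
  shows "(\<Sum>k\<in>A. (cmod (ip H f (e k)))\<^sup>2) \<le> (nrm H f)\<^sup>2"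
proof -
  let ?s = "\<Sum>k\<in>A. (cmod (ip H f (e k)))\<^sup>2"
  let ?p = "psum (\<lambda>k. ip H f (e k)) A"
  have "complex_of_real ?s = ip H ?p f"
    by (simp only: of_real_sum complex_norm_square ip_psum[OF A f])
  then have "?s \<le> cmod (ip H ?p f)"
    using abs_ge_self[of ?s] norm_of_real[of ?s, where 'a = complex] by (simp only:)
  also have "\<dots> \<le> nrm H ?p * nrm H f"
    by (intro cauchy_schwarz psum_vec A f)
  also have "nrm H ?p = sqrt ?s"
    by (rule real_sqrt_unique[symmetric]) (intro nrm_psum nrm_nonneg psum_vec A)+
  finally have le: "?s \<le> sqrt ?s * nrm H f" .
  have s0: "?s \<ge> 0" by (intro sum_nonneg) auto
  have "sqrt ?s \<le> nrm H f"
  proof (cases "?s = 0")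
    case True
    then show ?thesis using nrm_nonneg[OF f] by simp
  next
    case False
    then have "sqrt ?s > 0" using s0 by (simp only: real_sqrt_gt_0_iff)
    have "sqrt ?s * sqrt ?s \<le> sqrt ?s * nrm H f" using le s0 by simp
    then show ?thesis using \<open>sqrt ?s > 0\<close> by (rule mult_left_le_imp_le)
  qed
  then have "(sqrt ?s)\<^sup>2 \<le> (nrm H f)\<^sup>2" using s0 by (intro power_mono) auto
  then show ?thesis using s0 by simp
qed

lemma coef_summable:
  assumes "f \<in> vecs H"
  shows "(\<lambda>k. (cmod (ip H f (e k)))\<^sup>2) summable_on UNIV"
proof (rule nonneg_bdd_above_summable_on)
  show "bdd_above (sum (\<lambda>k. (cmod (ip H f (e k)))\<^sup>2) ` {F. F \<subseteq> UNIV \<and> finite F})"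
    by (rule bdd_aboveI2[where M = "(nrm H f)\<^sup>2"]) (use bessel[OF assms] in simp)
qed simp

text \<open>Riesz-Fischer yields a limit g with the same coefficients as f; the difference is
  orthogonal to the whole basis, hence null by totality.\<close>

lemma psum_tendsto:
  assumes f: "f \<in> vecs H"
  shows "(\<lambda>n. nrm H (\<lambda>i. psum (\<lambda>k. ip H f (e k)) (exhaustion n) i - f i)) \<longlonglongrightarrow> 0"
proof -
  obtain g where g: "g \<in> vecs H" "\<And>k. ip H g (e k) = ip H f (e k)"
    "(\<lambda>n. nrm H (\<lambda>i. psum (\<lambda>k. ip H f (e k)) (exhaustion n) i - g i)) \<longlonglongrightarrow> 0"
    by (rule riesz_fischer_lim[OF coef_summable[OF f]]) (rule that)
  have gf: "nrm H (\<lambda>i. g i - f i) = 0"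
    by (rule e_total[OF diff_vec[OF g(1) f]]) (simp add: ip_diff_left g f e_vec)
  then have fg: "veq H f g"
    using nrm_commute[OF f g(1)] by (simp add: veq_def)
  have "nrm H (\<lambda>i. psum (\<lambda>k. ip H f (e k)) (exhaustion n) i - f i) =
      nrm H (\<lambda>i. psum (\<lambda>k. ip H f (e k)) (exhaustion n) i - g i)" for n
    by (intro veq_nrm veq_diff diff_vec psum_vec finite_exhaustion f g veq_refl fg)
  then show ?thesis using g(3) by simp
qed

lemma parseval:
  assumes f: "f \<in> vecs H" and g: "g \<in> vecs H"
  shows "((\<lambda>k. ip H f (e k) * cnj (ip H g (e k))) has_sum ip H f g) UNIV"
proof -
  let ?t = "\<lambda>k. ip H f (e k) * cnj (ip H g (e k))"
  \<comment> \<open>Absolute summability comes first, so that the unordered sum has a value at all;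
    the value is then identified along the exhaustion.\<close>
  have "(\<lambda>k. norm (?t k)) summable_on UNIV"
  proof (rule summable_on_comparison_test)
    show "(\<lambda>k. (cmod (ip H f (e k)))\<^sup>2 + (cmod (ip H g (e k)))\<^sup>2) summable_on UNIV"
      by (intro summable_on_add coef_summable f g)
    show "norm (?t k) \<le> (cmod (ip H f (e k)))\<^sup>2 + (cmod (ip H g (e k)))\<^sup>2" for k
      using sum_squares_bound[of "cmod (ip H f (e k))" "cmod (ip H g (e k))"]
        mult_nonneg_nonneg[OF norm_ge_zero[of "ip H f (e k)"] norm_ge_zero[of "ip H g (e k)"]]
      unfolding norm_mult complex_mod_cnj by linarith
  qed auto
  then have "?t summable_on UNIV" by (rule abs_summable_summable)
  then obtain s where s: "(?t has_sum s) UNIV" by (auto simp: summable_on_def)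
  have "(\<lambda>n. ip H (psum (\<lambda>k. ip H f (e k)) (exhaustion n)) g) \<longlonglongrightarrow> ip H f g"
    by (intro ip_tendsto_left psum_tendsto psum_vec finite_exhaustion f g)
  then have "(\<lambda>n. sum ?t (exhaustion n)) \<longlonglongrightarrow> ip H f g"
    by (simp add: ip_psum finite_exhaustion g)
  then have "s = ip H f g" using has_sum_exhaustion[OF s] LIMSEQ_unique by blast
  then show ?thesis using s by simp
qed

lemma parseval_nrm:
  assumes f: "f \<in> vecs H"
  shows "((\<lambda>k. (cmod (ip H f (e k)))\<^sup>2) has_sum (nrm H f)\<^sup>2) UNIV"
proof -
  have "((\<lambda>k. Re (ip H f (e k) * cnj (ip H f (e k)))) has_sum Re (ip H f f)) UNIV"
    by (intro has_sum_Re parseval f)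
  then show ?thesis by (simp add: ip_self[OF f] complex_norm_square[symmetric] del: of_real_power)
qed

end

section \<open>Slices of a Hilbert tensor product\<close>

lemma has_sum_sum:
  fixes f :: "'a \<Rightarrow> 'b \<Rightarrow> 'c :: topological_comm_monoid_add"
  assumes "finite A" "\<And>i. i \<in> A \<Longrightarrow> (f i has_sum s i) B"
  shows "((\<lambda>x. \<Sum>i\<in>A. f i x) has_sum (\<Sum>i\<in>A. s i)) B"
  using assms by (induction A rule: finite_induct) (simp_all add: has_sum_add)

lemma tendsto_0_le:
  fixes a b :: "nat \<Rightarrow> real"
  assumes "\<And>n. 0 \<le> a n" "\<And>n. a n \<le> b n" "b \<longlonglongrightarrow> 0"
  shows "a \<longlonglongrightarrow> 0"
  by (rule tendsto_sandwich[OF _ _ tendsto_const assms(3)]) (simp_all add: assms)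

text \<open>Minkowski's inequality for unordered sums, obtained from the finite version for
  \<open>L2_set\<close>. It gives the triangle inequality for the tensor norm, which is a square sum
  over slices.\<close>

lemma l2_triangle:
  fixes a b c :: "'k \<Rightarrow> real"
  assumes a: "((\<lambda>k. (a k)\<^sup>2) has_sum A\<^sup>2) UNIV" and b: "((\<lambda>k. (b k)\<^sup>2) has_sum B\<^sup>2) UNIV"
    and c: "((\<lambda>k. (c k)\<^sup>2) has_sum C\<^sup>2) UNIV"
    and le: "\<And>k. 0 \<le> c k" "\<And>k. c k \<le> a k + b k" and nn: "0 \<le> A" "0 \<le> B"
  shows "C \<le> A + B"
proof -
  have bd: "L2_set a F \<le> A" if "((\<lambda>k. (a k)\<^sup>2) has_sum A\<^sup>2) UNIV" "finite F" "0 \<le> A" for a :: "'k \<Rightarrow> real" and A F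
    unfolding L2_set_def
    by (rule real_le_lsqrt) (use finite_sum_le_has_sum[OF that(1,2)] that(3) in \<open>auto intro: sum_nonneg\<close>)
  have "C\<^sup>2 \<le> (A + B)\<^sup>2"
  proof (rule has_sum_le_finite_sums[OF c])
    fix F :: "'k set" assume F: "finite F"
    have "L2_set c F \<le> L2_set (\<lambda>k. a k + b k) F" by (intro L2_set_mono le)
    also have "\<dots> \<le> L2_set a F + L2_set b F" by (rule L2_set_triangle_ineq)
    also have "\<dots> \<le> A + B" by (intro add_mono bd a b F nn)
    finally have "(L2_set c F)\<^sup>2 \<le> (A + B)\<^sup>2" by (intro power_mono) (auto simp: L2_set_nonneg)
    then show "(\<Sum>k\<in>F. (c k)\<^sup>2) \<le> (A + B)\<^sup>2"
      by (simp add: L2_set_def sum_nonneg)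
  qed
  then show ?thesis by (rule power2_le_imp_le) (use nn in auto)
qed

section \<open>Limits of sequences and the completion of a seminormed space\<close>

context seminormed_space
begin

lemma limit_unique:
  assumes "\<And>n. X n \<in> vecs H" "f \<in> vecs H" "g \<in> vecs H"
    "(\<lambda>n. nrm H (\<lambda>i. X n i - f i)) \<longlonglongrightarrow> 0" "(\<lambda>n. nrm H (\<lambda>i. X n i - g i)) \<longlonglongrightarrow> 0"
  shows "veq H f g"
proof -
  have "(\<lambda>n. nrm H (\<lambda>i. X n i - f i) + nrm H (\<lambda>i. X n i - g i)) \<longlonglongrightarrow> 0 + 0"
    by (intro tendsto_add assms)
  moreover have "nrm H (\<lambda>i. f i - g i) \<le> nrm H (\<lambda>i. X n i - f i) + nrm H (\<lambda>i. X n i - g i)" for n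
    using nrm_diff_triangle[OF assms(2,1,3), of n] nrm_commute[OF assms(2,1), of n] by simp
  ultimately have "nrm H (\<lambda>i. f i - g i) \<le> 0 + 0"
    by (intro LIMSEQ_le_const[of _ "0 + 0"]) auto
  then show ?thesis using nrm_nonneg[OF diff_vec[OF assms(2,3)]] by (simp add: veq_def)
qed

lemma nrm_tendsto:
  assumes "\<And>n. X n \<in> vecs H" "f \<in> vecs H" "(\<lambda>n. nrm H (\<lambda>i. X n i - f i)) \<longlonglongrightarrow> 0"
  shows "(\<lambda>n. nrm H (X n)) \<longlonglongrightarrow> nrm H f"
proof (rule Lim_null[THEN iffD2], rule Lim_null_comparison[OF _ assms(3)])
  show "\<forall>\<^sub>F n in sequentially. norm (nrm H (X n) - nrm H f) \<le> nrm H (\<lambda>i. X n i - f i)"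
    using abs_nrm_diff assms by auto
qed

lemma cauchy_inD:
  assumes "cauchy_in H X"
  shows "X n \<in> vecs H" and "e > 0 \<Longrightarrow> \<exists>N. \<forall>m\<ge>N. \<forall>n\<ge>N. nrm H (\<lambda>i. X m i - X n i) < e"
  using assms by (auto simp: cauchy_in_def)

lemma cauchy_in_add:
  assumes "cauchy_in H X" "cauchy_in H Y"
  shows "cauchy_in H (\<lambda>n i. X n i + Y n i)"
  unfolding cauchy_in_def
proof (intro conjI allI impI)
  note X = cauchy_inD[OF assms(1)] and Y = cauchy_inD[OF assms(2)]
  show "(\<lambda>i. X n i + Y n i) \<in> vecs H" for n by (intro add_vec X Y)
  fix e :: real assume "e > 0"
  then obtain M N where M: "\<And>m n. m \<ge> M \<Longrightarrow> n \<ge> M \<Longrightarrow> nrm H (\<lambda>i. X m i - X n i) < e / 2"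
    and N: "\<And>m n. m \<ge> N \<Longrightarrow> n \<ge> N \<Longrightarrow> nrm H (\<lambda>i. Y m i - Y n i) < e / 2"
    using X(2)[of "e / 2"] Y(2)[of "e / 2"] by (metis half_gt_zero)
  show "\<exists>N. \<forall>m\<ge>N. \<forall>n\<ge>N. nrm H (\<lambda>i. (X m i + Y m i) - (X n i + Y n i)) < e"
  proof (intro exI[of _ "max M N"] allI impI)
    fix m n assume mn: "max M N \<le> m" "max M N \<le> n"
    have "nrm H (\<lambda>i. (X m i - X n i) + (Y m i - Y n i)) \<le>
        nrm H (\<lambda>i. X m i - X n i) + nrm H (\<lambda>i. Y m i - Y n i)"
      by (intro nrm_triangle diff_vec X Y)
    then show "nrm H (\<lambda>i. (X m i + Y m i) - (X n i + Y n i)) < e"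
      using M[of m n] N[of m n] mn by (simp add: algebra_simps)
  qed
qed

lemma cauchy_in_contraction:
  assumes X: "cauchy_in H X" and Y: "\<And>n. Y n \<in> vecs K"
    and le: "\<And>m n. nrm K (\<lambda>i. Y m i - Y n i) \<le> C * nrm H (\<lambda>i. X m i - X n i)"
  shows "cauchy_in K Y"
  unfolding cauchy_in_def
proof (intro conjI allI impI Y)
  fix e :: real assume e: "e > 0"
  have pos: "\<bar>C\<bar> + 1 > 0" by simp
  then obtain N where N: "\<And>m n. m \<ge> N \<Longrightarrow> n \<ge> N \<Longrightarrow> nrm H (\<lambda>i. X m i - X n i) < e / (\<bar>C\<bar> + 1)"
    using cauchy_inD(2)[OF X, of "e / (\<bar>C\<bar> + 1)"] e by (meson divide_pos_pos)
  show "\<exists>N. \<forall>m\<ge>N. \<forall>n\<ge>N. nrm K (\<lambda>i. Y m i - Y n i) < e"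
  proof (intro exI[of _ N] allI impI)
    fix m n assume mn: "m \<ge> N" "n \<ge> N"
    have nn: "0 \<le> nrm H (\<lambda>i. X m i - X n i)"
      by (intro nrm_nonneg diff_vec cauchy_inD[OF X])
    have "C * nrm H (\<lambda>i. X m i - X n i) \<le> (\<bar>C\<bar> + 1) * nrm H (\<lambda>i. X m i - X n i)"
      using nn by (intro mult_right_mono) auto
    also have "\<dots> < (\<bar>C\<bar> + 1) * (e / (\<bar>C\<bar> + 1))"
      using N[OF mn] pos by (intro mult_strict_left_mono) auto
    finally show "nrm K (\<lambda>i. Y m i - Y n i) < e" using le[of m n] pos by simp
  qed
qed

lemma cauchy_in_scale:
  assumes "cauchy_in H X"
  shows "cauchy_in H (\<lambda>n i. a * X n i)"
proof (rule cauchy_in_contraction[OF assms])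
  fix m n
  have "nrm H (\<lambda>i. a * (X m i - X n i)) = cmod a * nrm H (\<lambda>i. X m i - X n i)"
    by (intro nrm_scale diff_vec cauchy_inD[OF assms])
  then show "nrm H (\<lambda>i. a * X m i - a * X n i) \<le> cmod a * nrm H (\<lambda>i. X m i - X n i)"
    by (simp add: right_diff_distrib)
qed (intro scale_vec cauchy_inD[OF assms])

lemma cauchy_in_nrm_convergent:
  assumes "cauchy_in H X"
  shows "convergent (\<lambda>n. nrm H (X n))"
proof (rule Cauchy_convergent, rule CauchyI)
  fix e :: real assume "e > 0"
  then obtain N where N: "\<And>m n. m \<ge> N \<Longrightarrow> n \<ge> N \<Longrightarrow> nrm H (\<lambda>i. X m i - X n i) < e"
    using cauchy_inD(2)[OF assms] by blast
  show "\<exists>N. \<forall>m\<ge>N. \<forall>n\<ge>N. norm (nrm H (X m) - nrm H (X n)) < e"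
    using le_less_trans[OF abs_nrm_diff[OF cauchy_inD(1)[OF assms] cauchy_inD(1)[OF assms]] N]
    by (intro exI[of _ N]) simp
qed

text \<open>\<open>ip\<close> of the completion is a \<open>lim\<close>, whose value is meaningful
  only for a convergent sequence. On the diagonal it is, by the hypothesis, a limit of squared
  norms, and the norms along a Cauchy sequence converge.\<close>

lemma nrm_completion_tendsto:
  assumes self: "\<And>f. f \<in> vecs H \<Longrightarrow> ip H f f = complex_of_real ((nrm H f)\<^sup>2)"
    and X: "X \<in> vecs (completion H)"
  shows "(\<lambda>n. nrm H (\<lambda>i. X (n, i))) \<longlonglongrightarrow> nrm (completion H) X"
proof -
  have cX: "cauchy_in H (\<lambda>n i. X (n, i))" using X by (simp add: completion_def)
  obtain L where L: "(\<lambda>n. nrm H (\<lambda>i. X (n, i))) \<longlonglongrightarrow> L"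
    using cauchy_in_nrm_convergent[OF cX] by (auto simp: convergent_def)
  have "0 \<le> L"
    by (rule LIMSEQ_le_const[OF L]) (use nrm_nonneg cauchy_inD[OF cX] in auto)
  have "(\<lambda>n. ip H (\<lambda>i. X (n, i)) (\<lambda>i. X (n, i))) \<longlonglongrightarrow> complex_of_real (L\<^sup>2)"
    unfolding self[OF cauchy_inD(1)[OF cX]] by (intro tendsto_intros L)
  then have "ip (completion H) X X = complex_of_real (L\<^sup>2)"
    by (simp add: completion_def limI)
  then have "nrm (completion H) X = L" using \<open>0 \<le> L\<close> by (simp add: nrm_def)
  then show ?thesis using L by simp
qed

lemma completion_seminormed_space:
  assumes self: "\<And>f. f \<in> vecs H \<Longrightarrow> ip H f f = complex_of_real ((nrm H f)\<^sup>2)"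
  shows "seminormed_space (completion H)"
proof
  note lim = nrm_completion_tendsto[OF self]
  have vecs: "X \<in> vecs (completion H) \<longleftrightarrow> cauchy_in H (\<lambda>n i. X (n, i))" for X
    by (simp add: completion_def)
  show "(\<lambda>_. 0) \<in> vecs (completion H)"
    unfolding vecs by (auto simp: cauchy_in_def zero_vec nrm_zero)
  fix X Y and a :: complex
  assume X: "X \<in> vecs (completion H)"
  show aX: "(\<lambda>i. a * X i) \<in> vecs (completion H)"
    using cauchy_in_scale X unfolding vecs by simp
  have "(\<lambda>n. nrm H (\<lambda>i. a * X (n, i))) \<longlonglongrightarrow> nrm (completion H) (\<lambda>i. a * X i)"
    using lim[OF _ aX] by simp
  moreover have "(\<lambda>n. nrm H (\<lambda>i. a * X (n, i))) \<longlonglongrightarrow> cmod a * nrm (completion H) X"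
    using X lim[OF _ X] unfolding vecs
    by (subst nrm_scale) (auto intro!: tendsto_intros dest: cauchy_inD)
  ultimately show "nrm (completion H) (\<lambda>i. a * X i) = cmod a * nrm (completion H) X"
    by (rule LIMSEQ_unique)
  assume Y: "Y \<in> vecs (completion H)"
  show XY: "(\<lambda>i. X i + Y i) \<in> vecs (completion H)"
    using cauchy_in_add X Y unfolding vecs by simp
  show "nrm (completion H) (\<lambda>i. X i + Y i) \<le> nrm (completion H) X + nrm (completion H) Y"
  proof (rule LIMSEQ_le[OF lim[OF _ XY] tendsto_add[OF lim[OF _ X] lim[OF _ Y]]])
    show "\<exists>N. \<forall>n\<ge>N. nrm H (\<lambda>i. X (n, i) + Y (n, i)) \<le> nrm H (\<lambda>i. X (n, i)) + nrm H (\<lambda>i. Y (n, i))"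
      using X Y unfolding vecs by (auto intro!: nrm_triangle dest: cauchy_inD)
  qed auto
qed

end

section \<open>Components of a tensor along an orthonormal basis of the second factor\<close>

locale tensor_slices = H: hilbert_space H + K: orthonormal_basis K e
  for H :: "'x ipspace" and K :: "'y ipspace" and e :: "'k::countable \<Rightarrow> 'y \<Rightarrow> complex"
begin

abbreviation "V \<equiv> alg_tensor H K"

definition coef :: "'k \<Rightarrow> ('y \<Rightarrow> complex) \<Rightarrow> complex" where
  "coef k \<phi> = ip K \<phi> (e k)"

text \<open>The contraction of the formal sum d with \<open>e k\<close> in the second factor: a term
  f \<otimes> g contributes <g, e k> f.\<close>

definition slice :: "'k \<Rightarrow> (('x \<Rightarrow> complex) \<times> ('y \<Rightarrow> complex) \<Rightarrow> complex) \<Rightarrow> 'x \<Rightarrow> complex" where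
  "slice k d = (\<lambda>i. \<Sum>p | d p \<noteq> 0. (d p * coef k (snd p)) * fst p i)"

lemma V_vecs: "d \<in> vecs V \<longleftrightarrow> finite {p. d p \<noteq> 0} \<and> {p. d p \<noteq> 0} \<subseteq> vecs H \<times> vecs K"
  by (simp add: alg_tensor_def)

text \<open>Two formal sums have different supports, and terms may cancel when they are added.
  Summing over a common finite superset makes linearity of slices a termwise computation.\<close>

lemma slice_superset:
  "finite B \<Longrightarrow> {p. d p \<noteq> 0} \<subseteq> B \<Longrightarrow> slice k d = (\<lambda>i. \<Sum>p\<in>B. (d p * coef k (snd p)) * fst p i)"
  unfolding slice_def by (rule ext, rule sum.mono_neutral_left) auto

lemma slice_vec: "d \<in> vecs V \<Longrightarrow> slice k d \<in> vecs H"
  unfolding slice_def by (rule H.sum_vec) (auto simp: V_vecs)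

lemma V_add: "d \<in> vecs V \<Longrightarrow> d' \<in> vecs V \<Longrightarrow> (\<lambda>p. d p + d' p) \<in> vecs V"
proof -
  assume d: "d \<in> vecs V" "d' \<in> vecs V"
  have "{p. d p + d' p \<noteq> 0} \<subseteq> {p. d p \<noteq> 0} \<union> {p. d' p \<noteq> 0}" by auto
  moreover have "finite ({p. d p \<noteq> 0} \<union> {p. d' p \<noteq> 0})" using d by (simp add: V_vecs)
  ultimately show ?thesis using d unfolding V_vecs by (meson finite_subset le_sup_iff order_trans)
qed

lemma V_scale: "d \<in> vecs V \<Longrightarrow> (\<lambda>p. a * d p) \<in> vecs V"
  unfolding V_vecs by (auto elim!: rev_finite_subset)

lemma slice_add:
  assumes "d \<in> vecs V" "d' \<in> vecs V"
  shows "slice k (\<lambda>p. d p + d' p) = (\<lambda>i. slice k d i + slice k d' i)"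
proof -
  define B where "B = {p. d p \<noteq> 0} \<union> {p. d' p \<noteq> 0}"
  have B: "finite B" using assms by (simp add: V_vecs B_def)
  have 1: "slice k d = (\<lambda>i. \<Sum>p\<in>B. (d p * coef k (snd p)) * fst p i)"
    by (rule slice_superset[OF B]) (auto simp: B_def)
  have 2: "slice k d' = (\<lambda>i. \<Sum>p\<in>B. (d' p * coef k (snd p)) * fst p i)"
    by (rule slice_superset[OF B]) (auto simp: B_def)
  have 3: "slice k (\<lambda>p. d p + d' p) = (\<lambda>i. \<Sum>p\<in>B. ((d p + d' p) * coef k (snd p)) * fst p i)"
    by (rule slice_superset[OF B]) (auto simp: B_def)
  show ?thesis
    unfolding 1 2 3 by (simp add: algebra_simps sum.distrib)
qed

lemma slice_scale:
  assumes "d \<in> vecs V"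
  shows "slice k (\<lambda>p. a * d p) = (\<lambda>i. a * slice k d i)"
proof -
  have B: "finite {p. d p \<noteq> 0}" using assms by (simp add: V_vecs)
  have "slice k (\<lambda>p. a * d p) = (\<lambda>i. \<Sum>p | d p \<noteq> 0. ((a * d p) * coef k (snd p)) * fst p i)"
    by (rule slice_superset[OF B]) auto
  then show ?thesis
    by (simp add: slice_def sum_distrib_left mult.assoc)
qed

lemma slice_diff:
  assumes "d \<in> vecs V" "d' \<in> vecs V"
  shows "slice k (\<lambda>p. d p - d' p) = (\<lambda>i. slice k d i - slice k d' i)"
  using slice_add[OF assms(1) V_scale[OF assms(2), of "-1"], of k] slice_scale[OF assms(2), of k "-1"]
  by simp

text \<open>Parseval in K, applied to each pair of terms, pulls the sum over k out of the finite
  double sum. In this form the product form is visibly real and nonnegative on the diagonal, which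
  the double sum does not show.\<close>

lemma ip_V_has_sum:
  assumes d: "d \<in> vecs V"
  shows "((\<lambda>k. complex_of_real ((nrm H (slice k d))\<^sup>2)) has_sum ip V d d) UNIV"
proof -
  define B where "B = {p. d p \<noteq> 0}"
  have B: "finite B" "B \<subseteq> vecs H \<times> vecs K" using d by (auto simp: V_vecs B_def)
  have "((\<lambda>k. \<Sum>p\<in>B. \<Sum>q\<in>B. d p * cnj (d q) * (ip H (fst p) (fst q) * (coef k (snd p) * cnj (coef k (snd q)))))
      has_sum (\<Sum>p\<in>B. \<Sum>q\<in>B. d p * cnj (d q) * (ip H (fst p) (fst q) * ip K (snd p) (snd q)))) UNIV"
    unfolding coef_def using B
    by (intro has_sum_sum has_sum_cmult_right K.parseval) auto
  moreover have "complex_of_real ((nrm H (slice k d))\<^sup>2) =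
      (\<Sum>p\<in>B. \<Sum>q\<in>B. d p * cnj (d q) * (ip H (fst p) (fst q) * (coef k (snd p) * cnj (coef k (snd q)))))" for k
  proof -
    have f: "fst p \<in> vecs H" if "p \<in> B" for p using B that by auto
    have s: "slice k d = (\<lambda>i. \<Sum>p\<in>B. (d p * coef k (snd p)) * fst p i)"
      by (simp add: slice_def B_def)
    have "ip H (slice k d) (slice k d) = (\<Sum>p\<in>B. (d p * coef k (snd p)) * ip H (fst p) (slice k d))"
      by (subst s, rule H.ip_sum_left) (use B f slice_vec[OF d] in auto)
    also have "\<dots> = (\<Sum>p\<in>B. (d p * coef k (snd p)) * (\<Sum>q\<in>B. cnj (d q * coef k (snd q)) * ip H (fst p) (fst q)))"
      unfolding s by (intro sum.cong refl arg_cong2[where f = "(*)"] H.ip_sum_right) (use B f in auto)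
    finally show ?thesis
      by (simp add: H.ip_self[OF slice_vec[OF d], symmetric] sum_distrib_left algebra_simps del: of_real_power)
  qed
  ultimately show ?thesis by (simp add: alg_tensor_def B_def)
qed

lemma
  assumes d: "d \<in> vecs V"
  shows nrm_V: "((\<lambda>k. (nrm H (slice k d))\<^sup>2) has_sum (nrm V d)\<^sup>2) UNIV"
    and ip_V_self: "ip V d d = complex_of_real ((nrm V d)\<^sup>2)"
    and nrm_V_nonneg: "0 \<le> nrm V d"
proof -
  have re: "((\<lambda>k. (nrm H (slice k d))\<^sup>2) has_sum Re (ip V d d)) UNIV"
    using has_sum_Re[OF ip_V_has_sum[OF d]] by simp
  have "((\<lambda>k::'k. 0 :: real) has_sum Im (ip V d d)) UNIV"
    using has_sum_Im[OF ip_V_has_sum[OF d]] by (simp del: of_real_power)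
  then have im: "Im (ip V d d) = 0" using has_sum_0_simp by (rule has_sum_unique)
  have nn: "Re (ip V d d) \<ge> 0" by (rule has_sum_nonneg[OF re]) auto
  then have nrm: "(nrm V d)\<^sup>2 = Re (ip V d d)" by (simp add: nrm_def)
  show "0 \<le> nrm V d" using nn by (simp add: nrm_def)
  show "((\<lambda>k. (nrm H (slice k d))\<^sup>2) has_sum (nrm V d)\<^sup>2) UNIV" using re nrm by simp
  show "ip V d d = complex_of_real ((nrm V d)\<^sup>2)" using nrm im by (simp add: complex_eq_iff)
qed

lemma nrm_slice_le: "d \<in> vecs V \<Longrightarrow> nrm H (slice k d) \<le> nrm V d"
  by (rule power2_le_imp_le)
     (use finite_sum_le_has_sum[OF nrm_V, of d "{k}"] nrm_V_nonneg in auto)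

sublocale V: seminormed_space V
proof
  show "(\<lambda>_. 0) \<in> vecs V" by (simp add: V_vecs)
  fix d d' and a :: complex
  assume d: "d \<in> vecs V"
  show "(\<lambda>p. a * d p) \<in> vecs V" by (rule V_scale[OF d])
  have "((\<lambda>k. (nrm H (slice k (\<lambda>p. a * d p)))\<^sup>2) has_sum (cmod a)\<^sup>2 * (nrm V d)\<^sup>2) UNIV"
    using has_sum_cmult_right[OF nrm_V[OF d], of "(cmod a)\<^sup>2"]
    by (simp add: slice_scale[OF d] H.nrm_scale[OF slice_vec[OF d]] power_mult_distrib)
  then have "(nrm V (\<lambda>p. a * d p))\<^sup>2 = (cmod a * nrm V d)\<^sup>2"
    using nrm_V[OF V_scale[OF d, of a]] has_sum_unique by (metis power_mult_distrib)
  then show "nrm V (\<lambda>p. a * d p) = cmod a * nrm V d"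
    using nrm_V_nonneg[OF d] nrm_V_nonneg[OF V_scale[OF d, of a]]
    by (subst (asm) power2_eq_iff_nonneg) auto
  assume d': "d' \<in> vecs V"
  show s: "(\<lambda>p. d p + d' p) \<in> vecs V" by (rule V_add[OF d d'])
  show "nrm V (\<lambda>p. d p + d' p) \<le> nrm V d + nrm V d'"
    by (rule l2_triangle[OF nrm_V[OF d] nrm_V[OF d'] nrm_V[OF s]])
       (auto simp: slice_add[OF d d'] nrm_V_nonneg d d' slice_vec
         intro!: H.nrm_nonneg H.nrm_triangle H.add_vec)
qed

lemma tensor_seminormed_space: "seminormed_space (H \<otimes>\<^sub>H K)"
  unfolding hilbert_tensor_def by (rule V.completion_seminormed_space[OF ip_V_self])

lemma tensor_vecs: "X \<in> vecs (H \<otimes>\<^sub>H K) \<longleftrightarrow> cauchy_in V (\<lambda>n i. X (n, i))"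
  by (simp add: hilbert_tensor_def completion_def)

lemma tensor_vec_nth: "X \<in> vecs (H \<otimes>\<^sub>H K) \<Longrightarrow> (\<lambda>i. X (n, i)) \<in> vecs V"
  using V.cauchy_inD(1) unfolding tensor_vecs by blast

lemma nrm_tensor_tendsto:
  "X \<in> vecs (H \<otimes>\<^sub>H K) \<Longrightarrow> (\<lambda>n. nrm V (\<lambda>i. X (n, i))) \<longlonglongrightarrow> nrm (H \<otimes>\<^sub>H K) X"
  using V.nrm_completion_tendsto[OF ip_V_self] unfolding hilbert_tensor_def by blast

text \<open>Slicing does not increase the norm, so the slices of a Cauchy sequence converge in H.
  Their limit is determined only up to \<open>veq\<close>, hence the choice.\<close>

definition component :: "'k \<Rightarrow> (nat \<times> ('x \<Rightarrow> complex) \<times> ('y \<Rightarrow> complex) \<Rightarrow> complex) \<Rightarrow> 'x \<Rightarrow> complex" where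
  "component k X = (SOME f. f \<in> vecs H \<and> (\<lambda>n. nrm H (\<lambda>i. slice k (\<lambda>p. X (n, p)) i - f i)) \<longlonglongrightarrow> 0)"

lemma
  assumes X: "X \<in> vecs (H \<otimes>\<^sub>H K)"
  shows component_vec: "component k X \<in> vecs H"
    and component_tendsto: "(\<lambda>n. nrm H (\<lambda>i. slice k (\<lambda>p. X (n, p)) i - component k X i)) \<longlonglongrightarrow> 0"
proof -
  have "cauchy_in H (\<lambda>n. slice k (\<lambda>p. X (n, p)))"
  proof (rule V.cauchy_in_contraction)
    show "cauchy_in V (\<lambda>n i. X (n, i))" using X by (simp add: tensor_vecs)
    show "slice k (\<lambda>p. X (n, p)) \<in> vecs H" for n by (intro slice_vec tensor_vec_nth X)
    show "nrm H (\<lambda>i. slice k (\<lambda>p. X (m, p)) i - slice k (\<lambda>p. X (n, p)) i)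
      \<le> 1 * nrm V (\<lambda>i. X (m, i) - X (n, i))" for m n
      using nrm_slice_le[OF V.diff_vec[OF tensor_vec_nth[OF X] tensor_vec_nth[OF X]], of k m n]
      by (simp add: slice_diff tensor_vec_nth X)
  qed
  then have "\<exists>f. f \<in> vecs H \<and> (\<lambda>n. nrm H (\<lambda>i. slice k (\<lambda>p. X (n, p)) i - f i)) \<longlonglongrightarrow> 0"
    using H.complete by blast
  from someI_ex[OF this] show "component k X \<in> vecs H"
    "(\<lambda>n. nrm H (\<lambda>i. slice k (\<lambda>p. X (n, p)) i - component k X i)) \<longlonglongrightarrow> 0"
    by (simp_all add: component_def)
qed

lemma component_unique:
  assumes X: "X \<in> vecs (H \<otimes>\<^sub>H K)" and f: "f \<in> vecs H"
    and lim: "(\<lambda>n. nrm H (\<lambda>i. slice k (\<lambda>p. X (n, p)) i - f i)) \<longlonglongrightarrow> 0"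
  shows "veq H (component k X) f"
  by (rule H.limit_unique[OF slice_vec[OF tensor_vec_nth[OF X]] component_vec[OF X] f
        component_tendsto[OF X] lim])

lemma component_add:
  assumes X: "X \<in> vecs (H \<otimes>\<^sub>H K)" and Y: "Y \<in> vecs (H \<otimes>\<^sub>H K)"
  shows "veq H (component k (\<lambda>i. X i + Y i)) (\<lambda>i. component k X i + component k Y i)"
proof (rule component_unique)
  show "(\<lambda>i. X i + Y i) \<in> vecs (H \<otimes>\<^sub>H K)"
    using V.cauchy_in_add X Y by (auto simp: tensor_vecs)
  show "(\<lambda>i. component k X i + component k Y i) \<in> vecs H"
    by (intro H.add_vec component_vec X Y)
  have "(\<lambda>n. nrm H (\<lambda>i. slice k (\<lambda>p. X (n, p)) i - component k X i) +
      nrm H (\<lambda>i. slice k (\<lambda>p. Y (n, p)) i - component k Y i)) \<longlonglongrightarrow> 0 + 0"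
    by (intro tendsto_add component_tendsto X Y)
  moreover have "nrm H (\<lambda>i. (slice k (\<lambda>p. X (n, p)) i - component k X i) +
        (slice k (\<lambda>p. Y (n, p)) i - component k Y i)) \<le>
      nrm H (\<lambda>i. slice k (\<lambda>p. X (n, p)) i - component k X i) +
      nrm H (\<lambda>i. slice k (\<lambda>p. Y (n, p)) i - component k Y i)" for n
    by (intro H.nrm_triangle H.diff_vec slice_vec tensor_vec_nth component_vec X Y)
  moreover have "0 \<le> nrm H (\<lambda>i. (slice k (\<lambda>p. X (n, p)) i - component k X i) +
        (slice k (\<lambda>p. Y (n, p)) i - component k Y i))" for n
    by (intro H.nrm_nonneg H.add_vec H.diff_vec slice_vec tensor_vec_nth component_vec X Y)
  ultimately have "(\<lambda>n. nrm H (\<lambda>i. (slice k (\<lambda>p. X (n, p)) i - component k X i) +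
        (slice k (\<lambda>p. Y (n, p)) i - component k Y i))) \<longlonglongrightarrow> 0"
    by (rule_tac tendsto_0_le[rotated -1]) (simp only: add_0)
  then show "(\<lambda>n. nrm H (\<lambda>i. slice k (\<lambda>p. X (n, p) + Y (n, p)) i -
      (component k X i + component k Y i))) \<longlonglongrightarrow> 0"
    by (simp add: slice_add tensor_vec_nth X Y algebra_simps)
qed

lemma component_scale:
  assumes X: "X \<in> vecs (H \<otimes>\<^sub>H K)"
  shows "veq H (component k (\<lambda>i. a * X i)) (\<lambda>i. a * component k X i)"
proof (rule component_unique)
  show "(\<lambda>i. a * X i) \<in> vecs (H \<otimes>\<^sub>H K)"
    using V.cauchy_in_scale X by (auto simp: tensor_vecs)
  show "(\<lambda>i. a * component k X i) \<in> vecs H" by (intro H.scale_vec component_vec X)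
  have "nrm H (\<lambda>i. a * (slice k (\<lambda>p. X (n, p)) i - component k X i)) =
      cmod a * nrm H (\<lambda>i. slice k (\<lambda>p. X (n, p)) i - component k X i)" for n
    by (intro H.nrm_scale H.diff_vec slice_vec tensor_vec_nth component_vec X)
  moreover have "(\<lambda>n. cmod a * nrm H (\<lambda>i. slice k (\<lambda>p. X (n, p)) i - component k X i)) \<longlonglongrightarrow> 0"
    by (intro tendsto_mult_right_zero component_tendsto X)
  ultimately show "(\<lambda>n. nrm H (\<lambda>i. slice k (\<lambda>p. a * X (n, p)) i - a * component k X i)) \<longlonglongrightarrow> 0"
    by (simp add: slice_scale tensor_vec_nth X right_diff_distrib)
qed

text \<open>Components are limits for each fixed k, so the identity exchanges a limit with an
  infinite sum. One inequality passes finite partial sums to the limit. The other rests on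
  uniformity: for large n, the slices of x n are within r of the components in the l^2 sense over
  all k.\<close>

lemma component_nrm:
  assumes X: "X \<in> vecs (H \<otimes>\<^sub>H K)"
  shows "((\<lambda>k. (nrm H (component k X))\<^sup>2) has_sum (nrm (H \<otimes>\<^sub>H K) X)\<^sup>2) UNIV"
proof -
  define N where "N = nrm (H \<otimes>\<^sub>H K) X"
  define x where "x n = (\<lambda>p. X (n, p))" for n
  have xv: "x n \<in> vecs V" for n unfolding x_def by (rule tensor_vec_nth[OF X])
  have xN: "(\<lambda>n. nrm V (x n)) \<longlonglongrightarrow> N" unfolding x_def N_def by (rule nrm_tensor_tendsto[OF X])
  have N0: "0 \<le> N" by (rule LIMSEQ_le_const[OF xN]) (use nrm_V_nonneg xv in auto)
  have slim: "(\<lambda>n. nrm H (\<lambda>i. slice k (x n) i - component k X i)) \<longlonglongrightarrow> 0" for k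
    unfolding x_def by (rule component_tendsto[OF X])
  have sv: "slice k (x n) \<in> vecs H" for k n by (intro slice_vec xv)
  have cv: "component k X \<in> vecs H" for k by (rule component_vec[OF X])
  have fin: "(\<Sum>k\<in>F. (nrm H (component k X))\<^sup>2) \<le> N\<^sup>2" if F: "finite F" for F
  proof (rule LIMSEQ_le)
    show "(\<lambda>n. \<Sum>k\<in>F. (nrm H (slice k (x n)))\<^sup>2) \<longlonglongrightarrow> (\<Sum>k\<in>F. (nrm H (component k X))\<^sup>2)"
      by (intro tendsto_sum tendsto_power H.nrm_tendsto sv cv slim)
    show "(\<lambda>n. (nrm V (x n))\<^sup>2) \<longlonglongrightarrow> N\<^sup>2" by (intro tendsto_power xN)
    show "\<exists>M. \<forall>n\<ge>M. (\<Sum>k\<in>F. (nrm H (slice k (x n)))\<^sup>2) \<le> (nrm V (x n))\<^sup>2"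
      using finite_sum_le_has_sum[OF nrm_V[OF xv] F] by auto
  qed
  have "(\<lambda>k. (nrm H (component k X))\<^sup>2) summable_on UNIV"
  proof (rule nonneg_bdd_above_summable_on)
    show "bdd_above (sum (\<lambda>k. (nrm H (component k X))\<^sup>2) ` {F. F \<subseteq> UNIV \<and> finite F})"
      by (rule bdd_aboveI2[where M = "N\<^sup>2"]) (use fin in simp)
  qed simp
  then obtain S where S: "((\<lambda>k. (nrm H (component k X))\<^sup>2) has_sum S) UNIV"
    by (auto simp: summable_on_def)
  have S0: "0 \<le> S" by (rule has_sum_nonneg[OF S]) auto
  have SN: "S \<le> N\<^sup>2" by (rule has_sum_le_finite_sums[OF S]) (use fin in auto)
  have "N \<le> sqrt S"
  proof (rule field_le_epsilon)
    fix r :: real assume r: "r > 0"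
    have cx: "cauchy_in V x" using X unfolding tensor_vecs x_def .
    obtain M where M: "\<And>m n. m \<ge> M \<Longrightarrow> n \<ge> M \<Longrightarrow> nrm V (\<lambda>i. x m i - x n i) < r"
      using V.cauchy_inD(2)[OF cx r] by blast
    have "nrm V (x n) \<le> sqrt S + r" if n: "n \<ge> M" for n
    proof -
      \<comment> \<open>The Cauchy estimate on finitely many slices survives the limit in m, and the
        resulting bound r does not depend on the finite set F.\<close>
      have d: "L2_set (\<lambda>k. nrm H (\<lambda>i. slice k (x n) i - component k X i)) F \<le> r" if F: "finite F" for F
      proof -
        have "(\<Sum>k\<in>F. (nrm H (\<lambda>i. slice k (x n) i - component k X i))\<^sup>2) \<le> r\<^sup>2"
        proof (rule LIMSEQ_le_const2)
          have "(\<lambda>m. nrm H (\<lambda>i. slice k (x n) i - slice k (x m) i)) \<longlonglongrightarrow>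
              nrm H (\<lambda>i. slice k (x n) i - component k X i)" for k
          proof (rule H.nrm_tendsto)
            show "(\<lambda>m. nrm H (\<lambda>i. (slice k (x n) i - slice k (x m) i) - (slice k (x n) i - component k X i))) \<longlonglongrightarrow> 0"
              using slim[of k] H.nrm_commute[OF sv cv, of k _ k] by simp
          qed (intro H.diff_vec sv cv)+
          then show "(\<lambda>m. \<Sum>k\<in>F. (nrm H (\<lambda>i. slice k (x n) i - slice k (x m) i))\<^sup>2) \<longlonglongrightarrow>
            (\<Sum>k\<in>F. (nrm H (\<lambda>i. slice k (x n) i - component k X i))\<^sup>2)"
            by (intro tendsto_sum tendsto_power)
          show "\<exists>M. \<forall>m\<ge>M. (\<Sum>k\<in>F. (nrm H (\<lambda>i. slice k (x n) i - slice k (x m) i))\<^sup>2) \<le> r\<^sup>2"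
          proof (intro exI[of _ M] allI impI)
            fix m assume m: "M \<le> m"
            have "(\<Sum>k\<in>F. (nrm H (slice k (\<lambda>i. x n i - x m i)))\<^sup>2) \<le> (nrm V (\<lambda>i. x n i - x m i))\<^sup>2"
              using finite_sum_le_has_sum[OF nrm_V[OF V.diff_vec[OF xv xv]] F] by auto
            also have "\<dots> \<le> r\<^sup>2"
              using M[OF n m] nrm_V_nonneg[OF V.diff_vec[OF xv xv]] by (intro power_mono) auto
            finally show "(\<Sum>k\<in>F. (nrm H (\<lambda>i. slice k (x n) i - slice k (x m) i))\<^sup>2) \<le> r\<^sup>2"
              by (simp add: slice_diff xv)
          qed
        qed
        then show ?thesis unfolding L2_set_def by (rule real_le_lsqrt[rotated -1]) (use r in \<open>auto intro: sum_nonneg\<close>)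
      qed
      have "(nrm V (x n))\<^sup>2 \<le> (sqrt S + r)\<^sup>2"
      proof (rule has_sum_le_finite_sums[OF nrm_V[OF xv]])
        fix F :: "'k set" assume F: "finite F"
        have "L2_set (\<lambda>k. nrm H (slice k (x n))) F \<le>
            L2_set (\<lambda>k. nrm H (component k X) + nrm H (\<lambda>i. slice k (x n) i - component k X i)) F"
          by (intro L2_set_mono H.nrm_triangle_sub H.nrm_nonneg sv cv)
        also have "\<dots> \<le> L2_set (\<lambda>k. nrm H (component k X)) F +
            L2_set (\<lambda>k. nrm H (\<lambda>i. slice k (x n) i - component k X i)) F"
          by (rule L2_set_triangle_ineq)
        also have "\<dots> \<le> sqrt S + r"
          using finite_sum_le_has_sum[OF S F] d[OF F] unfolding L2_set_def
          by (intro add_mono real_sqrt_le_mono) auto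
        finally have "(L2_set (\<lambda>k. nrm H (slice k (x n))) F)\<^sup>2 \<le> (sqrt S + r)\<^sup>2"
          by (intro power_mono) (auto simp: L2_set_nonneg)
        then show "(\<Sum>k\<in>F. (nrm H (slice k (x n)))\<^sup>2) \<le> (sqrt S + r)\<^sup>2"
          by (simp add: L2_set_def sum_nonneg)
      qed
      then show ?thesis by (rule power2_le_imp_le) (use S0 r in auto)
    qed
    then show "N \<le> sqrt S + r"
      by (intro LIMSEQ_le_const2[OF xN]) blast
  qed
  then have "N\<^sup>2 \<le> (sqrt S)\<^sup>2" using N0 by (intro power_mono)
  then show ?thesis using SN S0 S by (simp add: N_def)
qed

lemma component_onto:
  assumes F: "\<And>k. F k \<in> vecs H" and sm: "(\<lambda>k. (nrm H (F k))\<^sup>2) summable_on UNIV"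
  shows "\<exists>X\<in>vecs (H \<otimes>\<^sub>H K). \<forall>k. veq H (component k X) (F k)"
proof -
  \<comment> \<open>The formal sum of F k \<otimes> e k over a finite exhaustion. Since e is
    injective, different k give different pairs even where the F k coincide, so coefficient 1 on
    each pair is correct.\<close>
  define x where "x n p = (if p \<in> (\<lambda>k. (F k, e k)) ` exhaustion n then 1 else 0 :: complex)" for n p
  have inj: "inj_on (\<lambda>k. (F k, e k)) A" for A
    using K.inj_e by (auto simp: inj_on_def)
  have supp: "{p. x n p \<noteq> 0} = (\<lambda>k. (F k, e k)) ` exhaustion n" for n by (auto simp: x_def)
  have xv: "x n \<in> vecs V" for n
    unfolding V_vecs supp using F K.e_vec finite_exhaustion by auto
  have sl: "slice l (x n) = (if l \<in> exhaustion n then F l else (\<lambda>_. 0))" for l n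
  proof
    fix i
    have "slice l (x n) i = (\<Sum>k\<in>exhaustion n. x n (F k, e k) * coef l (e k) * F k i)"
      unfolding slice_def supp by (subst sum.reindex[OF inj]) simp
    also have "\<dots> = (\<Sum>k\<in>exhaustion n. if k = l then F l i else 0)"
      by (intro sum.cong) (auto simp: x_def coef_def K.e_orth)
    finally show "slice l (x n) i = (if l \<in> exhaustion n then F l else (\<lambda>_. 0)) i"
      by (simp add: finite_exhaustion)
  qed
  have nd: "(nrm V (\<lambda>p. x m p - x n p))\<^sup>2 = (\<Sum>l\<in>exhaustion m - exhaustion n. (nrm H (F l))\<^sup>2)"
    if "n \<le> m" for m n
  proof -
    have "((\<lambda>l. (nrm H (slice l (\<lambda>p. x m p - x n p)))\<^sup>2) has_sum
        (\<Sum>l\<in>exhaustion m - exhaustion n. (nrm H (F l))\<^sup>2)) UNIV"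
    proof (subst has_sum_cong_neutral)
      show "((\<lambda>l. (nrm H (F l))\<^sup>2) has_sum (\<Sum>l\<in>exhaustion m - exhaustion n. (nrm H (F l))\<^sup>2))
          (exhaustion m - exhaustion n)"
        by (rule has_sum_finite) (simp add: finite_exhaustion)
    qed (use exhaustion_mono[OF that] in \<open>auto simp: slice_diff xv sl H.nrm_zero\<close>)
    then show ?thesis using nrm_V[OF V.diff_vec[OF xv xv]] has_sum_unique by blast
  qed
  define X where "X = (\<lambda>(n, p). x n p)"
  have "cauchy_in V x"
    unfolding cauchy_in_def
  proof (intro conjI allI impI xv)
    fix r :: real assume r: "r > 0"
    then have r2: "r\<^sup>2 > 0" by simp
    obtain N where N: "\<And>m n. m \<ge> N \<Longrightarrow> n \<ge> N \<Longrightarrow> n \<le> m \<Longrightarrow>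
        (\<Sum>k\<in>exhaustion m - exhaustion n. (nrm H (F k))\<^sup>2) < r\<^sup>2"
      using summable_exhaustion_cauchy[OF sm r2] by blast
    have *: "nrm V (\<lambda>i. x m i - x n i) < r" if "m \<ge> N" "n \<ge> N" "n \<le> m" for m n
    proof -
      have "(nrm V (\<lambda>i. x m i - x n i))\<^sup>2 < r\<^sup>2" using N[OF that] nd[OF that(3)] by simp
      then show ?thesis using r by (rule_tac power2_less_imp_less) auto
    qed
    show "\<exists>N. \<forall>m\<ge>N. \<forall>n\<ge>N. nrm V (\<lambda>i. x m i - x n i) < r"
    proof (intro exI[of _ N] allI impI)
      fix m n assume "m \<ge> N" "n \<ge> N"
      then show "nrm V (\<lambda>i. x m i - x n i) < r"
        using *[of m n] *[of n m] V.nrm_commute[OF xv xv, of m n] by (cases "n \<le> m") auto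
    qed
  qed
  then have Xv: "X \<in> vecs (H \<otimes>\<^sub>H K)" by (simp add: tensor_vecs X_def)
  have "veq H (component k X) (F k)" for k
  proof (rule component_unique[OF Xv F], rule tendsto_eventually)
    show "\<forall>\<^sub>F n in sequentially. nrm H (\<lambda>i. slice k (\<lambda>p. X (n, p)) i - F k i) = 0"
      using eventually_exhaustion[of k]
      by eventually_elim (simp add: X_def sl H.nrm_zero)
  qed
  then show ?thesis using Xv by blast
qed

text \<open>Coefficients are pushed forward along pairs, and different pairs may have the same
  image. Regrouping by the fibres of W restores a sum over the original support, where the factor c
  on coefficients and the linearity of U apply.\<close>

lemma slice_alg_tensor_map:
  assumes d: "d \<in> vecs V"
    and U_add: "\<And>f g. U (\<lambda>i. f i + g i) = (\<lambda>i. U f i + U g i)"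
    and U_scale: "\<And>a f. U (\<lambda>i. a * f i) = (\<lambda>i. a * U f i)"
    and U': "\<And>\<phi>. \<phi> \<in> vecs K \<Longrightarrow> coef k (U' \<phi>) = c * coef k \<phi>"
  shows "slice k (alg_tensor_map U U' d) = (\<lambda>i. c * U (slice k d) i)"
proof
  fix i
  define B where "B = {p. d p \<noteq> 0}"
  define W where "W = (\<lambda>p. (U (fst p), U' (snd p)))"
  have B: "finite B" "B \<subseteq> vecs H \<times> vecs K" using d by (auto simp: V_vecs B_def)
  have tm: "alg_tensor_map U U' d q = (\<Sum>p | p \<in> B \<and> W p = q. d p)" for q
    by (simp add: alg_tensor_map_def B_def W_def)
  have sub: "{q. alg_tensor_map U U' d q \<noteq> 0} \<subseteq> W ` B"
    unfolding tm by (force elim: sum.not_neutral_contains_not_neutral)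
  have "slice k (alg_tensor_map U U' d) i =
      (\<Sum>q\<in>W ` B. (\<Sum>p | p \<in> B \<and> W p = q. d p) * coef k (snd q) * fst q i)"
    by (subst slice_superset[OF _ sub]) (use B tm in auto)
  also have "\<dots> = (\<Sum>q\<in>W ` B. \<Sum>p | p \<in> B \<and> W p = q. d p * coef k (snd (W p)) * fst (W p) i)"
    by (intro sum.cong) (auto simp: sum_distrib_right)
  also have "\<dots> = (\<Sum>p\<in>B. d p * coef k (snd (W p)) * fst (W p) i)"
    using sum.image_gen[OF B(1), of "\<lambda>p. d p * coef k (snd (W p)) * fst (W p) i" W] by simp
  also have "\<dots> = (\<Sum>p\<in>B. c * ((d p * coef k (snd p)) * U (fst p) i))"
    using B(2) by (intro sum.cong) (auto simp: W_def U')
  also have "\<dots> = c * (\<Sum>p\<in>B. (d p * coef k (snd p)) * U (fst p) i)"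
    by (simp add: sum_distrib_left)
  also have "(\<Sum>p\<in>B. (d p * coef k (snd p)) * U (fst p) i) =
      U (\<lambda>i. \<Sum>p\<in>B. (d p * coef k (snd p)) * fst p i) i"
  proof -
    have U0: "U (\<lambda>_. 0) = (\<lambda>_. 0)" using U_scale[of 0 "\<lambda>_. 0"] by simp
    have "U (\<lambda>i. \<Sum>p\<in>B. a p * f p i) = (\<lambda>i. \<Sum>p\<in>B. a p * U (f p) i)" for a and f :: "_ \<Rightarrow> 'x \<Rightarrow> complex"
      using B(1) by (induction B rule: finite_induct) (simp_all add: U0 U_add U_scale)
    then show ?thesis by simp
  qed
  finally show "slice k (alg_tensor_map U U' d) i = c * U (slice k d) i"
    by (simp add: slice_def B_def)
qed

lemma alg_tensor_map_vec:
  assumes d: "d \<in> vecs V" and U: "\<And>f. f \<in> vecs H \<Longrightarrow> U f \<in> vecs H"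
    and U': "\<And>\<phi>. \<phi> \<in> vecs K \<Longrightarrow> U' \<phi> \<in> vecs K"
  shows "alg_tensor_map U U' d \<in> vecs V"
proof -
  define B where "B = {p. d p \<noteq> 0}"
  define W where "W = (\<lambda>p. (U (fst p), U' (snd p)))"
  have B: "finite B" "B \<subseteq> vecs H \<times> vecs K" using d by (auto simp: V_vecs B_def)
  have sub: "{q. alg_tensor_map U U' d q \<noteq> 0} \<subseteq> W ` B"
    unfolding alg_tensor_map_def B_def W_def
    by (force elim: sum.not_neutral_contains_not_neutral)
  moreover have "W ` B \<subseteq> vecs H \<times> vecs K" using B(2) U U' by (auto simp: W_def)
  ultimately show ?thesis
    unfolding V_vecs using B(1) by (meson finite_imageI finite_subset order_trans)
qed

text \<open>On each slice the tensor map is \<open>c k\<close> times a contraction, so it does not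
  increase distances of formal sums and maps Cauchy sequences to Cauchy sequences. The same
  slicewise estimate carries the eigenvalue relation to the limit defining
  \<open>component\<close>.\<close>

theorem tensor_diagonal:
  assumes U: "\<And>f. f \<in> vecs H \<Longrightarrow> U f \<in> vecs H"
    and U_add: "\<And>f g. U (\<lambda>i. f i + g i) = (\<lambda>i. U f i + U g i)"
    and U_scale: "\<And>a f. U (\<lambda>i. a * f i) = (\<lambda>i. a * U f i)"
    and U_contr: "\<And>f. f \<in> vecs H \<Longrightarrow> nrm H (U f) \<le> nrm H f"
    and U': "\<And>\<phi>. \<phi> \<in> vecs K \<Longrightarrow> U' \<phi> \<in> vecs K"
    and diag: "\<And>k \<phi>. \<phi> \<in> vecs K \<Longrightarrow> ip K (U' \<phi>) (e k) = c k * ip K \<phi> (e k)"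
    and c: "\<And>k. cmod (c k) \<le> 1" "\<And>k. c k \<noteq> 0"
  shows "diagonal_operator H (H \<otimes>\<^sub>H K) U (U \<otimes>\<^sub>o U') c component"
proof -
  interpret G: seminormed_space "H \<otimes>\<^sub>H K" by (rule tensor_seminormed_space)
  have U_diff: "U (\<lambda>i. f i - g i) = (\<lambda>i. U f i - U g i)" for f g
    using U_add[of f "\<lambda>i. - 1 * g i"] U_scale[of "-1" g] by simp
  have Tn: "(\<lambda>p. (U \<otimes>\<^sub>o U') X (n, p)) = alg_tensor_map U U' (\<lambda>p. X (n, p))" for X n
    by (simp add: tensor_map_def completion_map_def)
  have sl: "slice k (alg_tensor_map U U' d) = (\<lambda>i. c k * U (slice k d) i)" if "d \<in> vecs V" for k d
    by (rule slice_alg_tensor_map[OF that U_add U_scale]) (simp add: coef_def diag)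
  have contr: "nrm V (\<lambda>p. alg_tensor_map U U' d p - alg_tensor_map U U' d' p) \<le> 1 * nrm V (\<lambda>p. d p - d' p)"
    if d: "d \<in> vecs V" "d' \<in> vecs V" for d d'
  proof -
    have v: "alg_tensor_map U U' d \<in> vecs V" "alg_tensor_map U U' d' \<in> vecs V"
      by (rule alg_tensor_map_vec[OF d(1) U U'] alg_tensor_map_vec[OF d(2) U U'], assumption+)+
    have le: "nrm H (slice k (\<lambda>p. alg_tensor_map U U' d p - alg_tensor_map U U' d' p)) \<le>
        nrm H (slice k (\<lambda>p. d p - d' p))" for k
    proof -
      have "slice k (\<lambda>p. alg_tensor_map U U' d p - alg_tensor_map U U' d' p) =
          (\<lambda>i. c k * (U (slice k d) i - U (slice k d') i))"
        by (simp add: slice_diff v sl d right_diff_distrib)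
      also have "\<dots> = (\<lambda>i. c k * U (slice k (\<lambda>p. d p - d' p)) i)"
        by (simp only: U_diff slice_diff[OF d])
      finally have "nrm H (slice k (\<lambda>p. alg_tensor_map U U' d p - alg_tensor_map U U' d' p)) =
          cmod (c k) * nrm H (U (slice k (\<lambda>p. d p - d' p)))"
        by (simp add: H.nrm_scale U slice_vec V.diff_vec d)
      also have "\<dots> \<le> 1 * nrm H (slice k (\<lambda>p. d p - d' p))"
        by (intro mult_mono c U_contr slice_vec V.diff_vec d H.nrm_nonneg U) auto
      finally show ?thesis by simp
    qed
    have "(nrm V (\<lambda>p. alg_tensor_map U U' d p - alg_tensor_map U U' d' p))\<^sup>2 \<le> (nrm V (\<lambda>p. d p - d' p))\<^sup>2"
      by (rule has_sum_mono[OF nrm_V[OF V.diff_vec[OF v]] nrm_V[OF V.diff_vec[OF d]]])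
         (rule power_mono[OF le H.nrm_nonneg[OF slice_vec[OF V.diff_vec[OF v]]]])
    then have "nrm V (\<lambda>p. alg_tensor_map U U' d p - alg_tensor_map U U' d' p) \<le> nrm V (\<lambda>p. d p - d' p)"
      using nrm_V_nonneg[OF V.diff_vec[OF d]] by (rule power2_le_imp_le)
    then show ?thesis by simp
  qed
  have Tv: "(U \<otimes>\<^sub>o U') X \<in> vecs (H \<otimes>\<^sub>H K)" if X: "X \<in> vecs (H \<otimes>\<^sub>H K)" for X
    unfolding tensor_vecs
  proof (rule V.cauchy_in_contraction)
    show "cauchy_in V (\<lambda>n i. X (n, i))" using X by (simp add: tensor_vecs)
    show "(\<lambda>p. (U \<otimes>\<^sub>o U') X (n, p)) \<in> vecs V" for n
      unfolding Tn by (intro alg_tensor_map_vec tensor_vec_nth X U U')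
    show "nrm V (\<lambda>i. (U \<otimes>\<^sub>o U') X (m, i) - (U \<otimes>\<^sub>o U') X (n, i)) \<le> 1 * nrm V (\<lambda>i. X (m, i) - X (n, i))" for m n
      using contr[OF tensor_vec_nth[OF X] tensor_vec_nth[OF X], of m n]
      by (simp add: tensor_map_def completion_map_def)
  qed
  show ?thesis
  proof
    show "veq H (component k ((U \<otimes>\<^sub>o U') X)) (\<lambda>i. c k * U (component k X) i)"
      if X: "X \<in> vecs (H \<otimes>\<^sub>H K)" for X k
    proof (rule component_unique[OF Tv[OF X]])
      have s: "slice k (\<lambda>p. X (n, p)) \<in> vecs H" for n by (intro slice_vec tensor_vec_nth X)
      have cx: "component k X \<in> vecs H" by (rule component_vec[OF X])
      show "(\<lambda>i. c k * U (component k X) i) \<in> vecs H" by (intro H.scale_vec U cx)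
      have "nrm H (\<lambda>i. slice k (\<lambda>p. (U \<otimes>\<^sub>o U') X (n, p)) i - c k * U (component k X) i) \<le>
          nrm H (\<lambda>i. slice k (\<lambda>p. X (n, p)) i - component k X i)" for n
      proof -
        have "(\<lambda>i. slice k (\<lambda>p. (U \<otimes>\<^sub>o U') X (n, p)) i - c k * U (component k X) i) =
            (\<lambda>i. c k * (U (slice k (\<lambda>p. X (n, p))) i - U (component k X) i))"
          unfolding Tn sl[OF tensor_vec_nth[OF X]] by (simp add: right_diff_distrib)
        also have "\<dots> = (\<lambda>i. c k * U (\<lambda>i. slice k (\<lambda>p. X (n, p)) i - component k X i) i)"
          by (simp only: U_diff)
        finally have "nrm H (\<lambda>i. slice k (\<lambda>p. (U \<otimes>\<^sub>o U') X (n, p)) i - c k * U (component k X) i) =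
            cmod (c k) * nrm H (U (\<lambda>i. slice k (\<lambda>p. X (n, p)) i - component k X i))"
          by (simp add: H.nrm_scale U H.diff_vec s cx)
        also have "\<dots> \<le> 1 * nrm H (\<lambda>i. slice k (\<lambda>p. X (n, p)) i - component k X i)"
          by (intro mult_mono c U_contr H.diff_vec s cx H.nrm_nonneg U) auto
        finally show ?thesis by simp
      qed
      then show "(\<lambda>n. nrm H (\<lambda>i. slice k (\<lambda>p. (U \<otimes>\<^sub>o U') X (n, p)) i - c k * U (component k X) i)) \<longlonglongrightarrow> 0"
        by (rule tendsto_0_le[rotated, OF _ component_tendsto[OF X, of k]])
           (intro H.nrm_nonneg H.diff_vec slice_vec tensor_vec_nth Tv X H.scale_vec U cx)
    qed
  qed (fact U U_add U_scale U_contr c Tv component_vec component_add component_scale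
       component_nrm component_onto)+
qed

end

section \<open>The Hilbert space of square-integrable functions\<close>

lemma L2_vecs: "f \<in> vecs (L2_space M) \<longleftrightarrow> f \<in> borel_measurable M \<and> integrable M (\<lambda>x. (cmod (f x))\<^sup>2)"
  by (simp add: L2_space_def)

lemma L2_ip: "ip (L2_space M) f g = (LINT x|M. f x * cnj (g x))"
  by (simp add: L2_space_def)

lemma L2_measurable: "f \<in> vecs (L2_space M) \<Longrightarrow> f \<in> borel_measurable M"
  by (simp add: L2_vecs)

lemma L2_integrable_mult:
  assumes "f \<in> vecs (L2_space M)" "g \<in> vecs (L2_space M)"
  shows "integrable M (\<lambda>x. f x * cnj (g x))"
proof (rule Bochner_Integration.integrable_bound)
  show "integrable M (\<lambda>x. (cmod (f x))\<^sup>2 + (cmod (g x))\<^sup>2)"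
    using assms by (simp add: L2_vecs)
  have cg: "(\<lambda>x. cnj (g x)) \<in> borel_measurable M"
    by (rule borel_measurable_continuous_on[OF _ L2_measurable[OF assms(2)]]) (intro continuous_intros)
  show "(\<lambda>x. f x * cnj (g x)) \<in> borel_measurable M"
    by (intro borel_measurable_times cg L2_measurable assms)
  have "cmod (f x * cnj (g x)) \<le> norm ((cmod (f x))\<^sup>2 + (cmod (g x))\<^sup>2)" for x
    using sum_squares_bound[of "cmod (f x)" "cmod (g x)"]
      mult_nonneg_nonneg[OF norm_ge_zero[of "f x"] norm_ge_zero[of "g x"]]
    unfolding norm_mult complex_mod_cnj real_norm_def by linarith
  then show "AE x in M. cmod (f x * cnj (g x)) \<le> norm ((cmod (f x))\<^sup>2 + (cmod (g x))\<^sup>2)" by simp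
qed

lemma L2_add:
  assumes "f \<in> vecs (L2_space M)" "g \<in> vecs (L2_space M)"
  shows "(\<lambda>x. f x + g x) \<in> vecs (L2_space M)"
proof -
  have "integrable M (\<lambda>x. (cmod (f x + g x))\<^sup>2)"
  proof (rule Bochner_Integration.integrable_bound)
    show "integrable M (\<lambda>x. 2 * (cmod (f x))\<^sup>2 + 2 * (cmod (g x))\<^sup>2)"
      using assms by (simp add: L2_vecs)
    have "norm ((cmod (f x + g x))\<^sup>2) \<le> norm (2 * (cmod (f x))\<^sup>2 + 2 * (cmod (g x))\<^sup>2)" for x
    proof -
      have "(cmod (f x + g x))\<^sup>2 \<le> (cmod (f x) + cmod (g x))\<^sup>2"
        by (intro power_mono norm_triangle_ineq) simp
      also have "\<dots> \<le> 2 * (cmod (f x))\<^sup>2 + 2 * (cmod (g x))\<^sup>2"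
        using sum_squares_bound[of "cmod (f x)" "cmod (g x)"]
        by (simp add: power2_eq_square algebra_simps)
      finally show ?thesis by simp
    qed
    then show "AE x in M. norm ((cmod (f x + g x))\<^sup>2) \<le> norm (2 * (cmod (f x))\<^sup>2 + 2 * (cmod (g x))\<^sup>2)"
      by simp
    show "(\<lambda>x. (cmod (f x + g x))\<^sup>2) \<in> borel_measurable M"
      using L2_measurable[OF assms(1)] L2_measurable[OF assms(2)] by measurable
  qed
  moreover have "(\<lambda>x. f x + g x) \<in> borel_measurable M"
    by (intro borel_measurable_add L2_measurable assms)
  ultimately show ?thesis by (simp add: L2_vecs)
qed

lemma L2_scale: "f \<in> vecs (L2_space M) \<Longrightarrow> (\<lambda>x. a * f x) \<in> vecs (L2_space M)"
  unfolding L2_vecs norm_mult power_mult_distrib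
  by (intro conjI borel_measurable_times borel_measurable_const integrable_mult_right) auto

lemma L2_ip_self: "ip (L2_space M) f f = complex_of_real (LINT x|M. (cmod (f x))\<^sup>2)"
  unfolding L2_ip complex_norm_square[symmetric] by (rule integral_complex_of_real)

lemma L2_nrm: "(nrm (L2_space M) f)\<^sup>2 = (LINT x|M. (cmod (f x))\<^sup>2)"
  by (simp add: nrm_def L2_ip_self)

lemma L2_nn_integral:
  assumes "f \<in> vecs (L2_space M)"
  shows "(\<integral>\<^sup>+x. ennreal ((cmod (f x))\<^sup>2) \<partial>M) = ennreal ((nrm (L2_space M) f)\<^sup>2)"
  unfolding L2_nrm using assms by (intro nn_integral_eq_integral) (auto simp: L2_vecs)

text \<open>Fatou's lemma: an almost everywhere limit along a subsequence of a Cauchy sequence is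
  also its limit in norm. The limit f is left arbitrary because it is later either a pointwise
  \<open>lim\<close> or, in the Fock space, a given entire function.\<close>

lemma L2_limit_of_AE:
  assumes X: "cauchy_in (L2_space M) X" and r: "filterlim r at_top sequentially"
    and ae: "AE x in M. (\<lambda>k. X (r k) x) \<longlonglongrightarrow> f x" and f: "f \<in> borel_measurable M"
  shows "f \<in> vecs (L2_space M)" "(\<lambda>n. nrm (L2_space M) (\<lambda>x. X n x - f x)) \<longlonglongrightarrow> 0"
proof -
  have Xv: "X n \<in> vecs (L2_space M)" for n using X by (simp add: cauchy_in_def)
  have diff: "(\<lambda>x. g x - h x) \<in> vecs (L2_space M)"
    if "g \<in> vecs (L2_space M)" "h \<in> vecs (L2_space M)" for g h
    using L2_add[OF that(1) L2_scale[OF that(2), of "-1"]] by simp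
  have fatou: "(\<lambda>x. X n x - f x) \<in> vecs (L2_space M) \<and> nrm (L2_space M) (\<lambda>x. X n x - f x) \<le> e"
    if e: "e > 0" and N: "\<And>m. m \<ge> N \<Longrightarrow> nrm (L2_space M) (\<lambda>x. X n x - X m x) < e" for e N n
  proof -
    have m: "(\<lambda>x. X n x - f x) \<in> borel_measurable M"
      by (intro borel_measurable_diff L2_measurable Xv f)
    have "(\<integral>\<^sup>+x. ennreal ((cmod (X n x - f x))\<^sup>2) \<partial>M) =
        (\<integral>\<^sup>+x. liminf (\<lambda>k. ennreal ((cmod (X n x - X (r k) x))\<^sup>2)) \<partial>M)"
    proof (rule nn_integral_cong_AE, use ae in eventually_elim)
      fix x assume "(\<lambda>k. X (r k) x) \<longlonglongrightarrow> f x"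
      then have "(\<lambda>k. ennreal ((cmod (X n x - X (r k) x))\<^sup>2)) \<longlonglongrightarrow> ennreal ((cmod (X n x - f x))\<^sup>2)"
        by (intro tendsto_intros) 
      then show "ennreal ((cmod (X n x - f x))\<^sup>2) = liminf (\<lambda>k. ennreal ((cmod (X n x - X (r k) x))\<^sup>2))"
        by (intro lim_imp_Liminf[symmetric]) auto
    qed
    also have "\<dots> \<le> liminf (\<lambda>k. \<integral>\<^sup>+x. ennreal ((cmod (X n x - X (r k) x))\<^sup>2) \<partial>M)"
    proof (rule nn_integral_liminf)
      fix k
      show "(\<lambda>x. ennreal ((cmod (X n x - X (r k) x))\<^sup>2)) \<in> borel_measurable M"
        using L2_measurable[OF Xv] by measurable
    qed
    also have "\<dots> \<le> ennreal (e\<^sup>2)"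
    proof (rule Liminf_le)
      have "\<forall>\<^sub>F k in sequentially. r k \<ge> N" using r by (simp add: filterlim_at_top)
      then show "\<forall>\<^sub>F k in sequentially. (\<integral>\<^sup>+x. ennreal ((cmod (X n x - X (r k) x))\<^sup>2) \<partial>M) \<le> ennreal (e\<^sup>2)"
      proof eventually_elim
        fix k assume "N \<le> r k"
        have "nrm (L2_space M) (\<lambda>x. X n x - X (r k) x) \<ge> 0" by (simp add: nrm_def L2_ip_self)
        then show "(\<integral>\<^sup>+x. ennreal ((cmod (X n x - X (r k) x))\<^sup>2) \<partial>M) \<le> ennreal (e\<^sup>2)"
          using N[OF \<open>N \<le> r k\<close>] L2_nn_integral[OF diff[OF Xv Xv], of n "r k"]
          by (simp add: ennreal_leI power_mono)
      qed
    qed simp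
    finally have le: "(\<integral>\<^sup>+x. ennreal ((cmod (X n x - f x))\<^sup>2) \<partial>M) \<le> ennreal (e\<^sup>2)" .
    have int: "integrable M (\<lambda>x. (cmod (X n x - f x))\<^sup>2)"
    proof (rule integrableI_nonneg)
      show "(\<lambda>x. (cmod (X n x - f x))\<^sup>2) \<in> borel_measurable M"
        using m by measurable
      show "(\<integral>\<^sup>+x. ennreal ((cmod (X n x - f x))\<^sup>2) \<partial>M) < \<infinity>"
        using le by (rule le_less_trans) simp
    qed simp
    have v: "(\<lambda>x. X n x - f x) \<in> vecs (L2_space M)" using m int by (simp add: L2_vecs)
    have "(nrm (L2_space M) (\<lambda>x. X n x - f x))\<^sup>2 \<le> e\<^sup>2"
      using le L2_nn_integral[OF v] by simp
    then have "nrm (L2_space M) (\<lambda>x. X n x - f x) \<le> e"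
      by (rule power2_le_imp_le) (use e in simp)
    then show ?thesis using v by simp
  qed
  have cauchy: "\<exists>N. \<forall>m\<ge>N. \<forall>n\<ge>N. nrm (L2_space M) (\<lambda>x. X m x - X n x) < e" if "e > 0" for e
    using X that by (simp add: cauchy_in_def)
  obtain N where N: "\<forall>m\<ge>N. \<forall>n\<ge>N. nrm (L2_space M) (\<lambda>x. X m x - X n x) < 1"
    using cauchy[of 1] by auto
  have "(\<lambda>x. X N x - f x) \<in> vecs (L2_space M)" using fatou[of 1 N N] N by auto
  from diff[OF Xv[of N] this] show "f \<in> vecs (L2_space M)" by simp
  show "(\<lambda>n. nrm (L2_space M) (\<lambda>x. X n x - f x)) \<longlonglongrightarrow> 0"
  proof (rule LIMSEQ_I)
    fix e :: real assume e: "e > 0"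
    obtain N where N: "\<forall>m\<ge>N. \<forall>n\<ge>N. nrm (L2_space M) (\<lambda>x. X m x - X n x) < e / 2"
      using cauchy[of "e / 2"] e by auto
    have "norm (nrm (L2_space M) (\<lambda>x. X n x - f x) - 0) < e" if n: "n \<ge> N" for n
    proof -
      have "nrm (L2_space M) (\<lambda>x. X n x - f x) \<le> e / 2"
        using fatou[of "e / 2" N n] N e n by auto
      moreover have "nrm (L2_space M) (\<lambda>x. X n x - f x) \<ge> 0" by (simp add: nrm_def L2_ip_self)
      ultimately show ?thesis using e by simp
    qed
    then show "\<exists>N. \<forall>n\<ge>N. norm (nrm (L2_space M) (\<lambda>x. X n x - f x) - 0) < e" by blast
  qed
qed

text \<open>A subsequence with rapidly shrinking steps converges almost everywhere, and Fatou
  upgrades this to convergence in norm.\<close>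

lemma L2_complete:
  assumes X: "cauchy_in (L2_space M) X"
  shows "\<exists>f\<in>vecs (L2_space M). (\<lambda>n. nrm (L2_space M) (\<lambda>x. X n x - f x)) \<longlonglongrightarrow> 0"
proof -
  have Xv: "X n \<in> vecs (L2_space M)" for n using X by (simp add: cauchy_in_def)
  have diff: "(\<lambda>x. g x - h x) \<in> vecs (L2_space M)"
    if "g \<in> vecs (L2_space M)" "h \<in> vecs (L2_space M)" for g h
    using L2_add[OF that(1) L2_scale[OF that(2), of "-1"]] by simp
  have "\<forall>k. \<exists>N. \<forall>m\<ge>N. \<forall>n\<ge>N. nrm (L2_space M) (\<lambda>x. X m x - X n x) < (1/2) ^ k"
    using X by (simp add: cauchy_in_def)
  from choice[OF this] obtain R where
    R: "\<And>k m n. m \<ge> R k \<Longrightarrow> n \<ge> R k \<Longrightarrow> nrm (L2_space M) (\<lambda>x. X m x - X n x) < (1/2) ^ k"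
    by blast
  define r where "r k = k + (\<Sum>j\<le>k. R j)" for k
  have rR: "R k \<le> r k" for k
    using member_le_sum[of k "{..k}" R] by (simp add: r_def trans_le_add2)
  have rS: "r k \<le> r (Suc k)" for k by (simp add: r_def)
  have rlim: "filterlim r at_top sequentially"
    by (rule filterlim_at_top_mono[OF filterlim_ident]) (simp add: r_def)
  define D where "D k x = cmod (X (r (Suc k)) x - X (r k) x)" for k x
  have Dm: "D k \<in> borel_measurable M" for k
    unfolding D_def using L2_measurable[OF Xv] by measurable
  \<comment> \<open>The squared steps integrate to at most 4^(-k), so the weight 2^k still leaves a
    geometric series. The weight serves to pass from squares to absolute steps: (2^k D - 1)^2 \<ge>
    0 implies D \<le> 2^k D^2 + 2^(-k).\<close>
  have D2: "(\<integral>\<^sup>+x. ennreal (2 ^ k * (D k x)\<^sup>2) \<partial>M) \<le> ennreal ((1/2) ^ k)" for k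
  proof -
    have Dm': "(\<lambda>x. ennreal ((D k x)\<^sup>2)) \<in> borel_measurable M"
      by (intro measurable_compose[OF _ measurable_ennreal] borel_measurable_power Dm)
    have "(\<integral>\<^sup>+x. ennreal ((D k x)\<^sup>2) \<partial>M) = ennreal ((nrm (L2_space M) (\<lambda>x. X (r (Suc k)) x - X (r k) x))\<^sup>2)"
      unfolding D_def by (rule L2_nn_integral[OF diff[OF Xv Xv]])
    also have "\<dots> \<le> ennreal (((1/2) ^ k)\<^sup>2)"
    proof (intro ennreal_leI power_mono)
      show "nrm (L2_space M) (\<lambda>x. X (r (Suc k)) x - X (r k) x) \<le> (1/2) ^ k"
        using R[of k "r (Suc k)" "r k"] rR[of k] rS[of k] by simp
      show "nrm (L2_space M) (\<lambda>x. X (r (Suc k)) x - X (r k) x) \<ge> 0" by (simp add: nrm_def L2_ip_self)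
    qed
    finally have "ennreal (2 ^ k) * (\<integral>\<^sup>+x. ennreal ((D k x)\<^sup>2) \<partial>M) \<le> ennreal (2 ^ k) * ennreal (((1/2) ^ k)\<^sup>2)"
      by (intro mult_left_mono) auto
    also have "ennreal (2 ^ k) * ennreal (((1/2) ^ k)\<^sup>2) = ennreal ((1/2) ^ k)"
      by (simp add: ennreal_mult[symmetric] power2_eq_square power_mult_distrib[symmetric])
    finally show ?thesis
      by (simp add: ennreal_mult nn_integral_cmult[OF Dm'])
  qed
  have "(\<integral>\<^sup>+x. (\<Sum>k. ennreal (2 ^ k * (D k x)\<^sup>2)) \<partial>M) = (\<Sum>k. \<integral>\<^sup>+x. ennreal (2 ^ k * (D k x)\<^sup>2) \<partial>M)"
    by (rule nn_integral_suminf)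
       (intro measurable_compose[OF _ measurable_ennreal] borel_measurable_times borel_measurable_power Dm
         borel_measurable_const)
  also have "\<dots> \<le> (\<Sum>k. ennreal ((1/2) ^ k))"
    by (intro suminf_le D2) auto
  also have "\<dots> < \<infinity>"
    by (subst suminf_ennreal2) (auto simp: summable_geometric)
  finally have "AE x in M. (\<Sum>k. ennreal (2 ^ k * (D k x)\<^sup>2)) \<noteq> \<infinity>"
    by (intro nn_integral_PInf_AE borel_measurable_suminf_order
          measurable_compose[OF _ measurable_ennreal] borel_measurable_times borel_measurable_power Dm
         borel_measurable_const) auto
  then have ae: "AE x in M. (\<lambda>k. X (r k) x) \<longlonglongrightarrow> lim (\<lambda>k. X (r k) x)"
  proof eventually_elim
    fix x assume "(\<Sum>k. ennreal (2 ^ k * (D k x)\<^sup>2)) \<noteq> \<infinity>"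
    then have "summable (\<lambda>k. 2 ^ k * (D k x)\<^sup>2)"
      by (intro summable_suminf_not_top) auto
    then have sm: "summable (\<lambda>k. 2 ^ k * (D k x)\<^sup>2 + (1/2) ^ k)"
      by (intro summable_add summable_geometric) auto
    have "summable (\<lambda>k. X (r (Suc k)) x - X (r k) x)"
    proof (rule summable_comparison_test'[OF sm])
      fix k
      have "0 \<le> (2 ^ k * D k x - 1)\<^sup>2" by simp
      then have "2 * (2 ^ k * D k x) \<le> 2 ^ k * (2 ^ k * (D k x)\<^sup>2) + 1"
        by (simp add: power2_eq_square algebra_simps)
      moreover have "0 \<le> 2 ^ k * (2 ^ k * (D k x)\<^sup>2) + 1" by (intro add_nonneg_nonneg mult_nonneg_nonneg) auto
      ultimately have "2 ^ k * D k x \<le> 2 ^ k * (2 ^ k * (D k x)\<^sup>2) + 1" by linarith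
      also have "\<dots> = 2 ^ k * (2 ^ k * (D k x)\<^sup>2 + (1/2) ^ k)"
        by (simp add: algebra_simps power_mult_distrib[symmetric])
      finally have "D k x \<le> 2 ^ k * (D k x)\<^sup>2 + (1/2) ^ k" by simp
      then show "norm (X (r (Suc k)) x - X (r k) x) \<le> 2 ^ k * (D k x)\<^sup>2 + (1/2) ^ k"
        by (simp add: D_def)
    qed
    then obtain l where "(\<lambda>m. \<Sum>k<m. X (r (Suc k)) x - X (r k) x) \<longlonglongrightarrow> l"
      using summable_LIMSEQ by blast
    then have "(\<lambda>m. (X (r m) x - X (r 0) x) + X (r 0) x) \<longlonglongrightarrow> l + X (r 0) x"
      by (intro tendsto_add tendsto_const) (simp add: sum_lessThan_telescope[of "\<lambda>k. X (r k) x"])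
    then have "convergent (\<lambda>k. X (r k) x)" by (auto simp: convergent_def)
    then show "(\<lambda>k. X (r k) x) \<longlonglongrightarrow> lim (\<lambda>k. X (r k) x)" by (simp add: convergent_LIMSEQ_iff)
  qed
  have "(\<lambda>x. lim (\<lambda>k. X (r k) x)) \<in> borel_measurable M"
    by (rule borel_measurable_lim_metric) (intro L2_measurable Xv)
  from L2_limit_of_AE[OF X rlim ae this] show ?thesis
    by (intro bexI[of _ "\<lambda>x. lim (\<lambda>k. X (r k) x)"])
qed

theorem hilbert_L2: "hilbert (L2_space M)"
  unfolding hilbert_def
proof (intro conjI allI ballI impI)
  show "(\<lambda>_. 0) \<in> vecs (L2_space M)" by (simp add: L2_vecs)
  fix f assume f: "f \<in> vecs (L2_space M)"
  show "(\<lambda>x. a * f x) \<in> vecs (L2_space M)" for a by (rule L2_scale[OF f])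
  show "0 \<le> Re (ip (L2_space M) f f)" by (simp add: L2_ip_self)
  fix g assume g: "g \<in> vecs (L2_space M)"
  show "(\<lambda>x. f x + g x) \<in> vecs (L2_space M)" by (rule L2_add[OF f g])
  show "ip (L2_space M) (\<lambda>x. a * f x) g = a * ip (L2_space M) f g" for a
    by (simp add: L2_ip mult.assoc)
  show "ip (L2_space M) g f = cnj (ip (L2_space M) f g)"
    unfolding L2_ip Bochner_Integration.integral_cnj[symmetric] by (simp add: mult.commute)
  fix h assume h: "h \<in> vecs (L2_space M)"
  show "ip (L2_space M) (\<lambda>x. f x + g x) h = ip (L2_space M) f h + ip (L2_space M) g h"
    unfolding L2_ip distrib_right
    by (rule Bochner_Integration.integral_add[OF L2_integrable_mult[OF f h] L2_integrable_mult[OF g h]])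
qed (rule L2_complete)

section \<open>The Gaussian measure on complex Euclidean space\<close>

lemma nn_integral_lborel_translation:
  fixes f :: "'a::euclidean_space \<Rightarrow> ennreal"
  assumes "f \<in> borel_measurable borel"
  shows "(\<integral>\<^sup>+x. f (a + x) \<partial>lborel) = (\<integral>\<^sup>+x. f x \<partial>lborel)"
proof -
  have "(\<integral>\<^sup>+x. f x \<partial>lborel) = (\<integral>\<^sup>+x. f x \<partial>distr lborel borel ((+) a))"
    by (simp add: lborel_distr_plus)
  also have "\<dots> = (\<integral>\<^sup>+x. f (a + x) \<partial>lborel)"
    by (rule nn_integral_distr) (use assms in auto)
  finally show ?thesis by simp
qed

text \<open>Both sides are compared after multiplying with the volume of the unit ball, which is
  written as an integral over translations.\<close>

lemma nn_integral_lborel_isometry: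
  fixes T :: "'a::euclidean_space \<Rightarrow> 'a" and h :: "'a \<Rightarrow> ennreal"
  assumes T: "linear T" and T': "\<And>x. T (T' x) = x" and nrm: "\<And>x. norm (T x) = norm x"
    and h: "h \<in> borel_measurable borel"
  shows "(\<integral>\<^sup>+x. h (T x) \<partial>lborel) = (\<integral>\<^sup>+x. h x \<partial>lborel)"
proof -
  define B where "B = ball (0::'a) 1"
  define c where "c = emeasure lborel B"
  have Bm [measurable]: "B \<in> sets borel" by (simp add: B_def)
  have [measurable]: "T \<in> borel_measurable borel"
    using T by (intro borel_measurable_continuous_onI linear_continuous_on) (simp add: linear_linear)
  note h [measurable]
  have c: "c \<noteq> 0" "c \<noteq> top"
    using emeasure_lborel_ball_finite[of "0::'a" 1] content_ball_pos[of 1 "0::'a"]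
    by (auto simp: c_def B_def measure_def)
  have swap: "(\<integral>\<^sup>+x. \<integral>\<^sup>+y. g x y \<partial>lborel \<partial>lborel) = (\<integral>\<^sup>+y. \<integral>\<^sup>+x. g x y \<partial>lborel \<partial>lborel)"
    if "case_prod g \<in> borel_measurable (lborel \<Otimes>\<^sub>M lborel)" for g :: "'a \<Rightarrow> 'a \<Rightarrow> ennreal"
    using lborel_pair.Fubini'[OF that] by simp
  have "(\<integral>\<^sup>+x. h (T x) \<partial>lborel) * c = (\<integral>\<^sup>+y. \<integral>\<^sup>+x. h (T x) * indicator B y \<partial>lborel \<partial>lborel)"
    by (simp add: nn_integral_multc nn_integral_cmult c_def)
  also have "\<dots> = (\<integral>\<^sup>+y. \<integral>\<^sup>+x. h (y + T x) * indicator B y \<partial>lborel \<partial>lborel)"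
  proof (rule nn_integral_cong)
    fix y
    have "(\<integral>\<^sup>+x. h (T x) * indicator B y \<partial>lborel) = (\<integral>\<^sup>+x. h (T (T' y + x)) * indicator B y \<partial>lborel)"
      by (rule nn_integral_lborel_translation[symmetric]) measurable
    then show "(\<integral>\<^sup>+x. h (T x) * indicator B y \<partial>lborel) = (\<integral>\<^sup>+x. h (y + T x) * indicator B y \<partial>lborel)"
      by (simp add: linear_add[OF T] T')
  qed
  also have "\<dots> = (\<integral>\<^sup>+x. \<integral>\<^sup>+y. h (y + T x) * indicator B y \<partial>lborel \<partial>lborel)"
    by (rule swap) measurable
  also have "\<dots> = (\<integral>\<^sup>+x. \<integral>\<^sup>+y. h y * indicator B (y - T x) \<partial>lborel \<partial>lborel)"
  proof (rule nn_integral_cong)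
    fix x
    have "(\<integral>\<^sup>+y. h y * indicator B (y - T x) \<partial>lborel) =
        (\<integral>\<^sup>+y. h (T x + y) * indicator B (T x + y - T x) \<partial>lborel)"
      by (rule nn_integral_lborel_translation[symmetric]) measurable
    then show "(\<integral>\<^sup>+y. h (y + T x) * indicator B y \<partial>lborel) = (\<integral>\<^sup>+y. h y * indicator B (y - T x) \<partial>lborel)"
      by (simp add: add.commute)
  qed
  also have "\<dots> = (\<integral>\<^sup>+y. \<integral>\<^sup>+x. h y * indicator B (y - T x) \<partial>lborel \<partial>lborel)"
    by (rule swap) measurable
  also have "\<dots> = (\<integral>\<^sup>+y. h y * c \<partial>lborel)"
  proof (rule nn_integral_cong)
    fix y
    have ind: "indicator B (y - T x) = (indicator B (x - T' y) :: ennreal)" for x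
    proof -
      have "norm (y - T x) = norm (T (T' y - x))" by (simp add: linear_diff[OF T] T')
      then show ?thesis by (simp add: nrm B_def indicator_def norm_minus_commute)
    qed
    have "(\<integral>\<^sup>+x. h y * indicator B (y - T x) \<partial>lborel) = h y * (\<integral>\<^sup>+x. indicator B (x - T' y) \<partial>lborel)"
      unfolding ind by (rule nn_integral_cmult) measurable
    also have "(\<integral>\<^sup>+x. indicator B (x - T' y) \<partial>lborel) = (\<integral>\<^sup>+x. indicator B (T' y + x - T' y) \<partial>lborel)"
      by (rule nn_integral_lborel_translation[symmetric]) measurable
    also have "\<dots> = c" by (simp add: c_def)
    finally show "(\<integral>\<^sup>+x. h y * indicator B (y - T x) \<partial>lborel) = h y * c" .
  qed
  also have "\<dots> = (\<integral>\<^sup>+y. h y \<partial>lborel) * c"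
    by (rule nn_integral_multc) measurable
  finally show ?thesis
    using c by (simp add: ennreal_mult_cancel_left mult.commute[of _ c])
qed

lemma nn_integral_gaussian_real:
  assumes a: "a > 0"
  shows "(\<integral>\<^sup>+x. ennreal (exp (- (a * x\<^sup>2))) \<partial>lborel) = ennreal (sqrt (pi / a))"
proof -
  define \<sigma> where "\<sigma> = sqrt (1 / (2 * a))"
  have s: "\<sigma> > 0" "\<sigma>\<^sup>2 = 1 / (2 * a)" using a by (auto simp: \<sigma>_def)
  have eq: "exp (- (a * x\<^sup>2)) = sqrt (pi / a) * normal_density 0 \<sigma> x" for x
    using a by (simp add: normal_density_def s field_simps)
  have "(\<integral>\<^sup>+x. ennreal (normal_density 0 \<sigma> x) \<partial>lborel) = ennreal (\<integral>x. normal_density 0 \<sigma> x \<partial>lborel)"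
    by (rule nn_integral_eq_integral) (use s in auto)
  then have "(\<integral>\<^sup>+x. ennreal (normal_density 0 \<sigma> x) \<partial>lborel) = 1" using s by simp
  moreover have "(\<integral>\<^sup>+x. ennreal (exp (- (a * x\<^sup>2))) \<partial>lborel) =
      ennreal (sqrt (pi / a)) * (\<integral>\<^sup>+x. ennreal (normal_density 0 \<sigma> x) \<partial>lborel)"
    unfolding eq using a by (subst nn_integral_cmult[symmetric]) (auto simp: ennreal_mult)
  ultimately show ?thesis by simp
qed

lemma nn_integral_gaussian:
  assumes a: "a > 0"
  shows "(\<integral>\<^sup>+x. ennreal (exp (- (a * (norm x)\<^sup>2))) \<partial>(lborel :: 'a::euclidean_space measure)) =
    ennreal (sqrt (pi / a) ^ DIM('a))"
proof -
  have "ennreal (exp (- (a * (norm x)\<^sup>2))) = (\<Prod>b\<in>Basis. ennreal (exp (- (a * (x \<bullet> b)\<^sup>2))))" for x :: 'a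
  proof -
    have "(norm x)\<^sup>2 = (\<Sum>b\<in>Basis. (x \<bullet> b)\<^sup>2)"
      unfolding power2_norm_eq_inner euclidean_inner[of x x] by (simp add: power2_eq_square)
    then have "exp (- (a * (norm x)\<^sup>2)) = (\<Prod>b\<in>Basis. exp (- (a * (x \<bullet> b)\<^sup>2)))"
      by (simp add: exp_sum[symmetric] sum_distrib_left sum_negf)
    then show ?thesis by (simp add: prod_ennreal)
  qed
  then have "(\<integral>\<^sup>+x. ennreal (exp (- (a * (norm x)\<^sup>2))) \<partial>(lborel :: 'a measure)) =
      (\<integral>\<^sup>+x. (\<Prod>b\<in>Basis. ennreal (exp (- (a * (x \<bullet> b)\<^sup>2)))) \<partial>(lborel :: 'a measure))" by simp
  also have "\<dots> = (\<Prod>b\<in>(Basis::'a set). \<integral>\<^sup>+x. ennreal (exp (- (a * x\<^sup>2))) \<partial>lborel)"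
    by (rule nn_integral_lborel_prod) auto
  also have "\<dots> = ennreal (sqrt (pi / a) ^ DIM('a))"
    using a by (simp add: nn_integral_gaussian_real[OF a] ennreal_power)
  finally show ?thesis .
qed

text \<open>pi^m is the integral of exp (-|z|^2) over the 2m real dimensions, and the same factor
  normalizes \<open>modulated_fock_space\<close>. The Fock space thus sits inside L^2 of a
  probability measure.\<close>

definition gauss_density :: "complex^'m \<Rightarrow> real" where
  "gauss_density z = exp (- (norm z)\<^sup>2) / pi ^ CARD('m)"

definition gauss :: "(complex^'m) measure" where
  "gauss = density lborel gauss_density"

lemma gauss_density_measurable [measurable]: "gauss_density \<in> borel_measurable borel"
  unfolding gauss_density_def by measurable

lemma gauss_density_pos: "gauss_density z > 0"
  by (simp add: gauss_density_def)

lemma sets_gauss [simp, measurable_cong]: "sets gauss = sets borel"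
  by (simp add: gauss_def)

lemma space_gauss [simp]: "space gauss = UNIV"
  by (simp add: gauss_def)

lemma prob_space_gauss: "prob_space (gauss :: (complex^'m) measure)"
proof
  have dim: "DIM(complex^'m) = 2 * CARD('m)" by simp
  have "(\<integral>\<^sup>+z. ennreal (gauss_density (z::complex^'m)) \<partial>lborel) =
      ennreal (1 / pi ^ CARD('m)) * (\<integral>\<^sup>+z. ennreal (exp (- (1 * (norm z)\<^sup>2))) \<partial>(lborel :: (complex^'m) measure))"
    by (subst nn_integral_cmult[symmetric])
       (auto simp: gauss_density_def ennreal_mult[symmetric] intro!: nn_integral_cong)
  also have "\<dots> = 1"
    unfolding nn_integral_gaussian[OF zero_less_one] dim power_mult
    by (simp add: ennreal_mult[symmetric])
  finally show "emeasure gauss (space (gauss :: (complex^'m) measure)) = 1"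
    by (simp add: gauss_def emeasure_density)
qed

interpretation gauss: prob_space "gauss :: (complex^'m) measure"
  by (rule prob_space_gauss)

lemma nn_integral_gauss:
  "f \<in> borel_measurable borel \<Longrightarrow> (\<integral>\<^sup>+z. f z \<partial>gauss) = (\<integral>\<^sup>+z. ennreal (gauss_density z) * f z \<partial>lborel)"
  unfolding gauss_def by (rule nn_integral_density) auto

lemma integral_gauss:
  fixes f :: "complex^'m \<Rightarrow> complex"
  shows "f \<in> borel_measurable borel \<Longrightarrow> (LINT z|gauss. f z) = (LINT z|lborel. gauss_density z *\<^sub>R f z)"
  unfolding gauss_def by (rule integral_density) (auto simp: gauss_density_pos less_imp_le)

lemma integrable_gauss:
  fixes f :: "complex^'m \<Rightarrow> 'b::{banach, second_countable_topology}"
  shows "f \<in> borel_measurable borel \<Longrightarrow> integrable gauss f \<longleftrightarrow> integrable lborel (\<lambda>z. gauss_density z *\<^sub>R f z)"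
  unfolding gauss_def by (rule integrable_density) (auto simp: gauss_density_pos less_imp_le)

text \<open>The density depends only on the norm. Two kinds of T occur later: multiplication of all
  coordinates by one number of modulus 1, for mean values, and rotation of a single coordinate, for
  orthogonality.\<close>

lemma distr_gauss_isometry:
  fixes T :: "complex^'m \<Rightarrow> complex^'m"
  assumes T: "linear T" "\<And>x. T (T' x) = x" "\<And>x. norm (T x) = norm x"
  shows "distr gauss borel T = (gauss :: (complex^'m) measure)"
proof (rule measure_eqI)
  fix A :: "(complex^'m) set" assume "A \<in> sets (distr gauss borel T)"
  then have [measurable]: "A \<in> sets borel" by simp
  have [measurable]: "T \<in> borel_measurable borel"
    using T by (intro borel_measurable_continuous_onI linear_continuous_on) (simp add: linear_linear)
  have "emeasure (distr gauss borel T) A = (\<integral>\<^sup>+z. indicator A (T z) \<partial>gauss)"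
    by (subst nn_integral_indicator[symmetric], simp, subst nn_integral_distr) auto
  also have "\<dots> = (\<integral>\<^sup>+z. ennreal (gauss_density (T z)) * indicator A (T z) \<partial>lborel)"
    by (subst nn_integral_gauss) (auto simp: gauss_density_def T(3))
  also have "\<dots> = (\<integral>\<^sup>+z. ennreal (gauss_density z) * indicator A z \<partial>lborel)"
    by (rule nn_integral_lborel_isometry[OF T]) measurable
  also have "\<dots> = emeasure gauss A" by (simp add: gauss_def emeasure_density)
  finally show "emeasure (distr gauss borel T) A = emeasure gauss A" .
qed simp

text \<open>Lebesgue measure is translation invariant, and the exponential is the quotient of the
  Gaussian densities at z + w and at z.\<close>

lemma
  fixes f :: "complex^'m \<Rightarrow> complex"
  assumes f: "f \<in> borel_measurable borel"
  shows integral_gauss_translation: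
      "(LINT z|gauss. f z) = (LINT z|gauss. complex_of_real (exp (- 2 * (z \<bullet> w) - (norm w)\<^sup>2)) * f (z + w))"
    and integrable_gauss_translation:
      "integrable gauss f \<Longrightarrow>
        integrable gauss (\<lambda>z. complex_of_real (exp (- 2 * (z \<bullet> w) - (norm w)\<^sup>2)) * f (z + w))"
proof -
  have d: "gauss_density (z + w) = gauss_density z * exp (- 2 * (z \<bullet> w) - (norm w)\<^sup>2)" for z
    by (simp add: gauss_density_def exp_add[symmetric] power2_norm_eq_inner inner_add inner_commute algebra_simps)
  note f [measurable]
  have m: "(\<lambda>z. complex_of_real (exp (- 2 * (z \<bullet> w) - (norm w)\<^sup>2)) * f (z + w)) \<in> borel_measurable borel"
    by measurable
  have m': "(\<lambda>z. gauss_density z *\<^sub>R f z) \<in> borel_measurable borel" by measurable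
  have eq: "gauss_density (w + z) *\<^sub>R f (w + z) =
      gauss_density z *\<^sub>R (complex_of_real (exp (- 2 * (z \<bullet> w) - (norm w)\<^sup>2)) * f (z + w))" for z
    using d[of z] by (simp add: add.commute scaleR_conv_of_real)
  have "(LINT z|gauss. f z) = (LINT z|distr lborel borel ((+) w). gauss_density z *\<^sub>R f z)"
    by (simp add: integral_gauss[OF f] lborel_distr_plus)
  also have "\<dots> = (LINT z|lborel. gauss_density (w + z) *\<^sub>R f (w + z))"
    by (rule integral_distr) (use m' in auto)
  finally show "(LINT z|gauss. f z) = (LINT z|gauss. complex_of_real (exp (- 2 * (z \<bullet> w) - (norm w)\<^sup>2)) * f (z + w))"
    unfolding integral_gauss[OF m] eq .
  show "integrable gauss (\<lambda>z. complex_of_real (exp (- 2 * (z \<bullet> w) - (norm w)\<^sup>2)) * f (z + w))"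
    if "integrable gauss f"
  proof -
    have "integrable (distr lborel borel ((+) w)) (\<lambda>z. gauss_density z *\<^sub>R f z)"
      using that by (simp add: integrable_gauss[OF f] lborel_distr_plus)
    then have "integrable lborel (\<lambda>z. gauss_density (w + z) *\<^sub>R f (w + z))"
      by (subst (asm) integrable_distr_eq) (use m' in auto)
    then show ?thesis unfolding integrable_gauss[OF m] eq .
  qed
qed

text \<open>R |z| \<le> R^2 / 2 + |z|^2 / 2 leaves half of the Gaussian exponent for integration.
  This is the source of the dominating functions used below.\<close>

lemma integrable_gauss_exp_norm: "integrable gauss (\<lambda>z::complex^'m. exp (R * norm z))"
proof -
  have "(\<integral>\<^sup>+z. ennreal (exp (- ((1/2) * (norm z)\<^sup>2))) \<partial>(lborel :: (complex^'m) measure)) < \<infinity>"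
    by (subst nn_integral_gaussian) auto
  then have "integrable lborel (\<lambda>z::complex^'m. exp (- ((1/2) * (norm z)\<^sup>2)))"
    by (intro integrableI_nonneg) auto
  then have "integrable lborel (\<lambda>z::complex^'m. exp (R\<^sup>2 / 2) / pi ^ CARD('m) * exp (- ((1/2) * (norm z)\<^sup>2)))"
    by (rule integrable_mult_right)
  then have "integrable lborel (\<lambda>z::complex^'m. gauss_density z *\<^sub>R exp (R * norm z))"
  proof (rule Bochner_Integration.integrable_bound)
    have "exp (- (norm z)\<^sup>2) * exp (R * norm z) \<le> exp (R\<^sup>2 / 2) * exp (- ((1/2) * (norm z)\<^sup>2))" for z :: "complex^'m"
    proof -
      have "R * norm z \<le> R\<^sup>2 / 2 + (norm z)\<^sup>2 / 2"
        using sum_squares_bound[of R "norm z"] by simp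
      then show ?thesis by (simp add: exp_add[symmetric])
    qed
    then show "AE z in lborel. norm (gauss_density (z::complex^'m) *\<^sub>R exp (R * norm z)) \<le>
        norm (exp (R\<^sup>2 / 2) / pi ^ CARD('m) * exp (- ((1/2) * (norm z)\<^sup>2)))"
      by (simp add: gauss_density_def field_simps)
  qed measurable
  then show ?thesis by (subst integrable_gauss) auto
qed

section \<open>Entire functions on complex Euclidean space\<close>

lemma entireI:
  "(\<And>z. \<exists>D. (f has_derivative D) (at z) \<and> (\<forall>c v. D (c *s v) = c * D v)) \<Longrightarrow> entire f"
  by (simp add: entire_def)

lemma entireE:
  assumes "entire f"
  obtains D where "(f has_derivative D) (at z)" "\<And>c v. D (c *s v) = c * D v"
  using assms unfolding entire_def by blast

lemma entire_continuous_on: "entire f \<Longrightarrow> continuous_on S f"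
  by (metis continuous_at_imp_continuous_on entireE has_derivative_continuous)

lemma entire_measurable: "entire f \<Longrightarrow> f \<in> borel_measurable borel"
  by (intro borel_measurable_continuous_onI entire_continuous_on)

lemma entire_const: "entire (\<lambda>_. a)"
  by (rule entireI) (auto intro!: exI[of _ "\<lambda>_. 0"])

lemma entire_component: "entire (\<lambda>z. z $ j)"
  by (rule entireI, rule exI[of _ "\<lambda>v. v $ j"])
     (auto intro: bounded_linear_imp_has_derivative bounded_linear_vec_nth)

lemma entire_add: "entire f \<Longrightarrow> entire g \<Longrightarrow> entire (\<lambda>z. f z + g z)"
proof (rule entireI)
  fix z assume "entire f" "entire g"
  then obtain D E where "(f has_derivative D) (at z)" "\<And>c v. D (c *s v) = c * D v"
    "(g has_derivative E) (at z)" "\<And>c v. E (c *s v) = c * E v"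
    by (metis entireE)
  then show "\<exists>D. ((\<lambda>z. f z + g z) has_derivative D) (at z) \<and> (\<forall>c v. D (c *s v) = c * D v)"
    by (intro exI[of _ "\<lambda>v. D v + E v"]) (auto intro: has_derivative_add simp: algebra_simps)
qed

lemma entire_mult: "entire f \<Longrightarrow> entire g \<Longrightarrow> entire (\<lambda>z. f z * g z)"
proof (rule entireI)
  fix z assume "entire f" "entire g"
  then obtain D E where "(f has_derivative D) (at z)" "\<And>c v. D (c *s v) = c * D v"
    "(g has_derivative E) (at z)" "\<And>c v. E (c *s v) = c * E v"
    by (metis entireE)
  then show "\<exists>D. ((\<lambda>z. f z * g z) has_derivative D) (at z) \<and> (\<forall>c v. D (c *s v) = c * D v)"
    by (intro exI[of _ "\<lambda>v. f z * E v + D v * g z"] conjI has_derivative_mult)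
       (simp_all add: algebra_simps)
qed

lemma entire_sum: "finite A \<Longrightarrow> (\<And>i. i \<in> A \<Longrightarrow> entire (f i)) \<Longrightarrow> entire (\<lambda>z. \<Sum>i\<in>A. f i z)"
  by (induction A rule: finite_induct) (simp_all add: entire_const entire_add)

lemma entire_prod: "finite A \<Longrightarrow> (\<And>i. i \<in> A \<Longrightarrow> entire (f i)) \<Longrightarrow> entire (\<lambda>z. \<Prod>i\<in>A. f i z)"
  by (induction A rule: finite_induct) (simp_all add: entire_const entire_mult)

lemma entire_power: "entire f \<Longrightarrow> entire (\<lambda>z. f z ^ n)"
  by (induction n) (simp_all add: entire_const entire_mult)

lemma entire_compose_field:
  assumes f: "entire f" and g: "\<And>z. (g has_field_derivative g' z) (at z)"
  shows "entire (\<lambda>z. g (f z))"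
proof (rule entireI)
  fix z
  obtain D where D: "(f has_derivative D) (at z)" "\<And>c v. D (c *s v) = c * D v"
    using f unfolding entire_def by blast
  have "((\<lambda>z. g (f z)) has_derivative (\<lambda>v. g' (f z) * D v)) (at z)"
    using has_derivative_compose[OF D(1), of g "(*) (g' (f z))"] g[of "f z"]
    by (simp add: has_field_derivative_def)
  then show "\<exists>D. ((\<lambda>z. g (f z)) has_derivative D) (at z) \<and> (\<forall>c v. D (c *s v) = c * D v)"
    by (intro exI[of _ "\<lambda>v. g' (f z) * D v"]) (auto simp: D(2))
qed

lemma entire_exp: "entire f \<Longrightarrow> entire (\<lambda>z. exp (f z))"
  by (rule entire_compose_field[where g' = exp]) (auto intro: DERIV_exp)

lemma entire_compose_linear:
  assumes f: "entire f" and L: "linear L" "\<And>c v. L (c *s v) = c *s L v"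
  shows "entire (\<lambda>z. f (L z + a))"
proof (rule entireI)
  fix z
  obtain D where D: "(f has_derivative D) (at (L z + a))" "\<And>c v. D (c *s v) = c * D v"
    using f unfolding entire_def by blast
  have "((\<lambda>z. L z + a) has_derivative L) (at z)"
    using L(1) by (auto intro!: derivative_eq_intros bounded_linear_imp_has_derivative
        simp: linear_conv_bounded_linear)
  from has_derivative_compose[OF this D(1)]
  show "\<exists>D. ((\<lambda>z. f (L z + a)) has_derivative D) (at z) \<and> (\<forall>c v. D (c *s v) = c * D v)"
    by (intro exI[of _ "\<lambda>v. D (L v)"]) (auto simp: D(2) L(2))
qed

text \<open>Restriction to complex lines is the bridge to one variable: Cauchy's formula and
  analytic continuation are both applied along such lines.\<close>

lemma entire_line_holomorphic:
  fixes a b :: "complex^'m"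
  assumes f: "entire f"
  shows "(\<lambda>\<zeta>. f (a + \<zeta> *s b)) holomorphic_on UNIV"
  unfolding holomorphic_on_def field_differentiable_def
proof
  fix \<zeta> :: complex
  obtain D where D: "(f has_derivative D) (at (a + \<zeta> *s b))" "\<And>c v. D (c *s v) = c * D v"
    using f unfolding entire_def by blast
  have l: "bounded_linear (\<lambda>\<zeta>::complex. \<zeta> *s b)"
  proof -
    have "linear (\<lambda>\<zeta>::complex. \<zeta> *s b)"
      by (rule linearI) (auto simp: vec_eq_iff algebra_simps)
    then show ?thesis by (simp add: linear_conv_bounded_linear)
  qed
  have "((\<lambda>\<zeta>. a + \<zeta> *s b) has_derivative (\<lambda>\<zeta>. \<zeta> *s b)) (at \<zeta>)"
    by (auto intro!: derivative_eq_intros bounded_linear_imp_has_derivative[OF l])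
  from has_derivative_compose[OF this D(1)]
  have "((\<lambda>\<zeta>. f (a + \<zeta> *s b)) has_derivative (\<lambda>h. h * D b)) (at \<zeta>)" by (simp add: D(2))
  then have "((\<lambda>\<zeta>. f (a + \<zeta> *s b)) has_field_derivative D b) (at \<zeta>)"
    unfolding has_field_derivative_def
    by (rule has_derivative_eq_rhs) (simp add: fun_eq_iff mult.commute)
  then show "\<exists>f'. ((\<lambda>\<zeta>. f (a + \<zeta> *s b)) has_field_derivative f') (at \<zeta> within UNIV)" by auto
qed

section \<open>The Hermitian form and functions of exponential type\<close>

lemma hermitian_dot_add: "hermitian_dot (z + z') w = hermitian_dot z w + hermitian_dot z' w"
  by (simp add: hermitian_dot_def distrib_right sum.distrib)

lemma hermitian_dot_scale: "hermitian_dot (c *s z) w = c * hermitian_dot z w"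
  by (simp add: hermitian_dot_def sum_distrib_left mult.assoc)

lemma cnj_hermitian_dot: "cnj (hermitian_dot z w) = hermitian_dot w z"
  by (simp add: hermitian_dot_def mult.commute)

lemma Re_hermitian_dot: "Re (hermitian_dot z w) = z \<bullet> w"
  by (simp add: hermitian_dot_def inner_vec_def inner_complex_def)

lemma cmod_hermitian_dot_le: "cmod (hermitian_dot z w) \<le> norm z * norm w"
proof -
  have "cmod (hermitian_dot z w) \<le> (\<Sum>j\<in>UNIV. \<bar>cmod (z $ j)\<bar> * \<bar>cmod (w $ j)\<bar>)"
    unfolding hermitian_dot_def by (rule sum_norm_le) (simp add: norm_mult)
  also have "\<dots> \<le> norm z * norm w"
    unfolding norm_vec_def by (rule L2_set_mult_ineq)
  finally show ?thesis .
qed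

lemma entire_hermitian_dot: "entire (\<lambda>z. hermitian_dot z w)"
  unfolding hermitian_dot_def
  by (intro entire_sum entire_mult entire_component entire_const finite)

lemma hermitian_dot_self: "hermitian_dot z z = complex_of_real ((norm z)\<^sup>2)"
proof -
  have "Im (hermitian_dot z z) = 0" using cnj_hermitian_dot[of z z] by (metis Reals_cnj_iff complex_is_Real_iff)
  then show ?thesis by (simp add: complex_eq_iff Re_hermitian_dot power2_norm_eq_inner)
qed

text \<open>A class closed under products that contains coordinates, monomials and kernels. Gaussian
  square integrability is automatic in it, so membership in the Fock space reduces to being
  entire.\<close>

definition exp_type :: "(complex^'m \<Rightarrow> complex) \<Rightarrow> bool" where
  "exp_type f \<longleftrightarrow> (\<exists>C R. \<forall>z. cmod (f z) \<le> C * exp (R * norm z))"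

lemma exp_typeI: "(\<And>z. cmod (f z) \<le> C * exp (R * norm z)) \<Longrightarrow> exp_type f"
  unfolding exp_type_def by blast

lemma exp_type_const: "exp_type (\<lambda>_. a)"
  by (rule exp_typeI[where C = "cmod a" and R = 0]) simp

lemma exp_type_mult:
  assumes "exp_type f" "exp_type g"
  shows "exp_type (\<lambda>z. f z * g z)"
proof -
  obtain C R C' R' where f: "\<And>z. cmod (f z) \<le> C * exp (R * norm z)"
    and g: "\<And>z. cmod (g z) \<le> C' * exp (R' * norm z)"
    using assms unfolding exp_type_def by metis
  show ?thesis
  proof (rule exp_typeI)
    fix z
    have "cmod (f z * g z) \<le> (C * exp (R * norm z)) * (C' * exp (R' * norm z))"
      unfolding norm_mult by (intro mult_mono f g order_trans[OF norm_ge_zero f] norm_ge_zero)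
    then show "cmod (f z * g z) \<le> (C * C') * exp ((R + R') * norm z)"
      unfolding distrib_right exp_add by (simp add: mult_ac)
  qed
qed

lemma exp_type_prod: "finite A \<Longrightarrow> (\<And>i. i \<in> A \<Longrightarrow> exp_type (f i)) \<Longrightarrow> exp_type (\<lambda>z. \<Prod>i\<in>A. f i z)"
  by (induction A rule: finite_induct) (simp_all add: exp_type_const exp_type_mult)

lemma exp_type_power: "exp_type f \<Longrightarrow> exp_type (\<lambda>z. f z ^ n)"
  by (induction n) (simp_all add: exp_type_const exp_type_mult)

lemma exp_type_component: "exp_type (\<lambda>z. z $ j)"
proof (rule exp_typeI)
  fix z :: "complex^'a"
  have "cmod (z $ j) \<le> norm z" by (rule Finite_Cartesian_Product.norm_nth_le)
  also have "\<dots> \<le> exp (norm z)" using exp_ge_add_one_self[of "norm z"] by linarith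
  finally show "cmod (z $ j) \<le> 1 * exp (1 * norm z)" by simp
qed

lemma exp_type_kernel: "exp_type (\<lambda>z. exp (hermitian_dot z w))"
proof (rule exp_typeI)
  fix z
  have "cmod (exp (hermitian_dot z w)) \<le> exp (cmod (hermitian_dot z w))" by (rule norm_exp)
  also have "\<dots> \<le> 1 * exp (norm w * norm z)"
    using cmod_hermitian_dot_le[of z w] by (simp add: mult.commute)
  finally show "cmod (exp (hermitian_dot z w)) \<le> 1 * exp (norm w * norm z)" .
qed

lemma exp_type_L2:
  assumes f: "exp_type f" "f \<in> borel_measurable borel"
  shows "f \<in> vecs (L2_space gauss)"
proof -
  obtain C R where C: "\<And>z. cmod (f z) \<le> C * exp (R * norm z)"
    using f(1) unfolding exp_type_def by blast
  have "integrable gauss (\<lambda>z. (cmod (f z))\<^sup>2)"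
  proof (rule Bochner_Integration.integrable_bound)
    show "integrable gauss (\<lambda>z::complex^'a. C\<^sup>2 * exp ((2 * R) * norm z))"
      by (intro integrable_mult_right integrable_gauss_exp_norm)
    have "(cmod (f z))\<^sup>2 \<le> C\<^sup>2 * exp ((2 * R) * norm z)" for z
      using power_mono[OF C[of z] norm_ge_zero, of 2]
      by (simp add: power_mult_distrib exp_double[symmetric] mult_ac)
    then show "AE z in gauss. norm ((cmod (f z))\<^sup>2) \<le> norm (C\<^sup>2 * exp ((2 * R) * norm z))" by simp
    show "(\<lambda>z. (cmod (f z))\<^sup>2) \<in> borel_measurable gauss" using f(2) by measurable
  qed
  then show ?thesis using f(2) by (simp add: L2_vecs measurable_cong_sets[OF sets_gauss refl])
qed

lemma exp_norm_L2: "(\<lambda>z. complex_of_real (exp (R * norm z))) \<in> vecs (L2_space gauss)"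
  by (rule exp_type_L2) (auto intro: exp_typeI[of _ 1 R])

lemma fock_iff: "f \<in> fock \<longleftrightarrow> entire f \<and> f \<in> vecs (L2_space gauss)"
proof (cases "entire f")
  case True
  then have [measurable]: "f \<in> borel_measurable borel" by (rule entire_measurable)
  have "integrable gauss (\<lambda>z. (cmod (f z))\<^sup>2) \<longleftrightarrow>
      integrable lborel (\<lambda>z. (1 / pi ^ CARD('a)) * ((cmod (f z))\<^sup>2 * exp (- (norm z)\<^sup>2)))"
    by (subst integrable_gauss) (auto simp: gauss_density_def mult_ac)
  also have "\<dots> \<longleftrightarrow> integrable lborel (\<lambda>z. (cmod (f z))\<^sup>2 * exp (- (norm z)\<^sup>2))"
    by (subst integrable_mult_left_iff) simp
  finally show ?thesis using True
    by (auto simp: fock_def L2_vecs measurable_cong_sets[OF sets_gauss refl])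
qed (simp add: fock_def)

lemma fock_L2: "f \<in> fock \<Longrightarrow> f \<in> vecs (L2_space gauss)"
  by (simp add: fock_iff)

lemma fockI: "entire f \<Longrightarrow> exp_type f \<Longrightarrow> f \<in> fock"
  by (simp add: fock_iff exp_type_L2 entire_measurable)

section \<open>The reproducing property\<close>

text \<open>Cauchy's formula at the centre of the unit circle in the complex line through z. The
  parameter is integrated against a probability measure, in view of Fubini with
  \<open>gauss\<close>.\<close>

lemma entire_circle_mean:
  fixes g :: "complex^'m \<Rightarrow> complex"
  assumes g: "entire g"
  shows "(LINT x|density lborel (indicator {0..1::real}). g (exp (2 * of_real pi * \<i> * of_real x) *s z)) = g 0"
proof -
  define h where "h x = g (exp (2 * of_real pi * \<i> * of_real x) *s z)" for x :: real
  have hol: "(\<lambda>\<zeta>. g (\<zeta> *s z)) holomorphic_on cball 0 1"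
    using holomorphic_on_subset[OF entire_line_holomorphic[OF g, of 0 z] subset_UNIV] by simp
  have "((\<lambda>u. g (u *s z) / (u - 0)) has_contour_integral (2 * of_real pi * \<i> * g (0 *s z))) (circlepath 0 1)"
    by (rule Cauchy_integral_circlepath_simple[OF hol]) simp
  then have "((\<lambda>x. (2 * of_real pi * \<i>) * h x) has_integral (2 * of_real pi * \<i> * g 0)) {0..1}"
    unfolding has_contour_integral vector_derivative_circlepath
    by (rule has_integral_eq_rhs[OF has_integral_eq[rotated]]) (simp_all add: circlepath h_def)
  then have "(h has_integral g 0) {0..1}"
    using has_integral_mult_right[of "\<lambda>x. (2 * of_real pi * \<i>) * h x" "2 * of_real pi * \<i> * g 0" "{0..1}" "1 / (2 * of_real pi * \<i>)"]
    by simp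
  then have I: "integral {0..1} h = g 0" by (rule integral_unique)
  have "continuous_on {0..1} h"
    unfolding h_def
    by (rule continuous_on_compose2[OF entire_continuous_on[OF g, of UNIV]])
       (auto simp: vector_scalar_mult_def intro!: continuous_intros)
  then have "set_integrable lborel {0..1} h" by (rule borel_integrable_atLeastAtMost')
  then have "(LINT x:{0..1}|lborel. h x) = integral {0..1} h" by (rule set_borel_integral_eq_integral(2))
  moreover have "(LINT x|density lborel (indicator {0..1::real}). h x) = (LINT x:{0..1}|lborel. h x)"
  proof -
    have [measurable]: "h \<in> borel_measurable borel"
      unfolding h_def
      by (intro borel_measurable_continuous_onI continuous_on_compose2[OF entire_continuous_on[OF g, of UNIV]])
         (auto simp: vector_scalar_mult_def intro!: continuous_intros)
    have "density lborel (indicator {0..1::real}) = density lborel (\<lambda>x. ennreal (indicator {0..1} x))"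
      by (simp add: ennreal_indicator)
    then show ?thesis
      unfolding set_lebesgue_integral_def by (simp only:) (subst integral_density, auto)
  qed
  ultimately show ?thesis using I by (simp add: h_def)
qed

lemma norm_scalar_mult: "norm (c *s z) = cmod c * norm (z :: complex^'m)"
  unfolding norm_vec_def by (simp add: norm_mult L2_set_right_distrib)

text \<open>The Gaussian is invariant under z -> \<rho> z for |\<rho>| = 1, so the integral equals
  its average over the circle. After Fubini the inner integral is a circle mean, which is g 0 for
  every z. Fubini applies because the integral of the norm over z does not depend on the
  rotation.\<close>

lemma gauss_mean_value:
  fixes g :: "complex^'m \<Rightarrow> complex"
  assumes g: "entire g" and int: "integrable gauss g"
  shows "(LINT z|gauss. g z) = g 0"
proof -
  define \<nu> where "\<nu> = (density lborel (indicator {0..1}) :: real measure)"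
  define \<rho> where "\<rho> x = exp (2 * of_real pi * \<i> * of_real x)" for x :: real
  have rho: "cmod (\<rho> x) = 1" for x by (simp add: \<rho>_def)
  have sets_nu [measurable_cong, simp]: "sets \<nu> = sets borel" by (simp add: \<nu>_def)
  interpret nu: prob_space \<nu>
    by standard (simp add: \<nu>_def emeasure_density)
  interpret P: pair_sigma_finite \<nu> "gauss :: (complex^'m) measure" ..
  have rot: "distr gauss borel (\<lambda>z. \<rho> x *s z) = (gauss :: (complex^'m) measure)" for x
  proof (rule distr_gauss_isometry)
    show "linear (\<lambda>z::complex^'m. \<rho> x *s z)"
      by (rule linearI) (auto simp: vec_eq_iff algebra_simps)
    have "\<rho> x \<noteq> 0" using rho[of x] by auto
    then show "\<rho> x *s (inverse (\<rho> x) *s z) = z" for z :: "complex^'m"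
      by (simp add: vec_eq_iff)
    show "norm (\<rho> x *s z) = norm z" for z :: "complex^'m" by (simp add: norm_scalar_mult rho)
  qed
  have gm [measurable]: "g \<in> borel_measurable borel" by (rule entire_measurable[OF g])
  have rm [measurable]: "(\<lambda>z::complex^'m. \<rho> x *s z) \<in> borel_measurable borel" for x
    by (intro borel_measurable_continuous_onI) (auto simp: vector_scalar_mult_def intro!: continuous_intros)
  have ri: "(LINT z|gauss. f (\<rho> x *s z)) = (LINT z|gauss. f z)"
    if "f \<in> borel_measurable borel" for x and f :: "complex^'m \<Rightarrow> 'b::{banach, second_countable_topology}"
  proof -
    have "(LINT z|gauss. f z) = (LINT z|distr gauss borel (\<lambda>z. \<rho> x *s z). f z)" by (simp add: rot)
    also have "\<dots> = (LINT z|gauss. f (\<rho> x *s z))" by (rule integral_distr) (use that rm in auto)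
    finally show ?thesis by simp
  qed
  have gint: "integrable gauss (\<lambda>z. g (\<rho> x *s z))" for x
  proof -
    have "integrable (distr gauss borel (\<lambda>z. \<rho> x *s z)) g" using int by (simp add: rot)
    then show ?thesis by (subst (asm) integrable_distr_eq) (use rm gm in auto)
  qed
  have "continuous_on UNIV (\<lambda>p. g (\<rho> (fst p) *s snd p))"
    unfolding \<rho>_def
    by (rule continuous_on_compose2[OF entire_continuous_on[OF g, of UNIV]])
       (auto simp: vector_scalar_mult_def intro!: continuous_intros)
  then have "(\<lambda>p. g (\<rho> (fst p) *s snd p)) \<in> borel_measurable (borel \<Otimes>\<^sub>M borel)"
    unfolding borel_prod by (rule borel_measurable_continuous_onI)
  then have m: "(\<lambda>(x, z). g (\<rho> x *s z)) \<in> borel_measurable (\<nu> \<Otimes>\<^sub>M gauss)"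
    by (subst measurable_cong_sets[OF sets_pair_measure_cong[OF sets_nu sets_gauss] refl])
       (simp add: case_prod_unfold)
  have pint: "integrable (\<nu> \<Otimes>\<^sub>M gauss) (\<lambda>(x, z). g (\<rho> x *s z))"
  proof (rule P.Fubini_integrable[OF m])
    have "(LINT z|gauss. norm (g (\<rho> x *s z))) = (LINT z|gauss. norm (g z))" for x
      by (rule ri[of "\<lambda>z. norm (g z)"]) measurable
    then show "integrable \<nu> (\<lambda>x. LINT z|gauss. norm (case (x, z) of (x, z) \<Rightarrow> g (\<rho> x *s z)))"
      by simp
    show "AE x in \<nu>. integrable gauss (\<lambda>z. case (x, z) of (x, z) \<Rightarrow> g (\<rho> x *s z))"
      using gint by simp
  qed
  have "(LINT z|gauss. g z) = (LINT x|\<nu>. LINT z|gauss. g (\<rho> x *s z))"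
    by (simp add: ri[OF gm] nu.prob_space)
  also have "\<dots> = (LINT z|gauss. LINT x|\<nu>. g (\<rho> x *s z))"
    by (rule P.Fubini_integral[OF pint, symmetric])
  also have "\<dots> = (LINT z|(gauss :: (complex^'m) measure). g 0)"
    unfolding \<nu>_def \<rho>_def entire_circle_mean[OF g] ..
  also have "\<dots> = g 0" by (simp add: gauss.prob_space[unfolded space_gauss])
  finally show ?thesis .
qed

text \<open>The parameter comes first, so that \<open>kernel w\<close> is the function K(., w). It
  is holomorphic in z, while w enters conjugated.\<close>

definition kernel :: "complex^'m \<Rightarrow> complex^'m \<Rightarrow> complex" where
  "kernel w z = exp (hermitian_dot z w)"

lemma kernel_fock: "kernel w \<in> fock"
  unfolding kernel_def
  by (intro fockI entire_exp entire_hermitian_dot exp_type_kernel)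

text \<open>Shift the Gaussian by w. Of the weight exp (-2 Re (z . w) - |w|^2), the part that is
  constant or conjugate linear in z cancels against the conjugated kernel, leaving exp (- z . w) f
  (z + w). This is entire, so its Gaussian mean is its value f w at 0.\<close>

lemma fock_reproducing:
  assumes f: "f \<in> fock"
  shows "ip (L2_space gauss) f (kernel w) = f w"
proof -
  define F where "F z = f z * cnj (kernel w z)" for z
  have ef: "entire f" using f by (simp add: fock_iff)
  have [measurable]: "f \<in> borel_measurable borel" "kernel w \<in> borel_measurable borel"
    using f kernel_fock[of w] by (auto simp: fock_iff entire_measurable)
  have cm: "cnj \<in> borel_measurable borel"
    by (intro borel_measurable_continuous_onI continuous_intros)
  have Fm: "F \<in> borel_measurable borel"
    unfolding F_def by (intro borel_measurable_times measurable_compose[OF _ cm]) measurable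
  have Fi: "integrable gauss F"
    unfolding F_def by (intro L2_integrable_mult fock_L2 f kernel_fock)
  define g where "g z = exp (- hermitian_dot z w) * f (z + w)" for z
  have g_eq: "complex_of_real (exp (- 2 * (z \<bullet> w) - (norm w)\<^sup>2)) * F (z + w) = g z" for z
  proof -
    have "complex_of_real (exp (- 2 * (z \<bullet> w) - (norm w)\<^sup>2)) =
        exp (- (hermitian_dot z w + hermitian_dot w z) - hermitian_dot w w)"
      unfolding hermitian_dot_self Re_hermitian_dot[symmetric] cnj_hermitian_dot[of z w, symmetric]
        complex_add_cnj
      by (simp add: exp_of_real[symmetric])
    moreover have hd_add: "hermitian_dot w (z + w) = hermitian_dot w z + hermitian_dot w w"
      by (simp add: hermitian_dot_def distrib_left sum.distrib)
    ultimately have "complex_of_real (exp (- 2 * (z \<bullet> w) - (norm w)\<^sup>2)) * F (z + w) =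
        exp (- (hermitian_dot z w + hermitian_dot w z) - hermitian_dot w w) *
          (exp (hermitian_dot w z + hermitian_dot w w) * f (z + w))"
      by (simp add: F_def kernel_def exp_cnj cnj_hermitian_dot hd_add)
    then show ?thesis
      by (simp add: g_def mult.assoc[symmetric] exp_add[symmetric])
  qed
  have ge: "entire g"
  proof -
    have "entire (\<lambda>z. f (id z + w))"
      by (rule entire_compose_linear[OF ef]) (auto intro: linearI)
    moreover have "entire (\<lambda>z. exp (- 1 * hermitian_dot z w))"
      by (intro entire_exp entire_mult entire_const entire_hermitian_dot)
    ultimately show ?thesis unfolding g_def using entire_mult by fastforce
  qed
  have "ip (L2_space gauss) f (kernel w) = (LINT z|gauss. F z)" by (simp add: L2_ip F_def)
  also have "\<dots> = (LINT z|gauss. g z)"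
    unfolding integral_gauss_translation[OF Fm, of w] g_eq ..
  also have "\<dots> = g 0"
    by (rule gauss_mean_value[OF ge]) (use integrable_gauss_translation[OF Fm Fi, of w] g_eq in simp)
  also have "\<dots> = f w" by (simp add: g_def hermitian_dot_def)
  finally show ?thesis .
qed

section \<open>Completeness of the Fock space\<close>

interpretation L2g: hilbert_space "L2_space (gauss :: (complex^'m) measure)"
  by standard (rule hilbert_L2)

lemma kernel_L2: "kernel w \<in> vecs (L2_space gauss)"
  by (rule fock_L2[OF kernel_fock])

lemma exp_remainder: "cmod (exp \<eta> - 1 - \<eta>) \<le> (cmod \<eta>)\<^sup>2 * exp (cmod \<eta>)"
  using Taylor_exp_field[of \<eta> 1] by (simp add: power2_eq_square diff_diff_eq mult.commute)

lemma integrable_mult_exp_norm: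
  assumes "F \<in> vecs (L2_space gauss)"
  shows "integrable gauss (\<lambda>z. cmod (F z) * exp (R * norm z))"
proof -
  have "integrable gauss (\<lambda>z. cmod (F z * cnj (complex_of_real (exp (R * norm z)))))"
    by (intro integrable_norm L2_integrable_mult assms exp_norm_L2)
  then show ?thesis by (simp add: norm_mult)
qed

text \<open>The projection of L^2 onto its entire part. F itself is merely measurable; w enters only
  through the conjugated kernel exp (w . z), which is holomorphic in w, and an explicit quadratic
  remainder justifies differentiation under the integral.\<close>

lemma entire_projection:
  fixes F :: "complex^'m \<Rightarrow> complex"
  assumes F: "F \<in> vecs (L2_space gauss)"
  shows "entire (\<lambda>w. ip (L2_space gauss) F (kernel w))"
proof (rule entireI)
  fix w :: "complex^'m"
  have Fm [measurable]: "F \<in> borel_measurable borel"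
    using F by (simp add: L2_vecs measurable_cong_sets[OF sets_gauss refl])
  have hm [measurable]: "(\<lambda>z. hermitian_dot v z) \<in> borel_measurable borel" for v :: "complex^'m"
    unfolding hermitian_dot_def
    by (intro borel_measurable_continuous_onI continuous_intros)
  have ker: "cnj (kernel w z) = exp (hermitian_dot w z)" for w z :: "complex^'m"
    by (simp add: kernel_def exp_cnj cnj_hermitian_dot)
  define P where "P w = (LINT z|gauss. F z * exp (hermitian_dot w z))" for w
  have P: "ip (L2_space gauss) F (kernel w) = P w" for w by (simp add: L2_ip ker P_def)
  have Pint: "integrable gauss (\<lambda>z. F z * exp (hermitian_dot w z))" for w
    using L2_integrable_mult[OF F kernel_L2[of w]] by (simp add: ker)
  define D where "D v = (LINT z|gauss. F z * exp (hermitian_dot w z) * hermitian_dot v z)" for v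
  have kb: "cmod (exp (hermitian_dot w z)) \<le> exp (norm w * norm z)" for z
    using norm_exp[of "hermitian_dot w z"] cmod_hermitian_dot_le[of w z] order_trans by fastforce
  have Db: "cmod (F z * exp (hermitian_dot w z) * hermitian_dot v z) \<le>
      norm v * (cmod (F z) * exp ((norm w + 1) * norm z))" for v z
  proof -
    have "norm z \<le> exp (norm z)" using exp_ge_add_one_self[of "norm z"] by linarith
    then have "cmod (hermitian_dot v z) \<le> norm v * exp (norm z)"
      using cmod_hermitian_dot_le[of v z] by (meson mult_left_mono norm_ge_zero order_trans)
    then have "cmod (exp (hermitian_dot w z)) * cmod (hermitian_dot v z) \<le>
        exp (norm w * norm z) * (norm v * exp (norm z))"
      by (intro mult_mono kb) auto
    also have "\<dots> = norm v * exp ((norm w + 1) * norm z)"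
      by (simp add: distrib_right exp_add)
    finally have "cmod (F z) * (cmod (exp (hermitian_dot w z)) * cmod (hermitian_dot v z)) \<le>
        cmod (F z) * (norm v * exp ((norm w + 1) * norm z))"
      by (rule mult_left_mono) simp
    then show ?thesis by (simp add: norm_mult mult_ac)
  qed
  have Dint: "integrable gauss (\<lambda>z. F z * exp (hermitian_dot w z) * hermitian_dot v z)" for v
  proof (rule Bochner_Integration.integrable_bound)
    show "integrable gauss (\<lambda>z. norm v * (cmod (F z) * exp ((norm w + 1) * norm z)))"
      by (intro integrable_mult_right integrable_mult_exp_norm F)
    show "AE z in gauss. norm (F z * exp (hermitian_dot w z) * hermitian_dot v z) \<le>
        norm (norm v * (cmod (F z) * exp ((norm w + 1) * norm z)))"
      using Db by simp
  qed measurable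
  have Dscale: "D (c *s v) = c * D v" for c v
    unfolding D_def hermitian_dot_scale by (simp add: mult.left_commute[of _ c])
  have Dlin: "bounded_linear D"
  proof (rule bounded_linear_intro)
    show "D (u + v) = D u + D v" for u v
      unfolding D_def hermitian_dot_add distrib_left
      by (rule Bochner_Integration.integral_add[OF Dint Dint])
    show "D (r *\<^sub>R v) = r *\<^sub>R D v" for r v
    proof -
      have "r *\<^sub>R v = complex_of_real r *s v"
        by (simp add: vec_eq_iff scaleR_conv_of_real[where 'a = complex])
      then show ?thesis using Dscale[of "complex_of_real r" v] by (simp add: scaleR_conv_of_real)
    qed
    show "norm (D v) \<le> norm v * (LINT z|gauss. cmod (F z) * exp ((norm w + 1) * norm z))" for v
    proof -
      have "norm (D v) \<le> (LINT z|gauss. norm (F z * exp (hermitian_dot w z) * hermitian_dot v z))"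
        unfolding D_def by (rule integral_norm_bound)
      also have "\<dots> \<le> (LINT z|gauss. norm v * (cmod (F z) * exp ((norm w + 1) * norm z)))"
        by (intro integral_mono integrable_norm Dint Db integrable_mult_right integrable_mult_exp_norm F)
      finally show ?thesis by simp
    qed
  qed
  \<comment> \<open>Of the added 3, two come from t^2 \<le> exp (2 t) and one from exp |v . z| \<le>
    exp t, which uses norm v \<le> 1.\<close>
  define K where "K = (LINT z|gauss. cmod (F z) * exp ((norm w + 3) * norm z))"
  have rem: "norm (P (w + v) - P w - D v) \<le> (norm v)\<^sup>2 * K" if v: "norm v \<le> 1" for v
  proof -
    define E where "E z = F z * exp (hermitian_dot w z) *
        (exp (hermitian_dot v z) - 1 - hermitian_dot v z)" for z
    have E_eq: "E z = F z * exp (hermitian_dot (w + v) z) - F z * exp (hermitian_dot w z) -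
        F z * exp (hermitian_dot w z) * hermitian_dot v z" for z
      by (simp add: E_def hermitian_dot_add exp_add algebra_simps)
    have Eint: "integrable gauss E"
      unfolding E_eq[abs_def] by (intro Bochner_Integration.integrable_diff Pint Dint)
    have "P (w + v) - P w - D v = (LINT z|gauss. E z)"
      unfolding E_eq P_def D_def
      by (simp add: Bochner_Integration.integral_diff Pint Dint Bochner_Integration.integrable_diff)
    also have "norm \<dots> \<le> (LINT z|gauss. norm (E z))" by (rule integral_norm_bound)
    also have "\<dots> \<le> (LINT z|gauss. (norm v)\<^sup>2 * (cmod (F z) * exp ((norm w + 3) * norm z)))"
    proof (intro integral_mono integrable_norm Eint integrable_mult_right integrable_mult_exp_norm F)
      fix z :: "complex^'m"
      define t where "t = norm z"
      have h1: "cmod (hermitian_dot v z) \<le> norm v * t" using cmod_hermitian_dot_le by (simp add: t_def)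
      have t0: "0 \<le> t" by (simp add: t_def)
      have h2: "cmod (hermitian_dot v z) \<le> t"
        using h1 mult_right_mono[OF v t0] by simp
      have t2: "t\<^sup>2 \<le> (exp t)\<^sup>2"
        using exp_ge_add_one_self[of t] t0 by (intro power_mono) linarith+
      have "cmod (exp (hermitian_dot v z) - 1 - hermitian_dot v z) \<le>
          (cmod (hermitian_dot v z))\<^sup>2 * exp (cmod (hermitian_dot v z))" by (rule exp_remainder)
      also have "\<dots> \<le> (norm v * t)\<^sup>2 * exp t"
        using h1 h2 by (intro mult_mono power_mono) auto
      also have "\<dots> \<le> ((norm v)\<^sup>2 * (exp t)\<^sup>2) * exp t"
        using t2 by (intro mult_right_mono) (auto simp: power_mult_distrib intro: mult_left_mono)
      finally have "cmod (exp (hermitian_dot w z)) * cmod (exp (hermitian_dot v z) - 1 - hermitian_dot v z)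
          \<le> exp (norm w * t) * (((norm v)\<^sup>2 * (exp t)\<^sup>2) * exp t)"
        using kb[of z] by (intro mult_mono) (auto simp: t_def)
      also have "\<dots> = (norm v)\<^sup>2 * exp ((norm w + 3) * t)"
      proof -
        have "(norm w + 3) * t = norm w * t + (t + t) + t" by (simp add: algebra_simps)
        then show ?thesis by (simp only: exp_add power2_eq_square mult_ac)
      qed
      finally have "cmod (F z) * (cmod (exp (hermitian_dot w z)) * cmod (exp (hermitian_dot v z) - 1 - hermitian_dot v z))
          \<le> cmod (F z) * ((norm v)\<^sup>2 * exp ((norm w + 3) * t))"
        by (rule mult_left_mono) simp
      then show "norm (E z) \<le> (norm v)\<^sup>2 * (cmod (F z) * exp ((norm w + 3) * norm z))"
        by (simp add: E_def norm_mult mult_ac t_def)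
    qed
    also have "\<dots> = (norm v)\<^sup>2 * K" by (simp add: K_def)
    finally show ?thesis .
  qed
  have "(P has_derivative D) (at w)"
  proof (rule has_derivativeI_sandwich[of 1 D UNIV w P "\<lambda>y. norm (y - w) * K"])
    fix y assume y: "y \<noteq> w" "dist y w < 1"
    have "norm (P y - P w - D (y - w)) \<le> (norm (y - w))\<^sup>2 * K"
      using rem[of "y - w"] y by (simp add: dist_norm)
    then show "norm (P y - P w - D (y - w)) / norm (y - w) \<le> norm (y - w) * K"
      using y by (simp add: divide_le_eq power2_eq_square mult_ac)
  next
    have "((\<lambda>y. norm (y - w) * K) \<longlongrightarrow> norm (w - w) * K) (at w)" by (intro tendsto_intros)
    then show "((\<lambda>y. norm (y - w) * K) \<longlongrightarrow> 0) (at w)" by simp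
  qed (use Dlin in auto)
  then show "\<exists>D. ((\<lambda>w. ip (L2_space gauss) F (kernel w)) has_derivative D) (at w) \<and> (\<forall>c v. D (c *s v) = c * D v)"
    unfolding P using Dscale by blast
qed

definition fock_space :: "(complex^'m) ipspace" where
  "fock_space = \<lparr>vecs = fock, ip = ip (L2_space gauss)\<rparr>"

lemma fock_space_simps [simp]:
  "vecs fock_space = fock" "ip fock_space = ip (L2_space gauss)" "nrm fock_space = nrm (L2_space gauss)"
  by (simp_all add: fock_space_def nrm_def fun_eq_iff)

text \<open>The L^2 limit F need not be an entire representative, but its projection f is entire.
  Point evaluation is the inner product with a kernel, so X n converges to f everywhere; hence f is
  itself a limit in norm.\<close>

lemma fock_complete:
  assumes X: "cauchy_in fock_space X"
  shows "\<exists>f\<in>fock. (\<lambda>n. nrm (L2_space gauss) (\<lambda>z. X n z - f z)) \<longlonglongrightarrow> 0"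
proof -
  have Xf: "X n \<in> fock" for n using X by (simp add: cauchy_in_def)
  have cX: "cauchy_in (L2_space gauss) X"
    using X by (auto simp: cauchy_in_def fock_L2)
  then obtain F where F: "F \<in> vecs (L2_space gauss)"
    and lim: "(\<lambda>n. nrm (L2_space gauss) (\<lambda>z. X n z - F z)) \<longlonglongrightarrow> 0"
    using L2_complete by blast
  define f where "f w = ip (L2_space gauss) F (kernel w)" for w
  have ef: "entire f" unfolding f_def[abs_def] by (rule entire_projection[OF F])
  have "(\<lambda>n. X n w) \<longlonglongrightarrow> f w" for w
    using L2g.ip_tendsto_left[OF fock_L2[OF Xf] F kernel_L2 lim, of w]
    by (simp add: fock_reproducing Xf f_def)
  then have ae: "AE z in gauss. (\<lambda>k. X k z) \<longlonglongrightarrow> f z" by simp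
  have fm: "f \<in> borel_measurable gauss"
    using entire_measurable[OF ef] by (simp add: measurable_cong_sets[OF sets_gauss refl])
  from L2_limit_of_AE[OF cX filterlim_ident ae fm] ef show ?thesis
    by (intro bexI[of _ f]) (simp_all add: fock_iff)
qed

lemma fock_add: "f \<in> fock \<Longrightarrow> g \<in> fock \<Longrightarrow> (\<lambda>z. f z + g z) \<in> fock"
  by (simp add: fock_iff entire_add L2_add)

lemma fock_scale: "f \<in> fock \<Longrightarrow> (\<lambda>z. a * f z) \<in> fock"
  by (simp add: fock_iff entire_mult entire_const L2_scale)

lemma fock_const: "(\<lambda>_. a) \<in> fock"
  by (intro fockI entire_const exp_type_const)

lemma hilbert_fock: "hilbert fock_space"
  unfolding hilbert_def fock_space_simps
  using fock_complete
  by (auto simp: fock_const fock_add fock_scale fock_L2 L2g.ip_add_left L2g.ip_scale_left L2g.ip_nonneg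
      intro: L2g.ip_commute)

lemma fock_nrm_eq_0:
  assumes f: "f \<in> fock" and 0: "nrm (L2_space gauss) f = 0"
  shows "f = (\<lambda>_. 0)"
proof
  fix w
  have "cmod (f w) \<le> nrm (L2_space gauss) f * nrm (L2_space gauss) (kernel w)"
    using L2g.cauchy_schwarz[OF fock_L2[OF f] kernel_L2[of w]] by (simp add: fock_reproducing f)
  then show "f w = 0" using 0 by simp
qed

section \<open>The monomial basis\<close>

definition monomial :: "nat^'m \<Rightarrow> complex^'m \<Rightarrow> complex" where
  "monomial k z = (\<Prod>j\<in>UNIV. z $ j ^ (k $ j))"

lemma exp_type_hermitian_dot: "exp_type (\<lambda>z. hermitian_dot z w)"
proof (rule exp_typeI)
  fix z :: "complex^'a"
  have "norm z \<le> exp (norm z)" using exp_ge_add_one_self[of "norm z"] by linarith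
  then have "norm w * norm z \<le> norm w * exp (norm z)" by (rule mult_left_mono) simp
  then show "cmod (hermitian_dot z w) \<le> norm w * exp (1 * norm z)"
    using cmod_hermitian_dot_le[of z w] by (simp add: mult.commute)
qed

lemma exp_type_monomial: "exp_type (monomial k)"
  unfolding monomial_def[abs_def]
  by (intro exp_type_prod exp_type_power exp_type_component finite)

lemma monomial_fock: "monomial k \<in> fock"
proof (rule fockI[OF _ exp_type_monomial])
  show "entire (monomial k)"
    unfolding monomial_def[abs_def] by (intro entire_prod entire_power entire_component finite)
qed

lemma monomial_scale: "monomial k (\<chi> j. d $ j * z $ j) = monomial k d * monomial k z"
  by (simp add: monomial_def power_mult_distrib prod.distrib)

lemma monomial_mult_component:
  "z $ j * monomial k z = monomial (\<chi> i. if i = j then Suc (k $ i) else k $ i) z"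
proof -
  have "monomial (\<chi> i. if i = j then Suc (k $ i) else k $ i) z =
      (\<Prod>i\<in>UNIV. (if i = j then z $ j else 1) * z $ i ^ (k $ i))"
    unfolding monomial_def by (intro prod.cong) auto
  then show ?thesis by (simp add: prod.distrib monomial_def)
qed

lemma monomial_orthogonal:
  assumes "k \<noteq> l"
  shows "ip (L2_space gauss) (monomial k) (monomial l) = 0"
proof -
  obtain j where j: "k $ j \<noteq> l $ j" using assms by (auto simp: vec_eq_iff)
  \<comment> \<open>This angle makes the rotation of coordinate j multiply \<open>monomial k\<close>
    times the conjugate of \<open>monomial l\<close> by exp (i pi) = -1, so invariance of the
    Gaussian forces the integral to vanish.\<close>
  define \<theta> where "\<theta> = pi / (real (k $ j) - real (l $ j))"
  define d where "d = (\<chi> i. if i = j then cis \<theta> else 1)"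
  define T where "T = (\<lambda>z::complex^'a. \<chi> i. d $ i * z $ i)"
  have d1: "cmod (d $ i) = 1" for i by (simp add: d_def)
  have d0: "d $ i \<noteq> 0" for i using d1[of i] by auto
  have inv: "distr gauss borel T = gauss"
  proof (rule distr_gauss_isometry)
    show "linear T" unfolding T_def by (rule linearI) (auto simp: vec_eq_iff algebra_simps)
    show "T (\<chi> i. inverse (d $ i) * z $ i) = z" for z using d0 by (simp add: T_def vec_eq_iff)
    show "norm (T z) = norm z" for z by (simp add: T_def norm_vec_def norm_mult d1)
  qed
  have mono_d: "monomial m d = cis \<theta> ^ (m $ j)" for m
  proof -
    have "monomial m d = (\<Prod>i\<in>UNIV. if i = j then cis \<theta> ^ (m $ j) else 1)"
      unfolding monomial_def d_def by (intro prod.cong) auto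
    then show ?thesis by simp
  qed
  define h where "h z = monomial k z * cnj (monomial l z)" for z
  have hm: "h \<in> borel_measurable borel"
    unfolding h_def monomial_def by (intro borel_measurable_continuous_onI continuous_intros)
  have Tm: "T \<in> borel_measurable borel"
    unfolding T_def by (intro borel_measurable_continuous_onI continuous_intros)
  define q where "q = monomial k d * cnj (monomial l d)"
  have q: "q = -1"
  proof -
    have ne: "real (k $ j) - real (l $ j) \<noteq> 0" using j by simp
    have "q = cis (real (k $ j) * \<theta>) * cis (- (real (l $ j) * \<theta>))"
      unfolding q_def mono_d by (simp add: Complex.DeMoivre cis_cnj)
    also have "\<dots> = cis (\<theta> * (real (k $ j) - real (l $ j)))"
      by (simp add: cis_mult algebra_simps)
    also have "\<theta> * (real (k $ j) - real (l $ j)) = pi" using ne by (simp add: \<theta>_def)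
    finally show ?thesis by simp
  qed
  have "(LINT z|gauss. h z) = (LINT z|distr gauss borel T. h z)" by (simp add: inv)
  also have "\<dots> = (LINT z|gauss. h (T z))" by (rule integral_distr) (use hm Tm in auto)
  also have "\<dots> = (LINT z|gauss. q * h z)"
    by (simp add: h_def T_def monomial_scale q_def mult_ac)
  also have "\<dots> = - (LINT z|gauss. h z)" by (simp add: q)
  finally have "(LINT z|gauss. h z) = 0" by simp
  then show ?thesis by (simp add: L2_ip h_def)
qed

lemma monomial_nrm: "nrm (L2_space gauss) (monomial k) > 0"
proof -
  have "nrm (L2_space gauss) (monomial k) \<noteq> 0"
  proof
    assume "nrm (L2_space gauss) (monomial k) = 0"
    then have "monomial k (\<chi> j. 1) = 0" using fock_nrm_eq_0[OF monomial_fock] by metis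
    then show False by (simp add: monomial_def)
  qed
  then show ?thesis using L2g.nrm_nonneg[OF fock_L2[OF monomial_fock[of k]]] by simp
qed

text \<open>f w is the inner product of f with a kernel, and the kernel is the sum of the powers of
  \<open>hermitian_dot z w\<close> divided by factorials. These are polynomials, hence orthogonal to
  f, and dominated convergence carries the orthogonality to the kernel.\<close>

lemma monomial_total:
  fixes f :: "complex^'m \<Rightarrow> complex"
  assumes f: "f \<in> fock" and orth: "\<And>k. ip (L2_space gauss) f (monomial k) = 0"
  shows "f = (\<lambda>_. 0)"
proof
  fix w :: "complex^'m"
  have fm: "f \<in> vecs (L2_space gauss)" by (rule fock_L2[OF f])
  have pf: "(\<lambda>z. monomial k z * hermitian_dot z w ^ n) \<in> vecs (L2_space gauss)" for k n
    using monomial_fock[of k]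
    by (intro fock_L2 fockI entire_mult entire_power entire_hermitian_dot exp_type_mult exp_type_power
        exp_type_hermitian_dot exp_type_monomial) (simp add: fock_iff)
  \<comment> \<open>The monomial factor strengthens the induction: expanding one factor of the power
    raises one exponent of the monomial and lowers n. Only k = 0 is used afterwards.\<close>
  have zero: "ip (L2_space gauss) f (\<lambda>z. monomial k z * hermitian_dot z w ^ n) = 0" for k n
  proof (induction n arbitrary: k)
    case (Suc n)
    let ?k = "\<lambda>j. \<chi> i. if i = j then Suc (k $ i) else k $ i"
    have "monomial k z * hermitian_dot z w ^ Suc n =
        (\<Sum>j\<in>UNIV. cnj (w $ j) * (monomial (?k j) z * hermitian_dot z w ^ n))" for z
    proof -
      have "monomial k z * hermitian_dot z w ^ Suc n =
          (\<Sum>j\<in>UNIV. cnj (w $ j) * ((z $ j * monomial k z) * hermitian_dot z w ^ n))"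
        by (simp add: hermitian_dot_def[of z w] sum_distrib_left sum_distrib_right mult_ac)
      then show ?thesis unfolding monomial_mult_component .
    qed
    then show ?case
      by (simp add: L2g.ip_sum_right[OF finite pf fm] Suc)
  qed (simp add: orth)
  define S where "S N z = (\<Sum>n<N. f z * cnj (monomial 0 z * hermitian_dot z w ^ n) / fact n)" for N z
  have mono0: "monomial 0 z = 1" for z by (simp add: monomial_def)
  have "(\<lambda>N. LINT z|gauss. S N z) \<longlonglongrightarrow> (LINT z|gauss. f z * cnj (kernel w z))"
  proof (rule integral_dominated_convergence)
    show "integrable gauss (\<lambda>z. cmod (f z) * exp (norm w * norm z))"
      by (rule integrable_mult_exp_norm[OF fm])
    show "(\<lambda>z. f z * cnj (kernel w z)) \<in> borel_measurable gauss"
      using L2_integrable_mult[OF fm kernel_L2] by (rule borel_measurable_integrable)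
    show "S N \<in> borel_measurable gauss" for N
      unfolding S_def
      by (intro borel_measurable_sum borel_measurable_divide borel_measurable_const
          borel_measurable_integrable L2_integrable_mult fm pf)
    have "(\<lambda>N. S N z) \<longlonglongrightarrow> f z * cnj (kernel w z)" for z
    proof -
      have "(\<lambda>N. f z * (\<Sum>n<N. cnj (hermitian_dot z w) ^ n /\<^sub>R fact n)) \<longlonglongrightarrow> f z * exp (cnj (hermitian_dot z w))"
        by (intro tendsto_mult tendsto_const exp_converges[unfolded sums_def])
      then show ?thesis
        by (simp add: S_def mono0 kernel_def exp_cnj sum_distrib_left scaleR_conv_of_real divide_inverse mult_ac)
    qed
    then show "AE z in gauss. (\<lambda>N. S N z) \<longlonglongrightarrow> f z * cnj (kernel w z)" by simp
    have "norm (S N z) \<le> cmod (f z) * exp (norm w * norm z)" for N z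
    proof -
      have "norm (S N z) \<le> (\<Sum>n<N. cmod (f z) * ((cmod (hermitian_dot z w)) ^ n /\<^sub>R fact n))"
        unfolding S_def
        by (rule sum_norm_le) (simp add: mono0 norm_mult norm_divide norm_power norm_inverse norm_fact divide_inverse mult_ac)
      also have "\<dots> = cmod (f z) * (\<Sum>n<N. (cmod (hermitian_dot z w)) ^ n /\<^sub>R fact n)"
        by (simp add: sum_distrib_left)
      also have "\<dots> \<le> cmod (f z) * exp (cmod (hermitian_dot z w))"
      proof (rule mult_left_mono)
        show "(\<Sum>n<N. (cmod (hermitian_dot z w)) ^ n /\<^sub>R fact n) \<le> exp (cmod (hermitian_dot z w))"
          unfolding exp_def by (rule sum_le_suminf[OF summable_exp_generic]) auto
      qed simp
      also have "\<dots> \<le> cmod (f z) * exp (norm w * norm z)"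
        using cmod_hermitian_dot_le[of z w] by (intro mult_left_mono) (auto simp: mult.commute)
      finally show ?thesis .
    qed
    then show "AE z in gauss. norm (S N z) \<le> cmod (f z) * exp (norm w * norm z)" for N by simp
  qed
  moreover have "(LINT z|gauss. S N z) = 0" for N
  proof -
    have "(LINT z|gauss. S N z) =
        (\<Sum>n<N. (LINT z|gauss. f z * cnj (monomial 0 z * hermitian_dot z w ^ n) / fact n))"
      unfolding S_def
      by (rule Bochner_Integration.integral_sum) (intro integrable_divide L2_integrable_mult fm pf)
    also have "\<dots> = (\<Sum>n<N. ip (L2_space gauss) f (\<lambda>z. monomial 0 z * hermitian_dot z w ^ n) / fact n)"
      by (simp add: L2_ip)
    finally show ?thesis by (simp add: zero)
  qed
  ultimately have "(LINT z|gauss. f z * cnj (kernel w z)) = 0"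
    by (simp add: LIMSEQ_const_iff)
  then show "f w = 0" using fock_reproducing[OF f, of w] by (simp add: L2_ip)
qed

text \<open>The scalar is 1 / sqrt (k_1! ... k_m!), kept as an abstract norm.\<close>

definition fock_basis :: "nat^'m \<Rightarrow> complex^'m \<Rightarrow> complex" where
  "fock_basis k = (\<lambda>z. complex_of_real (1 / nrm (L2_space gauss) (monomial k)) * monomial k z)"

lemma fock_basis_fock: "fock_basis k \<in> fock"
  unfolding fock_basis_def by (intro fock_scale monomial_fock)

lemma orthonormal_basis_fock: "orthonormal_basis fock_space fock_basis"
proof
  show "hilbert fock_space" by (rule hilbert_fock)
  show "fock_basis k \<in> vecs fock_space" for k by (simp add: fock_basis_fock)
  show "ip fock_space (fock_basis k) (fock_basis l) = (if k = l then 1 else 0)" for k l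
  proof -
    have m: "monomial k \<in> vecs (L2_space gauss)" for k by (intro fock_L2 monomial_fock)
    have "ip (L2_space gauss) (fock_basis k) (fock_basis l) =
        complex_of_real (1 / nrm (L2_space gauss) (monomial k)) * (complex_of_real (1 / nrm (L2_space gauss) (monomial l)) *
          ip (L2_space gauss) (monomial k) (monomial l))"
      unfolding fock_basis_def
      by (simp only: L2g.ip_scale_left L2g.ip_scale_right m L2_scale complex_cnj_complex_of_real)
    then show ?thesis
      using monomial_nrm[of k] monomial_orthogonal[of k l]
      by (auto simp: L2g.ip_self[OF m] power2_eq_square)
  qed
  fix f assume f: "f \<in> vecs fock_space" and orth: "\<And>k. ip fock_space f (fock_basis k) = 0"
  have "ip (L2_space gauss) f (monomial k) = 0" for k
  proof -
    have "ip (L2_space gauss) f (fock_basis k) =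
        complex_of_real (1 / nrm (L2_space gauss) (monomial k)) * ip (L2_space gauss) f (monomial k)"
      unfolding fock_basis_def using f
      by (simp only: L2g.ip_scale_right fock_L2 monomial_fock fock_space_simps complex_cnj_complex_of_real)
    then show ?thesis using orth[of k] monomial_nrm[of k] by simp
  qed
  then have "f = (\<lambda>_. 0)" using f by (intro monomial_total) auto
  then show "nrm fock_space f = 0" by (simp add: L2g.nrm_zero)
qed

interpretation fock: orthonormal_basis "fock_space :: (complex^'m) ipspace" fock_basis
  by (rule orthonormal_basis_fock)

text \<open>The composition is constructed from its expansion coefficients; this avoids a change of
  variables and gives membership in the Fock space and the coefficient formula at once.\<close>

lemma fock_dilation:
  fixes d :: "complex^'m"
  assumes f: "f \<in> fock" and d: "\<And>j. cmod (d $ j) \<le> 1"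
  shows "(\<lambda>z. f (\<chi> j. d $ j * z $ j)) \<in> fock"
    and "ip (L2_space gauss) (\<lambda>z. f (\<chi> j. d $ j * z $ j)) (fock_basis k) =
      monomial k d * ip (L2_space gauss) f (fock_basis k)"
proof -
  define a where "a k = ip (L2_space gauss) f (fock_basis k)" for k
  have expand: "((\<lambda>k. ip (L2_space gauss) g (fock_basis k) * fock_basis k z) has_sum g z) UNIV"
    if g: "g \<in> fock" for g :: "complex^'m \<Rightarrow> complex" and z
  proof -
    have "cnj (ip (L2_space gauss) (kernel z) (fock_basis k)) = fock_basis k z" for k
      using L2g.ip_commute[OF kernel_L2 fock_L2[OF fock_basis_fock], of k z]
      by (simp add: fock_reproducing fock_basis_fock)
    then show ?thesis
      using fock.parseval[of g "kernel z"] g kernel_fock[of z] by (simp add: fock_reproducing)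
  qed
  have md: "cmod (monomial k d) \<le> 1" for k
    unfolding monomial_def prod_norm[symmetric] using d by (intro prod_le_1) (auto simp: norm_mult norm_power power_le_one)
  have "(\<lambda>k. (cmod (a k))\<^sup>2) summable_on UNIV"
    using fock.coef_summable[of f] f by (simp add: a_def)
  then have "(\<lambda>k. (cmod (monomial k d * a k))\<^sup>2) summable_on UNIV"
  proof (rule summable_on_comparison_test)
    show "(cmod (monomial k d * a k))\<^sup>2 \<le> (cmod (a k))\<^sup>2" for k
      using mult_right_mono[OF md, of "cmod (a k)" k] by (intro power_mono) (auto simp: norm_mult)
  qed simp
  from fock.riesz_fischer[OF this] obtain g where g: "g \<in> fock"
    "\<And>k. ip (L2_space gauss) g (fock_basis k) = monomial k d * a k" by auto
  have "g z = f (\<chi> j. d $ j * z $ j)" for z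
  proof -
    have "((\<lambda>k. monomial k d * a k * fock_basis k z) has_sum g z) UNIV"
      using expand[OF g(1), of z] by (simp add: g(2))
    moreover have "(\<lambda>k. monomial k d * a k * fock_basis k z) =
        (\<lambda>k. a k * fock_basis k (\<chi> j. d $ j * z $ j))"
      by (simp add: fock_basis_def monomial_scale fun_eq_iff)
    moreover have "((\<lambda>k. a k * fock_basis k (\<chi> j. d $ j * z $ j)) has_sum f (\<chi> j. d $ j * z $ j)) UNIV"
      using expand[OF f, of "\<chi> j. d $ j * z $ j"] by (simp add: a_def)
    ultimately show ?thesis by (simp only: has_sum_unique)
  qed
  then have eq: "(\<lambda>z. f (\<chi> j. d $ j * z $ j)) = g" by auto
  show "(\<lambda>z. f (\<chi> j. d $ j * z $ j)) \<in> fock" using g(1) eq by simp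
  show "ip (L2_space gauss) (\<lambda>z. f (\<chi> j. d $ j * z $ j)) (fock_basis k) =
      monomial k d * ip (L2_space gauss) f (fock_basis k)"
    unfolding eq using g(2) by (simp add: a_def)
qed

section \<open>Uniqueness of the Fock representative\<close>

text \<open>An entire function vanishing on a ball of a totally real subspace of maximal dimension is
  extended by zero from real to complex values one coordinate at a time.\<close>

lemma entire_zero_on_real_ball:
  fixes g :: "complex^'m \<Rightarrow> complex"
  assumes g: "entire g" and r: "r > 0"
    and zero: "\<And>\<eta>::real^'m. norm \<eta> < r \<Longrightarrow> g (\<chi> j. complex_of_real (\<eta> $ j)) = 0"
  shows "g z = 0"
proof -
  define \<delta> where "\<delta> = r / (2 * real CARD('m))"
  have d: "\<delta> > 0" using r by (simp add: \<delta>_def)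
  have "g z = 0" if "finite J" "\<And>j. j \<notin> J \<Longrightarrow> \<exists>x. \<bar>x\<bar> < \<delta> \<and> z $ j = complex_of_real x" for J and z :: "complex^'m"
    using that
  proof (induction J arbitrary: z rule: finite_induct)
    case empty
    then obtain x where x: "\<And>j. \<bar>x j\<bar> < \<delta>" "\<And>j. z $ j = complex_of_real (x j)" by (metis empty_iff)
    define \<eta> :: "real^'m" where "\<eta> = (\<chi> j. x j)"
    have "norm \<eta> \<le> (\<Sum>j\<in>UNIV. \<bar>\<eta> $ j\<bar>)" by (rule norm_le_l1_cart)
    also have "\<dots> \<le> (\<Sum>j\<in>(UNIV::'m set). \<delta>)"
      by (intro sum_mono) (simp add: \<eta>_def x less_imp_le)
    also have "\<dots> < r" using r by (simp add: \<delta>_def)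
    finally have "g (\<chi> j. complex_of_real (\<eta> $ j)) = 0" by (rule zero)
    moreover have "(\<chi> j. complex_of_real (\<eta> $ j)) = z" by (simp add: vec_eq_iff \<eta>_def x(2))
    ultimately show ?case by simp
  next
    case (insert j J)
    define a where "a = (\<chi> i. if i = j then 0 else z $ i)"
    define h where "h \<zeta> = g (a + \<zeta> *s axis j 1)" for \<zeta>
    have co: "(a + \<zeta> *s axis j 1) $ i = (if i = j then \<zeta> else z $ i)" for i \<zeta>
      by (simp add: a_def axis_def)
    have hol: "h holomorphic_on UNIV"
      unfolding h_def by (rule entire_line_holomorphic[OF g])
    define U where "U = complex_of_real ` {x. \<bar>x\<bar> < \<delta>}"
    have hU: "h \<zeta> = 0" if \<zeta>: "\<zeta> \<in> U" for \<zeta>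
    proof -
      obtain x where x: "\<bar>x\<bar> < \<delta>" "\<zeta> = complex_of_real x" using \<zeta> by (auto simp: U_def)
      show ?thesis
        unfolding h_def
      proof (rule insert.IH)
        fix i assume "i \<notin> J"
        then show "\<exists>x. \<bar>x\<bar> < \<delta> \<and> (a + \<zeta> *s axis j 1) $ i = complex_of_real x"
          using insert.prems[of i] x unfolding co by (cases "i = j") auto
      qed
    qed
    have lim: "0 islimpt U"
      unfolding islimpt_approachable
    proof (intro allI impI)
      fix e :: real assume e: "e > 0"
      show "\<exists>x'\<in>U. x' \<noteq> 0 \<and> dist x' 0 < e"
      proof (rule bexI[of _ "complex_of_real (min (\<delta> / 2) (e / 2))"])
        show "complex_of_real (min (\<delta> / 2) (e / 2)) \<in> U"
          unfolding U_def using d e by (intro imageI) auto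
      qed (use d e in \<open>auto simp: min_def\<close>)
    qed
    have "h (z $ j) = 0"
      by (rule analytic_continuation[OF hol open_UNIV connected_UNIV subset_UNIV UNIV_I lim hU UNIV_I])
    moreover have "a + (z $ j) *s axis j 1 = z" by (simp only: vec_eq_iff co) auto
    ultimately show ?case by (simp add: h_def)
  qed
  from this[of UNIV z] show ?thesis by simp
qed

text \<open>The chart is onto a relatively open subset of \<open>A \<times> UNIV\<close>, and its
  inverse extends continuously near (p, 0). Fixing the first coordinate p therefore leaves a full
  ball of fibre coordinates. The neighbourhood V' matters because the eigenfunctions are known to be
  linear in y only near A.\<close>

lemma coordinates_near_ball:
  fixes u :: "'a::euclidean_space \<Rightarrow> 'a" and y :: "'a \<Rightarrow> 'b::euclidean_space"
  assumes co: "coordinates_near A V u y" and p: "p \<in> A" and V': "open V'" "A \<subseteq> V'"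
  obtains r where "r > 0" "\<And>\<eta>. norm \<eta> < r \<Longrightarrow> \<exists>x\<in>V'. u x = p \<and> y x = \<eta>"
proof -
  define \<Phi> where "\<Phi> = (\<lambda>x. (u x, y x))"
  define I where "I = the_inv_into V \<Phi>"
  have inj: "inj_on \<Phi> V" and sub: "A \<times> {0} \<subseteq> \<Phi> ` V"
    and op: "openin (top_of_set (A \<times> UNIV)) (\<Phi> ` V)" and sm: "smooth_on_subset (\<Phi> ` V) I"
    and y0: "{x\<in>V. y x = 0} = A"
    using co by (auto simp: coordinates_near_def \<Phi>_def I_def)
  have pV: "(p, 0) \<in> \<Phi> ` V" using sub p by auto
  obtain U g where U: "(p, 0) \<in> U" "smooth_on U g" and gI: "\<And>z. z \<in> U \<inter> \<Phi> ` V \<Longrightarrow> g z = I z"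
    using bspec[OF sm[unfolded smooth_on_subset_def] pV] by metis
  have oU: "open U" and cg: "continuous_on U g"
    using U(2) unfolding smooth_on_def by (auto dest: spec[of _ 0])
  have \<Phi>I: "\<Phi> (I z) = z" "I z \<in> V" if "z \<in> \<Phi> ` V" for z
    using that inj unfolding I_def by (auto simp: f_the_inv_into_f the_inv_into_into)
  have "y (I (p, 0)) = 0" using \<Phi>I(1)[OF pV] by (simp add: \<Phi>_def)
  then have "I (p, 0) \<in> A" using \<Phi>I(2)[OF pV] y0 by blast
  then have gp: "g (p, 0) \<in> V'" using gI[of "(p, 0)"] U(1) pV V'(2) by auto
  have oN: "open (U \<inter> g -` V')"
    using cg oU V'(1) by (rule continuous_open_preimage)
  obtain Q where Q: "open Q" "\<Phi> ` V = (A \<times> UNIV) \<inter> Q"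
    using op by (auto simp: openin_open)
  have "open (Q \<inter> (U \<inter> g -` V'))" using Q(1) oN by blast
  moreover have "(p, 0) \<in> Q \<inter> (U \<inter> g -` V')" using gp U(1) pV Q(2) by auto
  ultimately obtain r where r: "r > 0" "ball (p, 0) r \<subseteq> Q \<inter> (U \<inter> g -` V')"
    by (rule openE)
  show ?thesis
  proof (rule that[OF r(1)])
    fix \<eta> :: 'b assume "norm \<eta> < r"
    then have "(p, \<eta>) \<in> ball (p, 0) r" by (simp add: dist_Pair_Pair)
    then have m: "(p, \<eta>) \<in> Q" "(p, \<eta>) \<in> U" "g (p, \<eta>) \<in> V'" using r(2) by auto
    have pe: "(p, \<eta>) \<in> \<Phi> ` V" using m(1) p Q(2) by auto
    then have "I (p, \<eta>) \<in> V'" using gI[of "(p, \<eta>)"] m by auto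
    moreover have "u (I (p, \<eta>)) = p \<and> y (I (p, \<eta>)) = \<eta>" using \<Phi>I(1)[OF pe] by (simp add: \<Phi>_def)
    ultimately show "\<exists>x\<in>V'. u x = p \<and> y x = \<eta>" by blast
  qed
qed

text \<open>Over one point p of A the values of s are W p applied to a ball of real vectors. The
  difference of f and g composed with W p is entire and vanishes on that ball, hence everywhere, and
  W p is onto.\<close>

lemma principal_eigenfunctions_separate_fock:
  fixes s :: "real^'n \<Rightarrow> complex^'m"
  assumes co: "coordinates_near A V u y" and A: "A \<noteq> {}"
    and pe: "principal_eigenfunctions S A u y s lam"
    and f: "f \<in> fock" and g: "g \<in> fock" and eq: "f \<circ> s = g \<circ> s"
  shows "f = g"
proof
  obtain V' W where V': "open V'" "A \<subseteq> V'" and W: "\<And>p. p \<in> A \<Longrightarrow> invertible (W p)"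
    and s: "\<And>x. x \<in> V' \<Longrightarrow> s x = W (u x) *v (\<chi> j. complex_of_real (y x $ j))"
    using pe unfolding principal_eigenfunctions_def by blast
  obtain p where p: "p \<in> A" using A by blast
  obtain r where r: "r > 0" "\<And>\<eta>. norm \<eta> < r \<Longrightarrow> \<exists>x\<in>V'. u x = p \<and> y x = \<eta>"
    by (rule coordinates_near_ball[OF co p V']) (rule that)
  obtain W' where W': "W p ** W' = mat 1" using W[OF p] unfolding invertible_def by blast
  define h where "h z = f z + (-1) * g z" for z
  have eh: "entire h" unfolding h_def[abs_def]
    using f g by (intro entire_add entire_mult entire_const) (auto simp: fock_iff)
  have "linear ((*v) (W p))"
    by (rule linearI)
       (simp_all add: matrix_vector_right_distrib vec_eq_iff matrix_vector_mult_def scaleR_sum_right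
         distrib_left sum.distrib)
  then have "entire (\<lambda>z. h (W p *v z + 0))"
    by (rule entire_compose_linear[OF eh]) (rule vector_scalar_commute)
  then have "h (W p *v z + 0) = 0" for z
  proof (rule entire_zero_on_real_ball[OF _ r(1)])
    fix \<eta> :: "real^'m" assume "norm \<eta> < r"
    then obtain x where x: "x \<in> V'" "u x = p" "y x = \<eta>" using r(2) by blast
    have "h (s x) = 0" using fun_cong[OF eq, of x] by (simp add: h_def)
    then show "h (W p *v (\<chi> j. complex_of_real (\<eta> $ j)) + 0) = 0" using s[OF x(1)] x by simp
  qed
  from this[of "W' *v z" for z] have "h z = 0" for z
    by (simp add: matrix_vector_mul_assoc W')
  then show "f z = g z" for z by (simp add: h_def)
qed

section \<open>The modulated Fock space\<close>

text \<open>Injectivity of f -> f \<circ> s is the one property of s behind the Hilbert structure: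
  it makes \<open>fock_rep\<close> inverse to composition, and everything is transported from the
  Fock space.\<close>

locale modulated_fock =
  fixes s :: "'a \<Rightarrow> complex^'m"
  assumes separate: "f \<in> fock \<Longrightarrow> g \<in> fock \<Longrightarrow> f \<circ> s = g \<circ> s \<Longrightarrow> f = g"
begin

abbreviation "M \<equiv> modulated_fock_space s"

lemma vecs_M: "\<phi> \<in> vecs M \<longleftrightarrow> (\<exists>f\<in>fock. \<phi> = f \<circ> s)"
  by (auto simp: modulated_fock_space_def)

lemma fock_rep_comp: "f \<in> fock \<Longrightarrow> fock_rep s (f \<circ> s) = f"
  unfolding fock_rep_def using separate by (intro the_equality) auto

lemma ip_M:
  assumes f: "f \<in> fock" and g: "g \<in> fock"
  shows "ip M (f \<circ> s) (g \<circ> s) = ip (L2_space gauss) f g"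
proof -
  have "(\<lambda>z. f z * cnj (g z)) \<in> borel_measurable gauss"
    using L2_integrable_mult[OF fock_L2[OF f] fock_L2[OF g]] by (rule borel_measurable_integrable)
  then have m: "(\<lambda>z. f z * cnj (g z)) \<in> borel_measurable borel"
    by (simp add: measurable_cong_sets[OF sets_gauss refl])
  have "ip (L2_space gauss) f g = (LINT z|lborel. gauss_density z *\<^sub>R (f z * cnj (g z)))"
    unfolding L2_ip by (rule integral_gauss[OF m])
  also have "\<dots> = (LINT z|lborel. complex_of_real (1 / pi ^ CARD('m)) *
      (f z * cnj (g z) * complex_of_real (exp (- (norm z)\<^sup>2))))"
    by (rule Bochner_Integration.integral_cong)
       (simp_all add: gauss_density_def scaleR_conv_of_real)
  also have "\<dots> = complex_of_real (1 / pi ^ CARD('m)) *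
      (LINT z|lborel. f z * cnj (g z) * complex_of_real (exp (- (norm z)\<^sup>2)))"
    by (rule integral_mult_right_zero)
  finally show ?thesis
    by (simp add: modulated_fock_space_def fock_rep_comp f g)
qed

lemma nrm_M: "f \<in> fock \<Longrightarrow> nrm M (f \<circ> s) = nrm (L2_space gauss) f"
  by (simp add: nrm_def ip_M)

lemma comp_add: "(\<lambda>i. (f \<circ> s) i + (g \<circ> s) i) = (\<lambda>z. f z + g z) \<circ> s"
  and comp_scale: "(\<lambda>i. a * (f \<circ> s) i) = (\<lambda>z. a * f z) \<circ> s"
  and comp_diff: "(\<lambda>i. (f \<circ> s) i - (g \<circ> s) i) = (\<lambda>z. f z - g z) \<circ> s"
  by auto

lemma complete_M:
  assumes X: "cauchy_in M X"
  shows "\<exists>\<phi>\<in>vecs M. (\<lambda>n. nrm M (\<lambda>i. X n i - \<phi> i)) \<longlonglongrightarrow> 0"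
proof -
  have "\<forall>n. \<exists>f. f \<in> fock \<and> X n = f \<circ> s" using X by (auto simp: cauchy_in_def vecs_M)
  then obtain f where f: "\<And>n. f n \<in> fock" "\<And>n. X n = f n \<circ> s" by metis
  have nd: "nrm M (\<lambda>i. (g \<circ> s) i - (h \<circ> s) i) = nrm (L2_space gauss) (\<lambda>z. g z - h z)"
    if "g \<in> fock" "h \<in> fock" for g h
    unfolding comp_diff using fock.diff_vec[of g h] that by (intro nrm_M) simp
  have "cauchy_in fock_space f"
    unfolding cauchy_in_def
  proof (intro conjI allI impI)
    show "f n \<in> vecs fock_space" for n by (simp add: f)
    fix e :: real assume "e > 0"
    then obtain N where "\<forall>m\<ge>N. \<forall>n\<ge>N. nrm M (\<lambda>i. X m i - X n i) < e"
      using X unfolding cauchy_in_def by blast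
    then show "\<exists>N. \<forall>m\<ge>N. \<forall>n\<ge>N. nrm fock_space (\<lambda>i. f m i - f n i) < e"
      unfolding f(2) nd[OF f(1) f(1)] fock_space_simps by blast
  qed
  then obtain g where g: "g \<in> fock" "(\<lambda>n. nrm (L2_space gauss) (\<lambda>z. f n z - g z)) \<longlonglongrightarrow> 0"
    using fock_complete by blast
  show ?thesis
  proof (rule bexI[of _ "g \<circ> s"])
    show "(\<lambda>n. nrm M (\<lambda>i. X n i - (g \<circ> s) i)) \<longlonglongrightarrow> 0"
      unfolding f(2) nd[OF f(1) g(1)] by (rule g(2))
  qed (use g(1) vecs_M in auto)
qed

lemma hilbert_M: "hilbert M"
  unfolding hilbert_def
proof (intro conjI allI ballI impI)
  show "(\<lambda>_. 0) \<in> vecs M"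
    unfolding vecs_M by (rule bexI[of _ "\<lambda>_. 0"]) (auto simp: fock_const)
  fix \<phi> assume "\<phi> \<in> vecs M"
  then obtain f where f: "f \<in> fock" "\<phi> = f \<circ> s" unfolding vecs_M by blast
  show "(\<lambda>i. a * \<phi> i) \<in> vecs M" for a
    unfolding f(2) comp_scale vecs_M using fock_scale[OF f(1)] by blast
  show "0 \<le> Re (ip M \<phi> \<phi>)"
    unfolding f(2) ip_M[OF f(1) f(1)] by (rule L2g.ip_nonneg[OF fock_L2[OF f(1)]])
  fix \<psi> assume "\<psi> \<in> vecs M"
  then obtain g where g: "g \<in> fock" "\<psi> = g \<circ> s" unfolding vecs_M by blast
  show "(\<lambda>i. \<phi> i + \<psi> i) \<in> vecs M"
    unfolding f(2) g(2) comp_add vecs_M using fock_add[OF f(1) g(1)] by blast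
  show "ip M (\<lambda>i. a * \<phi> i) \<psi> = a * ip M \<phi> \<psi>" for a
    unfolding f(2) g(2) comp_scale using f g
    by (simp only: ip_M fock_scale L2g.ip_scale_left fock_L2)
  show "ip M \<psi> \<phi> = cnj (ip M \<phi> \<psi>)"
    unfolding f(2) g(2) ip_M[OF f(1) g(1)] ip_M[OF g(1) f(1)]
    by (rule L2g.ip_commute[OF fock_L2[OF f(1)] fock_L2[OF g(1)]])
  fix \<theta> assume "\<theta> \<in> vecs M"
  then obtain h where h: "h \<in> fock" "\<theta> = h \<circ> s" unfolding vecs_M by blast
  show "ip M (\<lambda>i. \<phi> i + \<psi> i) \<theta> = ip M \<phi> \<theta> + ip M \<psi> \<theta>"
    unfolding f(2) g(2) h(2) comp_add using f g h
    by (simp only: ip_M fock_add L2g.ip_add_left fock_L2)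
qed (rule complete_M)

lemma rkhs_M: "rkhs M (\<lambda>z w. exp (hermitian_dot (s z) (s w)))"
proof -
  have K: "(\<lambda>z. exp (hermitian_dot (s z) (s w))) = kernel (s w) \<circ> s" for w
    by (auto simp: kernel_def)
  have "\<phi> = (\<lambda>_. 0)" if \<phi>: "\<phi> \<in> vecs M" "nrm M \<phi> = 0" for \<phi>
  proof -
    obtain f where f: "f \<in> fock" "\<phi> = f \<circ> s" using \<phi>(1) unfolding vecs_M by blast
    have "f = (\<lambda>_. 0)" by (rule fock_nrm_eq_0[OF f(1)]) (use \<phi>(2) f in \<open>simp add: nrm_M\<close>)
    then show ?thesis using f(2) by auto
  qed
  moreover have "\<phi> w = ip M \<phi> (kernel (s w) \<circ> s)" if "\<phi> \<in> vecs M" for \<phi> w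
    using that by (auto simp: vecs_M ip_M kernel_fock fock_reproducing)
  moreover have "kernel (s w) \<circ> s \<in> vecs M" for w
    using kernel_fock vecs_M by blast
  ultimately show ?thesis unfolding rkhs_def K using hilbert_M by blast
qed

lemma off_attractor_space_eq: "off_attractor_space s = M"
proof -
  have "{(\<lambda>x. \<phi> x + c) | \<phi> c. \<phi> \<in> vecs M} = vecs M"
  proof (intro equalityI subsetI)
    fix \<psi> assume "\<psi> \<in> {(\<lambda>x. \<phi> x + c) | \<phi> c. \<phi> \<in> vecs M}"
    then obtain f c where f: "f \<in> fock" "\<psi> = (\<lambda>x. (f \<circ> s) x + c)" unfolding vecs_M by blast
    then have "\<psi> = (\<lambda>z. f z + c) \<circ> s" by auto
    then show "\<psi> \<in> vecs M" unfolding vecs_M using fock_add[OF f(1) fock_const] by blast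
  next
    fix \<psi> assume \<psi>: "\<psi> \<in> vecs M"
    have "\<psi> = (\<lambda>x. \<psi> x + 0)" by simp
    then show "\<psi> \<in> {(\<lambda>x. \<phi> x + c) | \<phi> c. \<phi> \<in> vecs M}" using \<psi> by blast
  qed
  then show ?thesis by (simp add: off_attractor_space_def)
qed

definition basis :: "nat^'m \<Rightarrow> 'a \<Rightarrow> complex" where
  "basis k = fock_basis k \<circ> s"

lemma orthonormal_basis_M: "orthonormal_basis M basis"
proof
  show "hilbert M" by (rule hilbert_M)
  show "basis k \<in> vecs M" for k
    unfolding basis_def vecs_M using fock_basis_fock by blast
  show "ip M (basis k) (basis l) = (if k = l then 1 else 0)" for k l
    unfolding basis_def ip_M[OF fock_basis_fock fock_basis_fock]
    using fock.e_orth[of k l] by simp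
  fix \<phi> assume \<phi>: "\<phi> \<in> vecs M" and orth: "\<And>k. ip M \<phi> (basis k) = 0"
  obtain f where f: "f \<in> fock" "\<phi> = f \<circ> s" using \<phi> unfolding vecs_M by blast
  have "nrm fock_space f = 0"
    by (rule fock.e_total)
       (use f orth in \<open>auto simp: basis_def ip_M fock_basis_fock\<close>)
  then show "nrm M \<phi> = 0" using f by (simp add: nrm_M)
qed

text \<open>If T acts on the values of s as the dilation by d, then composition with T acts on Fock
  representatives as that dilation, which is diagonal in the monomials.\<close>

lemma
  fixes d :: "complex^'m"
  assumes \<phi>: "\<phi> \<in> vecs M" and d: "\<And>j. cmod (d $ j) \<le> 1"
    and T: "\<And>x. s (T x) = (\<chi> j. d $ j * s x $ j)"
  shows dilation_vec: "\<phi> \<circ> T \<in> vecs M"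
    and dilation_coefficient: "ip M (\<phi> \<circ> T) (basis k) = monomial k d * ip M \<phi> (basis k)"
proof -
  obtain f where f: "f \<in> fock" "\<phi> = f \<circ> s" using \<phi> unfolding vecs_M by blast
  define f' where "f' = (\<lambda>z. f (\<chi> j. d $ j * z $ j))"
  have f': "f' \<in> fock" unfolding f'_def by (rule fock_dilation(1)[OF f(1) d])
  have eq: "\<phi> \<circ> T = f' \<circ> s" by (auto simp: f(2) f'_def T)
  show "\<phi> \<circ> T \<in> vecs M" unfolding eq vecs_M using f' by blast
  show "ip M (\<phi> \<circ> T) (basis k) = monomial k d * ip M \<phi> (basis k)"
    unfolding eq basis_def ip_M[OF f' fock_basis_fock]
    unfolding f(2) ip_M[OF f(1) fock_basis_fock] f'_def by (rule fock_dilation(2)[OF f(1) d])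
qed

end

section \<open>Spectra\<close>

lemma (in seminormed_space) eigenvalue_in_spectrum:
  assumes T: "bounded_operator H T" and f: "f \<in> vecs H" "nrm H f \<noteq> 0" "T f = (\<lambda>i. z * f i)"
  shows "z \<in> spectrum H T"
proof (rule ccontr)
  assume "z \<notin> spectrum H T"
  then obtain C where "bounded_inverse H (\<lambda>g i. T g i - z * g i) C"
    using not_in_spectrum_iff[OF T] by blast
  then have "nrm H f \<le> C * nrm H (\<lambda>i. T f i - z * f i)"
    using f(1) unfolding bounded_inverse_def by blast
  then show False using f nrm_nonneg[OF f(1)] by (simp add: nrm_zero)
qed

text \<open>The complex numbers as a Hilbert space of functions on one point. With this space and
  the identity as first factor, any space with an orthonormal basis is a direct sum in the sense of
  \<open>diagonal_operator\<close>, so the spectrum of a diagonal operator on it comes from the same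
  theorem.\<close>

definition scalars :: "unit ipspace" where
  "scalars = \<lparr>vecs = UNIV, ip = (\<lambda>f g. f () * cnj (g ()))\<rparr>"

lemma scalars_simps [simp]: "vecs scalars = UNIV" "nrm scalars f = cmod (f ())"
  by (simp_all add: scalars_def nrm_def complex_mult_cnj cmod_def)

interpretation scalars: complete_seminormed_space scalars
proof
  fix X :: "nat \<Rightarrow> unit \<Rightarrow> complex" assume "cauchy_in scalars X"
  then have "Cauchy (\<lambda>n. X n ())" by (simp add: cauchy_in_def Cauchy_def dist_norm)
  then obtain l where "(\<lambda>n. X n ()) \<longlonglongrightarrow> l" using Cauchy_convergent_iff convergent_def by blast
  then have "(\<lambda>n. cmod (X n () - l)) \<longlonglongrightarrow> 0" by (simp add: LIM_zero tendsto_norm_zero)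
  then show "\<exists>f\<in>vecs scalars. (\<lambda>n. nrm scalars (\<lambda>i. X n i - f i)) \<longlonglongrightarrow> 0"
    by (intro bexI[of _ "\<lambda>_. l"]) auto
qed (auto simp: norm_mult norm_triangle_ineq)

lemma spectrum_scalars_id: "spectrum scalars (\<lambda>f. f) = {1}"
proof -
  have id: "bounded_operator scalars (\<lambda>f. f)"
    by (auto simp: bounded_operator_def intro: exI[of _ 1])
  have "1 \<in> spectrum scalars (\<lambda>f. f)"
    by (rule scalars.eigenvalue_in_spectrum[OF id, of "\<lambda>_. 1"]) auto
  moreover have "z \<notin> spectrum scalars (\<lambda>f. f)" if z: "z \<noteq> 1" for z
  proof -
    have "bounded_inverse scalars (\<lambda>g i. g i - z * g i) (1 / cmod (1 - z))"
      unfolding bounded_inverse_def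
    proof (intro conjI ballI)
      fix g :: "unit \<Rightarrow> complex"
      have "g () - z * g () = (1 - z) * g ()" by (simp add: algebra_simps)
      then show "nrm scalars g \<le> 1 / cmod (1 - z) * nrm scalars (\<lambda>i. g i - z * g i)"
        using z by (simp add: norm_mult)
      have "g () / (1 - z) - z * (g () / (1 - z)) = (1 - z) * (g () / (1 - z))"
        by (simp only: left_diff_distrib mult_1_left)
      also have "\<dots> = g ()" using z by simp
      finally show "\<exists>f\<in>vecs scalars. veq scalars (\<lambda>i. f i - z * f i) g"
        by (intro bexI[of _ "\<lambda>_. g () / (1 - z)"]) (simp_all add: veq_def)
    qed
    then show ?thesis
      using z by (subst scalars.not_in_spectrum_iff[OF id]) (intro exI[of _ "1 / cmod (1 - z)"], simp)
  qed
  ultimately show ?thesis by blast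
qed

lemma (in orthonormal_basis) spectrum_diagonal_basis:
  assumes T: "\<And>\<phi>. \<phi> \<in> vecs H \<Longrightarrow> T \<phi> \<in> vecs H"
    and diag: "\<And>k \<phi>. \<phi> \<in> vecs H \<Longrightarrow> ip H (T \<phi>) (e k) = c k * ip H \<phi> (e k)"
    and c: "\<And>k. cmod (c k) \<le> 1" "\<And>k. c k \<noteq> 0"
    and fin: "\<And>r. r > 0 \<Longrightarrow> finite {c k | k. cmod (c k) > r}"
  shows "spectrum H T = closure (range c)"
proof -
  interpret D: diagonal_operator scalars H "\<lambda>f. f" T c "\<lambda>k \<phi> _. ip H \<phi> (e k)"
  proof
    fix F :: "'k \<Rightarrow> unit \<Rightarrow> complex"
    assume "(\<lambda>k. (nrm scalars (F k))\<^sup>2) summable_on UNIV"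
    then obtain \<phi> where "\<phi> \<in> vecs H" "\<And>k. ip H \<phi> (e k) = F k ()"
      using riesz_fischer[of "\<lambda>k. F k ()"] by auto
    then show "\<exists>X\<in>vecs H. \<forall>k. veq scalars (\<lambda>_. ip H X (e k)) (F k)"
      by (intro bexI[of _ \<phi>]) (auto simp: veq_def)
  qed (auto simp: T c diag veq_def ip_add_left ip_scale_left e_vec parseval_nrm)
  have "spectrum H T = closure {c k * a |k a. a \<in> spectrum scalars (\<lambda>f. f)}"
    by (rule D.spectrum_diagonal) (use fin spectrum_scalars_id in auto)
  also have "{c k * a |k a. a \<in> spectrum scalars (\<lambda>f. f)} = range c"
    unfolding spectrum_scalars_id by auto
  finally show ?thesis .
qed

section \<open>The Koopman operator on L^2 and the eigenvalues on monomials\<close>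

lemma koopman_measure_preserving:
  assumes sets: "sets \<mu> = sets borel" and m: "S t \<in> borel_measurable borel"
    and inv: "distr \<mu> borel (S t) = \<mu>" and f: "f \<in> vecs (L2_space \<mu>)"
  shows "koopman S t f \<in> vecs (L2_space \<mu>)" "nrm (L2_space \<mu>) (koopman S t f) = nrm (L2_space \<mu>) f"
proof -
  have fm: "f \<in> borel_measurable borel"
    using L2_measurable[OF f] by (simp add: measurable_cong_sets[OF sets refl])
  have Sm: "S t \<in> measurable \<mu> borel" using m by (simp add: measurable_cong_sets[OF sets refl])
  have nm: "(\<lambda>x. (cmod (f x))\<^sup>2) \<in> borel_measurable borel" using fm by measurable
  have "integrable (distr \<mu> borel (S t)) (\<lambda>x. (cmod (f x))\<^sup>2)" using f by (simp add: inv L2_vecs)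
  then have "integrable \<mu> (\<lambda>x. (cmod (f (S t x)))\<^sup>2)"
    by (subst (asm) integrable_distr_eq[OF Sm nm])
  moreover have "(\<lambda>x. f (S t x)) \<in> borel_measurable \<mu>" by (rule measurable_compose[OF Sm fm])
  ultimately show "koopman S t f \<in> vecs (L2_space \<mu>)" by (simp add: L2_vecs koopman_def o_def)
  have "(LINT x|\<mu>. (cmod (f x))\<^sup>2) = (LINT x|distr \<mu> borel (S t). (cmod (f x))\<^sup>2)" by (simp add: inv)
  also have "\<dots> = (LINT x|\<mu>. (cmod (f (S t x)))\<^sup>2)" by (rule integral_distr[OF Sm nm])
  finally show "nrm (L2_space \<mu>) (koopman S t f) = nrm (L2_space \<mu>) f"
    by (simp add: nrm_def L2_ip_self koopman_def)
qed

lemma monomial_exp: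
  fixes lam :: "complex^'m"
  shows "monomial k (\<chi> j. exp (lam $ j * a)) = exp ((\<Sum>j\<in>UNIV. of_nat (k $ j) * lam $ j) * a)"
  unfolding monomial_def
  by (simp add: exp_of_nat_mult[symmetric] exp_sum[symmetric] sum_distrib_right mult.assoc)

text \<open>All real parts have the same sign, so nothing cancels in the exponent and a lower bound
  on the modulus bounds every k_j. At t = 0 the indices are unrestricted, but the only value is
  1.\<close>

lemma finite_large_monomials:
  fixes lam :: "complex^'m"
  assumes lam: "\<And>j. Re (lam $ j) < 0" and t: "t \<ge> 0" and r: "r > 0"
  shows "finite {monomial k (\<chi> j. exp (lam $ j * complex_of_real t)) | k. cmod (monomial k (\<chi> j. exp (lam $ j * complex_of_real t))) > r}"
proof (cases "t = 0")
  case True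
  show ?thesis by (rule finite_subset[of _ "{1}"]) (auto simp: True monomial_def)
next
  case False
  then have t: "t > 0" using t by simp
  \<comment> \<open>Each summand k_j |Re lam_j| t is nonnegative and their sum is less than |ln r|,
    which gives this bound on k_j.\<close>
  define N where "N j = nat \<lceil>\<bar>ln r\<bar> / (- Re (lam $ j) * t)\<rceil>" for j
  have "k \<in> vec_lambda ` (\<Pi>\<^sub>E j\<in>UNIV. {..N j})"
    if k: "cmod (monomial k (\<chi> j. exp (lam $ j * complex_of_real t))) > r" for k :: "nat^'m"
  proof -
    have "Re ((\<Sum>j\<in>UNIV. of_nat (k $ j) * lam $ j) * complex_of_real t) =
        (\<Sum>j\<in>UNIV. real (k $ j) * Re (lam $ j) * t)"
      by (simp add: sum_distrib_right)
    then have "r < exp (\<Sum>j\<in>UNIV. real (k $ j) * Re (lam $ j) * t)"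
      using k unfolding monomial_exp norm_exp_eq_Re by simp
    then have "ln r < (\<Sum>j\<in>UNIV. real (k $ j) * Re (lam $ j) * t)"
      using r ln_less_cancel_iff[OF r exp_gt_zero] by simp
    moreover have "(\<Sum>j\<in>UNIV. real (k $ j) * (- Re (lam $ j) * t)) =
        - (\<Sum>j\<in>UNIV. real (k $ j) * Re (lam $ j) * t)"
      by (simp add: sum_negf mult.assoc)
    ultimately have sum: "(\<Sum>j\<in>UNIV. real (k $ j) * (- Re (lam $ j) * t)) < \<bar>ln r\<bar>"
      by linarith
    have pos: "- Re (lam $ i) * t > 0" for i using lam[of i] t by (simp add: mult_neg_pos)
    have "k $ i \<le> N i" for i
    proof -
      have "real (k $ i) * (- Re (lam $ i) * t) \<le> (\<Sum>j\<in>UNIV. real (k $ j) * (- Re (lam $ j) * t))"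
        by (rule member_le_sum) (simp_all only: UNIV_I finite mult_nonneg_nonneg of_nat_0_le_iff less_imp_le[OF pos])
      then have "real (k $ i) \<le> \<bar>ln r\<bar> / (- Re (lam $ i) * t)"
        unfolding pos_le_divide_eq[OF pos] using sum by linarith
      then show ?thesis unfolding N_def by linarith
    qed
    then have "vec_nth k \<in> (\<Pi>\<^sub>E j\<in>UNIV. {..N j})" by (auto simp: PiE_def)
    then show ?thesis by (metis image_eqI vec_nth_inverse)
  qed
  moreover have "finite (vec_lambda ` (\<Pi>\<^sub>E j\<in>(UNIV::'m set). {..N j}))"
    by (intro finite_imageI finite_PiE) auto
  ultimately show ?thesis
    by (intro finite_subset[OF _ finite_imageI[of "vec_lambda ` (\<Pi>\<^sub>E j\<in>(UNIV::'m set). {..N j})"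
          "\<lambda>k. monomial k (\<chi> j. exp (lam $ j * complex_of_real t))"]]) auto
qed

text \<open>The off-attractor spectrum is the closure of the set of eigenvalues, including its limit
  points, while the tensor theorem produces products with the eigenvalues themselves. Multiplication
  by a fixed number is continuous, so the closures of both product sets agree.\<close>

lemma closure_setprod: "closure (setprod E (closure C)) = closure (setprod E C)"
proof
  have "setprod E (closure C) \<subseteq> closure (setprod E C)"
  proof
    fix x assume "x \<in> setprod E (closure C)"
    then obtain a b where x: "x = a * b" "a \<in> E" "b \<in> closure C" by (auto simp: setprod_def)
    have "(\<lambda>b. a * b) ` closure C \<subseteq> closure (setprod E C)"
    proof (rule image_closure_subset)
      show "(\<lambda>b. a * b) ` C \<subseteq> closure (setprod E C)"
        using x(2) closure_subset[of "setprod E C"] by (auto simp: setprod_def)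
    qed (auto intro!: continuous_intros)
    then show "x \<in> closure (setprod E C)" using x by blast
  qed
  then show "closure (setprod E (closure C)) \<subseteq> closure (setprod E C)"
    by (rule closure_minimal) simp
  show "closure (setprod E C) \<subseteq> closure (setprod E (closure C))"
    by (rule closure_mono) (use closure_subset in \<open>auto simp: setprod_def\<close>)
qed

theorem theorem6p8:
  fixes F :: "real^'n \<Rightarrow> real^'n"
    and S :: "real \<Rightarrow> real^'n \<Rightarrow> real^'n"
    and A :: "(real^'n) set"
    and u :: "real^'n \<Rightarrow> real^'n"
    and y :: "real^'n \<Rightarrow> real^'m"
    and \<mu> :: "(real^'n) measure"
    and s :: "real^'n \<Rightarrow> complex^'m"
    and lam :: "complex^'m"
    and t :: real
  assumes "flow_of F S"
    and "milnor_attractor S A"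
    and "globally_stable S A"
    and "sell_type_attractor F S A u y"
    and "invariant_physical_measure S A \<mu>"
    and "principal_eigenfunctions S A u y s lam"
    and "\<And>j. Re (lam $ j) < 0"
    and "t \<ge> 0"
  shows "rkhs (modulated_fock_space s) (\<lambda>z w. exp (hermitian_dot (s z) (s w)))
    \<and> spectrum (L2_space \<mu> \<otimes>\<^sub>H off_attractor_space s) (koopman S t \<otimes>\<^sub>o koopman S t) =
      closure (setprod (spectrum (L2_space \<mu>) (koopman S t))
                       (spectrum (off_attractor_space s) (koopman S t)))
    \<and> closure (setprod (spectrum (L2_space \<mu>) (koopman S t))
                          (spectrum (off_attractor_space s) (koopman S t))) =
      closure (setprod (spectrum (L2_space \<mu>) (koopman S t))
        {exp ((\<Sum>j\<in>UNIV. of_nat (k $ j) * lam $ j) * complex_of_real t) | k :: nat^'m. True})"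
proof -
  \<comment> \<open>A point of A is needed as the base of a fibre. The Milnor condition provides it:
    the realm of attraction of the empty set is empty, hence negligible.\<close>
  have ne: "A \<noteq> {}"
  proof
    assume "A = {}"
    have "x \<notin> realm_of_attraction S {}" for x
      unfolding realm_of_attraction_def by (auto intro!: exI[of _ "{}"])
    then have "realm_of_attraction S A = {}" using \<open>A = {}\<close> by blast
    then show False using assms(2) by (simp add: milnor_attractor_def)
  qed
  obtain V where co: "coordinates_near A V u y"
    using assms(4) unfolding sell_type_attractor_def by blast
  interpret modulated_fock s
    by standard (rule principal_eigenfunctions_separate_fock[OF co ne assms(6)])
  interpret B: orthonormal_basis "modulated_fock_space s" basis by (rule orthonormal_basis_M)
  interpret \<mu>: prob_space \<mu> using assms(5) by (simp add: invariant_physical_measure_def)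
  interpret TS: tensor_slices "L2_space \<mu>" "modulated_fock_space s" basis
    by standard (rule hilbert_L2)
  define d where "d = (\<chi> j. exp (lam $ j * complex_of_real t))"
  \<comment> \<open>Negative real parts and t \<ge> 0 make the dilation a contraction, which keeps
    the composed functions in the Fock space.\<close>
  have d1: "cmod (d $ j) \<le> 1" for j
    using assms(7)[of j] assms(8) by (simp add: d_def mult_nonpos_nonneg)
  have sT: "s (S t x) = (\<chi> j. d $ j * s x $ j)" for x
  proof -
    have "koopman S t (\<lambda>x. s x $ j) x = exp (lam $ j * complex_of_real t) * s x $ j" for j
      using assms(6,8) unfolding principal_eigenfunctions_def koopman_eigenfunction_def by metis
    then show ?thesis by (simp add: vec_eq_iff koopman_def d_def)
  qed
  define c where "c k = monomial k d" for k
  have c_eq: "c k = exp ((\<Sum>j\<in>UNIV. of_nat (k $ j) * lam $ j) * complex_of_real t)" for k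
    unfolding c_def d_def by (rule monomial_exp)
  have c1: "cmod (c k) \<le> 1" for k
    unfolding c_def monomial_def prod_norm[symmetric]
    using d1 by (intro prod_le_1) (auto simp: norm_power power_le_one)
  have c0: "c k \<noteq> 0" for k by (simp add: c_eq)
  have fin: "finite {c k | k. cmod (c k) > r}" if "r > 0" for r
    unfolding c_def d_def by (rule finite_large_monomials[OF assms(7,8) that])
  have Kv: "koopman S t \<phi> \<in> vecs (modulated_fock_space s)" if "\<phi> \<in> vecs (modulated_fock_space s)" for \<phi>
    unfolding koopman_def by (rule dilation_vec[OF that d1 sT])
  have Kc: "ip (modulated_fock_space s) (koopman S t \<phi>) (basis k) = c k * ip (modulated_fock_space s) \<phi> (basis k)"
    if "\<phi> \<in> vecs (modulated_fock_space s)" for \<phi> k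
    unfolding koopman_def c_def by (rule dilation_coefficient[OF that d1 sT])
  have St: "S t \<in> borel_measurable borel"
  proof (rule borel_measurable_continuous_onI)
    have "continuous_on ({0..} \<times> UNIV) (\<lambda>(t, x). S t x)"
      using assms(1) by (simp add: flow_of_def)
    moreover have "continuous_on UNIV (\<lambda>x::real^'n. (t, x))" by (intro continuous_intros)
    ultimately have "continuous_on UNIV (\<lambda>x. case (t, x) of (t, x) \<Rightarrow> S t x)"
      by (rule continuous_on_compose2) (use assms(8) in auto)
    then show "continuous_on UNIV (S t)" by simp
  qed
  have inv: "sets \<mu> = sets borel" "distr \<mu> borel (S t) = \<mu>"
    using assms(5,8) by (auto simp: invariant_physical_measure_def)
  note K = koopman_measure_preserving[where S = S and t = t and \<mu> = \<mu>, OF inv(1) St inv(2)]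
  interpret D: diagonal_operator "L2_space \<mu>" "L2_space \<mu> \<otimes>\<^sub>H modulated_fock_space s"
    "koopman S t" "koopman S t \<otimes>\<^sub>o koopman S t" c TS.component
    by (rule TS.tensor_diagonal[OF K(1) _ _ eq_refl[OF K(2)] Kv Kc c1 c0])
       (simp_all add: koopman_def o_def)
  \<comment> \<open>The constant function is fixed by composition with the flow and has norm 1,
    since the measure is a probability measure.\<close>
  have one: "1 \<in> spectrum (L2_space \<mu>) (koopman S t)"
  proof (rule TS.H.eigenvalue_in_spectrum[OF D.U_bounded])
    show "(\<lambda>_. 1) \<in> vecs (L2_space \<mu>)" by (simp add: L2_vecs)
    show "nrm (L2_space \<mu>) (\<lambda>_. 1) \<noteq> 0" by (simp add: nrm_def L2_ip_self \<mu>.prob_space)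
  qed (simp add: koopman_def o_def)
  have "spectrum (L2_space \<mu> \<otimes>\<^sub>H modulated_fock_space s) (koopman S t \<otimes>\<^sub>o koopman S t) =
      closure {c k * a |k a. a \<in> spectrum (L2_space \<mu>) (koopman S t)}"
    by (rule D.spectrum_diagonal[OF one fin])
  also have "{c k * a |k a. a \<in> spectrum (L2_space \<mu>) (koopman S t)} =
      setprod (spectrum (L2_space \<mu>) (koopman S t)) (range c)"
    unfolding setprod_def by (auto simp: mult.commute)
  finally have tensor: "spectrum (L2_space \<mu> \<otimes>\<^sub>H modulated_fock_space s) (koopman S t \<otimes>\<^sub>o koopman S t) =
      closure (setprod (spectrum (L2_space \<mu>) (koopman S t)) (range c))" .
  have off: "spectrum (modulated_fock_space s) (koopman S t) = closure (range c)"
    by (rule B.spectrum_diagonal_basis[OF Kv Kc c1 c0 fin])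
  have range_c: "{exp ((\<Sum>j\<in>UNIV. of_nat (k $ j) * lam $ j) * complex_of_real t) | k :: nat^'m. True} = range c"
    by (auto simp: c_eq)
  show ?thesis
    unfolding range_c off_attractor_space_eq off closure_setprod tensor using rkhs_M by simp
qed

end
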